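(* Let $\epsilon_0>0$ and $\mu_0\in\mathcal{P}(\mathbb{S}^1)$. For $0<\nu<\epsilon_0$ let $\mu_t^\nu$ and $\mu_t$, $t\ge0$, denote the gradient flows in $\mathcal{P}(\mathbb{S}^1)$ of the energy functionals $\mathcal{F}_\nu$ and $\mathcal{F}_0$, respectively, with the same initial datum $\mu_0$. Then $\mu_t^\nu\to\mu_t$ in $\mathcal{P}(\mathbb{S}^1)$, locally uniformly in $t\in[0,\infty)$, as $\nu\to0^+$; that is, for every $T>0$, $\sup_{t\in[0,T]}\mathbf{d}_{per}(\mu_t^\nu,\mu_t)\to0$ as $\nu\to0^+$.
   Context: $\mathbb{S}^1=\mathbb{R}/2\pi\mathbb{Z}$, identified with $[-\pi,\pi)$ when convenient; $d_{per}(x,y)=\min_{k\in\mathbb{Z}}|x-y+2\pi k|$ is the geodesic distance. $\mathcal{P}(\mathbb{S}^1)$ is the set of Borel probability measures on $\mathbb{S}^1$, endowed with the periodic $2$-Wasserstein distance $$\mathbf{d}_{per}^2(\mu,\rho)=\inf\Big\{\int_{\mathbb{S}^1\times\mathbb{S}^1}d_{per}^2(x,y)\,d\gamma(x,y):\gamma\in\Gamma(\mu,\rho)\Big\},$$ where $\Gamma(\mu,\rho)$ is the set of probability measures on $\mathbb{S}^1\times\mathbb{S}^1$ with marginals $\mu$ and $\rho$. $\mathcal{P}_{ac}(\mathbb{S}^1)$ is the subset of measures absolutely continuous with respect to Lebesgue measure; such measures are identified with their densities. Interaction kernel: $W(x)=-\frac1\pi\log|\sin(x/2)|$ for $x\in\mathbb{R}\setminus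 2\pi\mathbb{Z}$ and $W(x)=+\infty$ for $x\in2\pi\mathbb{Z}$. Free energy: $\mathcal{F}_0[\mu]=\iint_{[-\pi,\pi)^2}W(x-y)\,d\mu(x)d\mu(y)$ for $\mu\in\mathcal{P}(\mathbb{S}^1)$. Entropy: $\mathcal{U}[\mu]=\int_{[-\pi,\pi)}\mu\log\mu\,dx$ if $\mu\in\mathcal{P}_{ac}(\mathbb{S}^1)$ and $\mathcal{U}[\mu]=+\infty$ otherwise. For $\nu>0$, $\mathcal{F}_\nu[\mu]=\nu\,\mathcal{U}[\mu]+\mathcal{F}_0[\mu]$ (so $\mathcal{F}_\nu[\mu]=+\infty$ if $\mu\notin\mathcal{P}_{ac}(\mathbb{S}^1)$). The domain is $D(\mathcal{F}_\nu)=\{\mu\in\mathcal{P}(\mathbb{S}^1):\mathcal{F}_\nu[\mu]<\infty\}$. Gradient flow: for $\nu\ge0$, in the sense of the metric theory of Ambrosio–Gigli–Savaré for ($0$-)convex functionals, the gradient flow of $\mathcal{F}_\nu$ with initial datum $\mu_0$ is the unique curve $\mu:[0,\infty)\to\mathcal{P}(\mathbb{S}^1)$, locally absolutely continuous on $(0,\infty)$, with $\mu(t)\to\mu(0)=\mu_0$ as $t\to0^+$, satisfying $$\frac12\frac{d}{dt}\mathbf{d}_{per}^2(\mu(t),\rho)+\mathcal{F}_\nu[\mu(t)]\le\mathcal{F}_\nu[\rho]\quad\text{for a.e. }t>0\text{ and all }\rho\in D(\mathcal{F}_\nu).$$ Equivalently, it is the locally uniform limit, as $\tau\to0^+$, of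 the piecewise constant discrete solutions $\mu_{\nu,\tau}(t)=\mu^k_{\nu,\tau}$ for $t\in[k\tau,(k+1)\tau)$, where $\mu^0_{\nu,\tau}=\mu_0$ and $\mu^k_{\nu,\tau}$ is the unique minimizer over $\rho\in\mathcal{P}(\mathbb{S}^1)$ of $\frac1{2\tau}\mathbf{d}_{per}^2(\mu^{k-1}_{\nu,\tau},\rho)+\mathcal{F}_\nu[\rho]$. *)

theory Defs
  imports "HOL-Probability.Probability"
begin

section \<open>The circle\<close>

text \<open>The circle is identified with \<open>[-\<pi>, \<pi>)\<close>. Its Borel sets, for the quotient topology, are
  exactly the Borel subsets of this interval, so only the distance has to be made periodic.\<close>

definition S1 :: "real measure" where
  "S1 = restrict_space borel {-pi..<pi}"

definition leb_S1 :: "real measure" where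
  "leb_S1 = restrict_space lborel {-pi..<pi}"

definition d_per :: "real \<Rightarrow> real \<Rightarrow> real" where
  "d_per x y = (INF k::int. \<bar>x - y + 2 * pi * of_int k\<bar>)"

definition P_S1 :: "real measure set" where
  "P_S1 = {\<mu>. prob_space \<mu> \<and> sets \<mu> = sets S1}"


section \<open>The periodic Wasserstein distance\<close>

definition couplings :: "real measure \<Rightarrow> real measure \<Rightarrow> (real \<times> real) measure set" where
  "couplings \<mu> \<rho> = {\<gamma>. prob_space \<gamma> \<and> sets \<gamma> = sets (S1 \<Otimes>\<^sub>M S1) \<and>
      distr \<gamma> S1 fst = \<mu> \<and> distr \<gamma> S1 snd = \<rho>}"

definition W_per :: "real measure \<Rightarrow> real measure \<Rightarrow> real" where
  "W_per \<mu> \<rho> = sqrt (INF \<gamma>\<in>couplings \<mu> \<rho>. \<integral>z. (d_per (fst z) (snd z))\<^sup>2 \<partial>\<gamma>)"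

text \<open>The infimum defining \<open>d_per\<close> is a minimum, the integrand above is bounded and measurable, and
  the infimum defining \<open>W_per\<close> is over a nonempty set; in particular \<open>W_per\<close> is bounded by \<open>\<pi>\<close>.\<close>

lemma d_per_eq_round:
  "d_per x y = \<bar>x - y - 2 * pi * of_int (round ((x - y) / (2 * pi)))\<bar>"
proof -
  let ?z = "(x - y) / (2 * pi)"
  have scale: "\<bar>x - y + 2 * pi * of_int k\<bar> = 2 * pi * \<bar>?z - of_int (- k)\<bar>" for k :: int
  proof -
    have "x - y + 2 * pi * of_int k = (2 * pi) * (?z - of_int (- k))"
      by (simp add: field_simps)
    then show ?thesis by (simp only: abs_mult) simp
  qed
  have "d_per x y = \<bar>x - y + 2 * pi * of_int (- round ?z)\<bar>"
    unfolding d_per_def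
  proof (rule cInf_eq_minimum)
    fix w assume "w \<in> range (\<lambda>k::int. \<bar>x - y + 2 * pi * of_int k\<bar>)"
    then obtain k :: int where w: "w = \<bar>x - y + 2 * pi * of_int k\<bar>" by auto
    have "\<bar>?z - of_int (round ?z)\<bar> \<le> \<bar>?z - of_int (- k)\<bar>"
      by (rule round_diff_minimal)
    then show "\<bar>x - y + 2 * pi * of_int (- round ?z)\<bar> \<le> w"
      unfolding w scale by simp
  qed blast
  then show ?thesis by simp
qed

lemma d_per_attained: "\<exists>k::int. d_per x y = \<bar>x - y + 2 * pi * of_int k\<bar>"
  by (rule exI[of _ "- round ((x - y) / (2 * pi))"]) (simp add: d_per_eq_round)

lemma d_per_nonneg: "0 \<le> d_per x y"
  by (simp add: d_per_eq_round)

lemma d_per_le_pi: "d_per x y \<le> pi"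
proof -
  let ?z = "(x - y) / (2 * pi)"
  have "x - y - 2 * pi * of_int (round ?z) = 2 * pi * (?z - of_int (round ?z))"
    by (simp add: field_simps)
  then have "d_per x y = 2 * pi * \<bar>?z - of_int (round ?z)\<bar>"
    unfolding d_per_eq_round by (simp only: abs_mult) simp
  also have "\<dots> \<le> 2 * pi * (1 / 2)"
    using of_int_round_abs_le[of ?z] by (intro mult_left_mono) (auto simp: abs_minus_commute)
  finally show ?thesis by simp
qed

lemma measurable_d_per:
  "(\<lambda>z. d_per (fst z) (snd z)) \<in> borel_measurable (S1 \<Otimes>\<^sub>M S1)"
proof -
  have "S1 \<Otimes>\<^sub>M S1 \<rightarrow>\<^sub>M borel \<supseteq> borel \<Otimes>\<^sub>M borel \<rightarrow>\<^sub>M (borel :: real measure)"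
  proof
    fix f :: "real \<times> real \<Rightarrow> real" assume f: "f \<in> borel \<Otimes>\<^sub>M borel \<rightarrow>\<^sub>M borel"
    have id: "(\<lambda>x. x) \<in> S1 \<rightarrow>\<^sub>M borel"
      unfolding S1_def by (rule measurable_restrict_space1) simp
    have "(\<lambda>z. (fst z, snd z)) \<in> S1 \<Otimes>\<^sub>M S1 \<rightarrow>\<^sub>M borel \<Otimes>\<^sub>M borel"
      using measurable_compose[OF measurable_fst id] measurable_compose[OF measurable_snd id]
      by (intro measurable_Pair) auto
    from measurable_compose[OF this f] show "f \<in> S1 \<Otimes>\<^sub>M S1 \<rightarrow>\<^sub>M borel" by simp
  qed
  moreover have "(\<lambda>z. d_per (fst z) (snd z)) \<in> borel \<Otimes>\<^sub>M borel \<rightarrow>\<^sub>M borel"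
    unfolding d_per_eq_round round_def by measurable
  ultimately show ?thesis by blast
qed

lemma couplings_nonempty:
  assumes "\<mu> \<in> P_S1" "\<rho> \<in> P_S1"
  shows "\<mu> \<Otimes>\<^sub>M \<rho> \<in> couplings \<mu> \<rho>"
proof -
  have p: "prob_space \<mu>" "prob_space \<rho>" and s: "sets \<mu> = sets S1" "sets \<rho> = sets S1"
    using assms by (auto simp: P_S1_def)
  interpret A: prob_space \<mu> by (rule p)
  interpret B: prob_space \<rho> by (rule p)
  interpret pair_prob_space \<mu> \<rho> ..
  have sp: "sets (\<mu> \<Otimes>\<^sub>M \<rho>) = sets (S1 \<Otimes>\<^sub>M S1)"
    using s by (rule sets_pair_measure_cong)
  have fst: "distr (\<mu> \<Otimes>\<^sub>M \<rho>) S1 fst = \<mu>"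
  proof (rule measure_eqI)
    fix X assume "X \<in> sets (distr (\<mu> \<Otimes>\<^sub>M \<rho>) S1 fst)"
    then have X: "X \<in> sets S1" by simp
    have "fst -` X \<inter> space (\<mu> \<Otimes>\<^sub>M \<rho>) = X \<times> space \<rho>"
      using sets.sets_into_space[of X \<mu>] X s by (auto simp: space_pair_measure)
    moreover have "fst \<in> \<mu> \<Otimes>\<^sub>M \<rho> \<rightarrow>\<^sub>M S1"
      using measurable_fst measurable_cong_sets[OF refl s(1)] by blast
    ultimately show "emeasure (distr (\<mu> \<Otimes>\<^sub>M \<rho>) S1 fst) X = emeasure \<mu> X"
      using X s B.emeasure_pair_measure_Times[of X \<mu> "space \<rho>"] sets.top[of \<rho>]
      by (simp add: emeasure_distr B.emeasure_space_1 del: sets.top)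
  qed (simp add: s)
  have snd: "distr (\<mu> \<Otimes>\<^sub>M \<rho>) S1 snd = \<rho>"
  proof (rule measure_eqI)
    fix X assume "X \<in> sets (distr (\<mu> \<Otimes>\<^sub>M \<rho>) S1 snd)"
    then have X: "X \<in> sets S1" by simp
    have "snd -` X \<inter> space (\<mu> \<Otimes>\<^sub>M \<rho>) = space \<mu> \<times> X"
      using sets.sets_into_space[of X \<rho>] X s by (auto simp: space_pair_measure)
    moreover have "snd \<in> \<mu> \<Otimes>\<^sub>M \<rho> \<rightarrow>\<^sub>M S1"
      using measurable_snd measurable_cong_sets[OF refl s(2)] by blast
    ultimately show "emeasure (distr (\<mu> \<Otimes>\<^sub>M \<rho>) S1 snd) X = emeasure \<rho> X"
      using X s B.emeasure_pair_measure_Times[of "space \<mu>" \<mu> X] sets.top[of \<mu>]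
      by (simp add: emeasure_distr A.emeasure_space_1 del: sets.top)
  qed (simp add: s)
  show ?thesis
    unfolding couplings_def using sp fst snd prob_space_axioms by simp
qed

lemma W_per_le_pi:
  assumes "\<mu> \<in> P_S1" "\<rho> \<in> P_S1"
  shows "W_per \<mu> \<rho> \<le> pi"
proof -
  let ?c = "\<lambda>\<gamma>. \<integral>z. (d_per (fst z) (snd z))\<^sup>2 \<partial>\<gamma>"
  let ?g = "\<mu> \<Otimes>\<^sub>M \<rho>"
  have g: "?g \<in> couplings \<mu> \<rho>" using assms by (rule couplings_nonempty)
  then interpret prob_space ?g by (simp add: couplings_def)
  have "(INF \<gamma>\<in>couplings \<mu> \<rho>. ?c \<gamma>) \<le> ?c ?g"
    by (rule cINF_lower[OF _ g]) (auto intro!: bdd_belowI2[where m = 0] Bochner_Integration.integral_nonneg)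
  also have "\<dots> \<le> (\<integral>z. pi\<^sup>2 \<partial>?g)"
  proof (rule integral_mono)
    have "(\<lambda>z. (d_per (fst z) (snd z))\<^sup>2) \<in> borel_measurable ?g"
      using g measurable_d_per measurable_cong_sets[of ?g "S1 \<Otimes>\<^sub>M S1" borel borel]
      by (auto simp: couplings_def)
    then show "integrable ?g (\<lambda>z. (d_per (fst z) (snd z))\<^sup>2)"
      by (rule integrable_const_bound[where B = "pi\<^sup>2", rotated])
        (simp add: power_mono d_per_nonneg d_per_le_pi)
  qed (auto simp: power_mono d_per_nonneg d_per_le_pi)
  also have "\<dots> = pi\<^sup>2" by (simp add: prob_space)
  finally show ?thesis
    unfolding W_per_def by (intro real_le_lsqrt) auto
qed


section \<open>The energy functionals\<close>

definition W_ker :: "real \<Rightarrow> ereal" where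
  "W_ker x = (if \<exists>k::int. x = 2 * pi * of_int k then \<infinity>
              else ereal (- (1 / pi) * ln \<bar>sin (x / 2)\<bar>))"

lemma W_ker_nonneg: "0 \<le> W_ker x"
proof (cases "\<exists>k::int. x = 2 * pi * of_int k")
  case False
  have "sin (x / 2) \<noteq> 0"
  proof
    assume "sin (x / 2) = 0"
    then obtain k :: int where "x / 2 = of_int k * pi" by (auto simp: sin_zero_iff_int2)
    then have "x = 2 * pi * of_int k" by simp
    with False show False by blast
  qed
  then have "ln \<bar>sin (x / 2)\<bar> \<le> 0" by (simp add: abs_sin_le_one)
  with False show ?thesis by (auto simp: W_ker_def divide_nonpos_pos)
qed (auto simp: W_ker_def)

text \<open>Since \<open>W_ker\<close> is nonnegative, \<open>e2ennreal\<close> loses nothing.\<close>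

definition F0 :: "real measure \<Rightarrow> ereal" where
  "F0 \<mu> = enn2ereal (\<integral>\<^sup>+z. e2ennreal (W_ker (fst z - snd z)) \<partial>(\<mu> \<Otimes>\<^sub>M \<mu>))"

text \<open>The integral of \<open>\<mu> log \<mu>\<close> is the difference of the integrals of its positive and negative
  parts. It lies in \<open>(-\<infinity>, \<infinity>]\<close>, as the negative part is at most \<open>1/e\<close>.\<close>

definition entropy_S1 :: "real measure \<Rightarrow> ereal" where
  "entropy_S1 \<mu> =
    (if absolutely_continuous leb_S1 \<mu> then
       (let f = (\<lambda>x. enn2real (RN_deriv leb_S1 \<mu> x)) in
          enn2ereal (\<integral>\<^sup>+x. ennreal (f x * ln (f x)) \<partial>leb_S1)
        - enn2ereal (\<integral>\<^sup>+x. ennreal (- (f x * ln (f x))) \<partial>leb_S1))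
     else \<infinity>)"

definition F_energy :: "real \<Rightarrow> real measure \<Rightarrow> ereal" where
  "F_energy \<nu> \<mu> = (if \<nu> = 0 then F0 \<mu> else ereal \<nu> * entropy_S1 \<mu> + F0 \<mu>)"

definition dom_S1 :: "(real measure \<Rightarrow> ereal) \<Rightarrow> real measure set" where
  "dom_S1 \<Phi> = {\<mu> \<in> P_S1. \<Phi> \<mu> < \<infinity>}"


section \<open>Metric gradient flows\<close>

text \<open>Local absolute continuity on \<open>(0, \<infinity>)\<close> of a curve in a metric space, in the sense of
  Ambrosio, Gigli and Savare.\<close>

definition loc_abs_cont :: "(real \<Rightarrow> real measure) \<Rightarrow> bool" where
  "loc_abs_cont \<mu> \<longleftrightarrow>
    (\<forall>a b. 0 < a \<and> a \<le> b \<longrightarrow>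
      (\<exists>m :: real \<Rightarrow> real. set_integrable lborel {a..b} m \<and>
        (\<forall>s t. a \<le> s \<and> s \<le> t \<and> t \<le> b \<longrightarrow>
           W_per (\<mu> s) (\<mu> t) \<le> set_lebesgue_integral lborel {s..t} m)))"

text \<open>The evolution variational inequality. As usual, the exceptional null set of times may depend
  on the reference measure \<open>\<rho>\<close>. The existence of the derivative is part of the condition; it is
  automatic at almost every time for locally absolutely continuous curves.\<close>

definition gradient_flow ::
  "(real measure \<Rightarrow> ereal) \<Rightarrow> real measure \<Rightarrow> (real \<Rightarrow> real measure) \<Rightarrow> bool" where
  "gradient_flow \<Phi> \<mu>\<^sub>0 \<mu> \<longleftrightarrow>
    (\<forall>t\<ge>0. \<mu> t \<in> P_S1) \<and>
    \<mu> 0 = \<mu>\<^sub>0 \<and>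
    ((\<lambda>t. W_per (\<mu> t) \<mu>\<^sub>0) \<longlongrightarrow> 0) (at_right 0) \<and>
    loc_abs_cont \<mu> \<and>
    (\<forall>\<rho>\<in>dom_S1 \<Phi>. AE t in lborel. 0 < t \<longrightarrow>
       (\<exists>D. ((\<lambda>s. (W_per (\<mu> s) \<rho>)\<^sup>2) has_real_derivative D) (at t) \<and>
            ereal (D / 2) + \<Phi> (\<mu> t) \<le> \<Phi> \<rho>))"

end

theory Submission
  imports Defs "HOL-Complex_Analysis.Cauchy_Integral_Formula" "HOL-Real_Asymp.Real_Asymp"
begin

text \<open>Write \<open>\<rho>\<^sub>r\<close> for the convolution of \<open>\<rho>\<close> with the Poisson kernel \<open>P\<^sub>r\<close>, where \<open>0 < r < 1\<close>. The potential
  \<open>W * P\<^sub>r\<close> is bounded and at most \<open>W - ln r / (2 \<pi>)\<close>, so \<open>F\<^sub>0 \<rho>\<^sub>r \<le> F\<^sub>0 \<rho> - ln r / \<pi>\<close>, while the entropy and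
  the interaction energy of \<open>\<rho>\<^sub>r\<close> are bounded in terms of \<open>r\<close> alone and \<open>\<rho>\<^sub>r\<close> is close to \<open>\<rho>\<close>.

  Let \<open>u\<close> and \<open>v\<close> be the flows of \<open>F\<^sub>\<nu>\<close> and \<open>F\<^sub>0\<close>. On a time step of length \<open>\<delta>\<close>, test the integrated
  variational inequality of \<open>u\<close> with \<open>(v s)\<^sub>r\<close> and that of \<open>v\<close> with \<open>u (s + \<delta>)\<close>. Adding up, half the squared
  distance of the flows grows by at most the sum of \<open>\<delta> (F\<^sub>0 (v s) + F\<^sub>0 (u (s + \<delta>)))\<close>, minus the integrals
  of the energies over the step, plus errors controlled by \<open>r\<close> and \<open>\<nu>\<close>. Summed over all steps and
  averaged over the offset of the time grid, the energies cancel except on two boundary cells. Their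
  contribution there, like the moduli of continuity of the flows, is small with \<open>\<delta>\<close> uniformly in \<open>\<nu>\<close>:
  test with the mollified starting point. It remains to choose first \<open>\<delta>\<close>, then \<open>r\<close> and finally \<open>\<nu>\<close>.\<close>

section \<open>Absolutely continuous functions with nonpositive derivative\<close>

text \<open>The two flows cannot be tested directly against each other:
  \<open>F_energy \<nu>\<close> is infinite at a measure without a density, and \<open>v s\<close>
  is not known to have one. In the other direction there is no such obstacle, because the entropy is
  bounded below and hence \<open>F0\<close> is at most \<open>F_energy \<nu>\<close> plus a multiple
  of \<nu>. This is why only one of the two reference measures is mollified. The Poisson kernel is
  the mollifier because the logarithmic kernel is a boundary value of a harmonic function: its
  smoothing is explicit, and the energy rises by an additive constant that vanishes as r tends to 1.
  The pair of flows is moved along a corner: u first, with v frozen at the start of the step, then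
  v, with u frozen at its end. So the energies appear at opposite ends of the step. The order in
  which the parameters are chosen is forced: about T/\<delta> steps each pay a transport error of
  order sqrt (1 - r), so \<delta> must precede r, and the entropy of a mollified measure is only
  bounded by a multiple of (1 - r)^(-4), so r must precede \<nu>.\<close>

text \<open>Henstock's lemma is applied to \<open>m\<close> set to \<open>0\<close> on the exceptional set \<open>N\<close>: for tags in \<open>N\<close> it
  bounds the sum of the integrals of \<open>m\<close> over their intervals, hence the increments of \<open>f\<close> there.\<close>

lemma nonincreasing_if_ac_deriv_nonpos:
  fixes f m :: "real \<Rightarrow> real"
  assumes ab: "a \<le> b" and m: "m integrable_on {a..b}"
    and bd: "\<And>s t. a \<le> s \<Longrightarrow> s \<le> t \<Longrightarrow> t \<le> b \<Longrightarrow> f t - f s \<le> integral {s..t} m"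
    and N: "negligible N"
    and der: "\<And>t. t \<in> {a..b} - N \<Longrightarrow> \<exists>D\<le>0. (f has_real_derivative D) (at t within {a..b})"
  shows "f b \<le> f a"
proof (rule field_le_epsilon)
  fix e0 :: real assume "e0 > 0"
  \<comment> \<open>The part \<open>e * (b - a)\<close> pays for the tags where \<open>f\<close> is
    differentiable, the part \<open>e\<close> for the Henstock error.\<close>
  define e where "e = e0 / (b - a + 1)"
  have e: "e > 0" using ab \<open>e0 > 0\<close> by (simp add: e_def)
  have "e * (b - a) + e = e * (b - a + 1)" by (simp add: algebra_simps)
  then have e0: "e * (b - a) + e = e0" using ab by (simp add: e_def)
  define m' where "m' t = (if t \<in> N then 0 else m t)" for t
  have m'int: "integral K m' = integral K m" for K
    by (rule integral_spike[OF N]) (auto simp: m'_def)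
  have m'I: "m' integrable_on cbox a b"
    unfolding cbox_interval by (rule integrable_spike[OF m N]) (auto simp: m'_def)
  obtain \<gamma> where \<gamma>: "gauge \<gamma>"
    "\<And>p. \<lbrakk>p tagged_partial_division_of (cbox a b); \<gamma> fine p\<rbrakk> \<Longrightarrow>
             (\<Sum>(x,k)\<in>p. norm (measure lborel k *\<^sub>R m' x - integral k m')) < e"
    using Henstock_lemma[OF m'I e] by blast
  \<comment> \<open>Straddle form of differentiability: the endpoints lie on either side of the tag,
    so the error is relative to \<open>v - u\<close> and sums to \<open>e * (b - a)\<close> over a
    division.\<close>
  have "\<exists>d>0. \<forall>u v. t \<in> {a..b} - N \<longrightarrow> a \<le> u \<longrightarrow> u \<le> t \<longrightarrow> t \<le> v \<longrightarrow> v \<le> b \<longrightarrow>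
      u \<in> ball t d \<longrightarrow> v \<in> ball t d \<longrightarrow> f v - f u \<le> e * (v - u)" for t
  proof (cases "t \<in> {a..b} - N")
    case True
    then obtain D where D: "D \<le> 0" "(f has_real_derivative D) (at t within {a..b})"
      using der by blast
    from D(2) obtain d where d: "d > 0"
      "\<And>y. y \<in> {a..b} \<Longrightarrow> norm (y - t) < d \<Longrightarrow> norm (f y - f t - D * (y - t)) \<le> e * norm (y - t)"
      unfolding has_field_derivative_def has_derivative_within_alt using e by auto
    have "f v - f u \<le> e * (v - u)" if "a \<le> u" "u \<le> t" "t \<le> v" "v \<le> b" "u \<in> ball t d" "v \<in> ball t d" for u v
    proof -
      have 1: "norm (f u - f t - D * (u - t)) \<le> e * norm (u - t)"
        using that by (intro d(2)) (auto simp: dist_real_def)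
      have 2: "norm (f v - f t - D * (v - t)) \<le> e * norm (v - t)"
        using that by (intro d(2)) (auto simp: dist_real_def)
      have "f v - f u \<le> e * (v - u) + D * (v - u)"
        using 1 2 that by (simp add: abs_le_iff algebra_simps)
      moreover have "D * (v - u) \<le> 0" using D(1) that by (intro mult_nonpos_nonneg) auto
      ultimately show ?thesis by simp
    qed
    with d(1) show ?thesis by blast
  qed (auto intro!: exI[of _ 1])
  then obtain d where d: "\<And>t. d t > 0"
    "\<And>t u v. t \<in> {a..b} - N \<Longrightarrow> a \<le> u \<Longrightarrow> u \<le> t \<Longrightarrow> t \<le> v \<Longrightarrow> v \<le> b \<Longrightarrow>
      u \<in> ball t (d t) \<Longrightarrow> v \<in> ball t (d t) \<Longrightarrow> f v - f u \<le> e * (v - u)"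
    by metis
  have "gauge (\<lambda>t. \<gamma> t \<inter> ball t (d t))"
    using \<gamma>(1) d(1) by (intro gauge_Int) (auto simp: gauge_def)
  then obtain p where p: "p tagged_division_of {a..b}" "(\<lambda>t. \<gamma> t \<inter> ball t (d t)) fine p"
    by (rule fine_division_exists_real)
  have fine: "\<gamma> fine p" "(\<lambda>t. ball t (d t)) fine p" using p(2) by (auto simp: fine_Int)
  have part: "p tagged_partial_division_of cbox a b"
    using p(1) by (simp add: tagged_division_of_def)
  have "f b - f a = (\<Sum>(x,K)\<in>p. f (Sup K) - f (Inf K))"
    using additive_tagged_division_1[OF ab p(1), of f] by simp
  also have "\<dots> \<le> (\<Sum>(x,K)\<in>p. e * measure lborel K + norm (measure lborel K *\<^sub>R m' x - integral K m'))"
  proof (rule sum_mono, clarify)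
    fix x K assume xK: "(x, K) \<in> p"
    from p(1) xK have K: "x \<in> K" "K \<subseteq> {a..b}" by (auto dest: tagged_division_ofD)
    from p(1) xK obtain u v where uv: "K = {u..v}"
      by (metis box_real(2) tagged_division_ofD(4))
    have le: "u \<le> x" "x \<le> v" "a \<le> u" "v \<le> b" using K uv by auto
    have S: "Sup K = v" "Inf K = u" using uv le by auto
    have cont: "measure lborel K = v - u" using uv le by simp
    show "f (Sup K) - f (Inf K) \<le> e * measure lborel K + norm (measure lborel K *\<^sub>R m' x - integral K m')"
    proof (cases "x \<in> N")
      case True
      have "f v - f u \<le> integral K m" using bd[of u v] le uv by simp
      also have "\<dots> \<le> norm (measure lborel K *\<^sub>R m' x - integral K m')"
        using True by (simp add: m'int m'_def[of x])
      also have "\<dots> \<le> e * measure lborel K + \<dots>" using e cont le by simp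
      finally show ?thesis using S by simp
    next
      case False
      have "K \<subseteq> ball x (d x)" using fine(2) xK by (auto simp: fine_def)
      moreover have "u \<in> K" "v \<in> K" using uv le by auto
      ultimately have "u \<in> ball x (d x)" "v \<in> ball x (d x)" by blast+
      then have "f v - f u \<le> e * (v - u)"
        using d(2)[of x u v] False le by auto
      then show ?thesis unfolding S cont using norm_ge_zero[of "(v - u) *\<^sub>R m' x - integral K m'"] by linarith
    qed
  qed
  also have "\<dots> = e * (\<Sum>(x,K)\<in>p. measure lborel K) + (\<Sum>(x,K)\<in>p. norm (measure lborel K *\<^sub>R m' x - integral K m'))"
    by (simp add: sum.distrib sum_distrib_left split_beta)
  also have "(\<Sum>(x,K)\<in>p. measure lborel K) = b - a"
    using additive_content_tagged_division[of p a b] p(1) ab by simp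
  also have "(\<Sum>(x,K)\<in>p. norm (measure lborel K *\<^sub>R m' x - integral K m')) \<le> e"
    using \<gamma>(2)[OF part fine(1)] by simp
  finally show "f b \<le> f a + e0" using e0 by simp
qed

section \<open>The metric space of probability measures on the circle\<close>

lemma space_S1: "space S1 = {-pi..<pi}"
  by (simp add: S1_def space_restrict_space)

lemma d_per_commute: "d_per x y = d_per y x"
proof -
  have le: "d_per y x \<le> d_per x y" for x y
  proof -
    obtain k :: int where "d_per x y = \<bar>x - y + 2 * pi * of_int k\<bar>" using d_per_attained by blast
    also have "\<dots> = \<bar>y - x + 2 * pi * of_int (- k)\<bar>" by simp
    also have "\<dots> \<ge> d_per y x"
      unfolding d_per_def by (rule cINF_lower) (auto intro!: bdd_belowI2[where m = 0])
    finally show ?thesis .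
  qed
  show ?thesis using le[of x y] le[of y x] by simp
qed

lemma d_per_le_shift: "d_per x y \<le> \<bar>x - y + 2 * pi * of_int k\<bar>"
  unfolding d_per_def by (rule cINF_lower) (auto intro!: bdd_belowI2[where m = 0])

lemma d_per_le_dist: "d_per x y \<le> \<bar>x - y\<bar>"
  using d_per_le_shift[of x y 0] by simp

lemma d_per_triangle: "d_per x z \<le> d_per x y + d_per y z"
proof -
  obtain k :: int where k: "d_per x y = \<bar>x - y + 2 * pi * of_int k\<bar>" using d_per_attained by blast
  obtain l :: int where l: "d_per y z = \<bar>y - z + 2 * pi * of_int l\<bar>" using d_per_attained by blast
  have "d_per x z \<le> \<bar>x - z + 2 * pi * of_int (k + l)\<bar>" by (rule d_per_le_shift)
  also have "\<dots> = \<bar>(x - y + 2 * pi * of_int k) + (y - z + 2 * pi * of_int l)\<bar>"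
    by (simp add: algebra_simps)
  also have "\<dots> \<le> d_per x y + d_per y z" unfolding k l by (rule abs_triangle_ineq)
  finally show ?thesis .
qed

lemma couplingsD:
  assumes "\<gamma> \<in> couplings \<mu> \<rho>"
  shows "prob_space \<gamma>" "sets \<gamma> = sets (S1 \<Otimes>\<^sub>M S1)" "distr \<gamma> S1 fst = \<mu>" "distr \<gamma> S1 snd = \<rho>"
    "space \<gamma> = {-pi..<pi} \<times> {-pi..<pi}"
proof -
  show "prob_space \<gamma>" "distr \<gamma> S1 fst = \<mu>" "distr \<gamma> S1 snd = \<rho>" and s: "sets \<gamma> = sets (S1 \<Otimes>\<^sub>M S1)"
    using assms by (auto simp: couplings_def)
  show "space \<gamma> = {-pi..<pi} \<times> {-pi..<pi}"
    using sets_eq_imp_space_eq[OF s] by (simp add: space_pair_measure space_S1)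
qed

lemma couplings_measurable:
  assumes "\<gamma> \<in> couplings \<mu> \<rho>"
  shows "fst \<in> \<gamma> \<rightarrow>\<^sub>M S1" "snd \<in> \<gamma> \<rightarrow>\<^sub>M S1" "(\<lambda>z. d_per (fst z) (snd z)) \<in> borel_measurable \<gamma>"
  using couplingsD(2)[OF assms] measurable_d_per by (auto cong: measurable_cong_sets)

lemma measurable_d_per_compose [measurable (raw)]:
  assumes "f \<in> M \<rightarrow>\<^sub>M S1" "g \<in> M \<rightarrow>\<^sub>M S1"
  shows "(\<lambda>x. d_per (f x) (g x)) \<in> borel_measurable M"
  using measurable_compose[OF measurable_Pair[OF assms] measurable_d_per] by simp

lemma bounded_d_per_integrable:
  assumes "prob_space M" "f \<in> M \<rightarrow>\<^sub>M S1" "g \<in> M \<rightarrow>\<^sub>M S1"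
  shows "integrable M (\<lambda>x. d_per (f x) (g x))" "integrable M (\<lambda>x. (d_per (f x) (g x))\<^sup>2)"
proof -
  interpret prob_space M by fact
  note [measurable] = assms(2,3)
  show "integrable M (\<lambda>x. d_per (f x) (g x))"
    by (rule integrable_const_bound[where B = pi]) (auto simp: d_per_nonneg d_per_le_pi)
  show "integrable M (\<lambda>x. (d_per (f x) (g x))\<^sup>2)"
    by (rule integrable_const_bound[where B = "pi\<^sup>2"]) (auto simp: d_per_nonneg d_per_le_pi power_mono)
qed

definition cost :: "(real \<times> real) measure \<Rightarrow> real" where
  "cost \<gamma> = sqrt (\<integral>z. (d_per (fst z) (snd z))\<^sup>2 \<partial>\<gamma>)"

lemma W_per_le_cost: "\<gamma> \<in> couplings \<mu> \<rho> \<Longrightarrow> W_per \<mu> \<rho> \<le> cost \<gamma>"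
  unfolding W_per_def cost_def
  by (intro real_sqrt_le_mono cINF_lower) (auto intro!: bdd_belowI2[where m = 0])

lemma W_per_nonneg:
  assumes "\<mu> \<in> P_S1" "\<rho> \<in> P_S1"
  shows "0 \<le> W_per \<mu> \<rho>"
  unfolding W_per_def using couplings_nonempty[OF assms]
  by (intro real_sqrt_ge_zero cINF_greatest) auto

lemma W_per_approx:
  assumes "\<mu> \<in> P_S1" "\<rho> \<in> P_S1" "W_per \<mu> \<rho> < c"
  obtains \<gamma> where "\<gamma> \<in> couplings \<mu> \<rho>" "cost \<gamma> < c"
proof -
  have c: "0 < c" using W_per_nonneg[OF assms(1,2)] assms(3) by simp
  have "(INF \<gamma>\<in>couplings \<mu> \<rho>. \<integral>z. (d_per (fst z) (snd z))\<^sup>2 \<partial>\<gamma>) < c\<^sup>2"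
    using assms(3) c real_less_rsqrt linorder_not_less unfolding W_per_def
    by (metis order_less_imp_le real_le_rsqrt)
  then obtain \<gamma> where "\<gamma> \<in> couplings \<mu> \<rho>" "(\<integral>z. (d_per (fst z) (snd z))\<^sup>2 \<partial>\<gamma>) < c\<^sup>2"
    using cInf_lessD[of "(\<lambda>\<gamma>. \<integral>z. (d_per (fst z) (snd z))\<^sup>2 \<partial>\<gamma>) ` couplings \<mu> \<rho>" "c\<^sup>2"]
      couplings_nonempty[OF assms(1,2)] by blast
  moreover from this(2) have "cost \<gamma> < sqrt (c\<^sup>2)" unfolding cost_def by (rule real_sqrt_less_mono)
  ultimately show ?thesis using c that by simp
qed

text \<open>Minkowski's inequality from the weighted Young inequality. The optimal weight is the
  ratio of the two norms; \<open>A\<close> and \<open>B\<close> exceed the norms slightly, so that a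
  vanishing norm causes no division by zero.\<close>

lemma L2_triangle:
  fixes f g :: "'a \<Rightarrow> real"
  assumes f: "integrable M (\<lambda>x. (f x)\<^sup>2)" and g: "integrable M (\<lambda>x. (g x)\<^sup>2)"
    and fm: "f \<in> borel_measurable M" and gm: "g \<in> borel_measurable M"
  shows "sqrt (\<integral>x. (f x + g x)\<^sup>2 \<partial>M) \<le> sqrt (\<integral>x. (f x)\<^sup>2 \<partial>M) + sqrt (\<integral>x. (g x)\<^sup>2 \<partial>M)"
proof (rule field_le_epsilon)
  fix e :: real assume e: "e > 0"
  define A where "A = sqrt (\<integral>x. (f x)\<^sup>2 \<partial>M) + e / 2"
  define B where "B = sqrt (\<integral>x. (g x)\<^sup>2 \<partial>M) + e / 2"
  have A: "A > 0" "(\<integral>x. (f x)\<^sup>2 \<partial>M) \<le> A\<^sup>2" and B: "B > 0" "(\<integral>x. (g x)\<^sup>2 \<partial>M) \<le> B\<^sup>2"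
    unfolding A_def B_def using e
    by (auto intro!: add_nonneg_pos sqrt_le_D)
  have pt: "(f x + g x)\<^sup>2 \<le> (1 + B / A) * (f x)\<^sup>2 + (1 + A / B) * (g x)\<^sup>2" for x
  proof -
    have "0 \<le> (B * f x - A * g x)\<^sup>2 / (A * B)" using A B by simp
    also have "\<dots> = (B / A) * (f x)\<^sup>2 + (A / B) * (g x)\<^sup>2 - 2 * f x * g x"
      using A B by (simp add: field_simps power2_eq_square)
    finally show ?thesis by (simp add: power2_eq_square algebra_simps)
  qed
  have int: "integrable M (\<lambda>x. (1 + B / A) * (f x)\<^sup>2 + (1 + A / B) * (g x)\<^sup>2)"
    using f g by auto
  have "(\<integral>x. (f x + g x)\<^sup>2 \<partial>M) \<le> (\<integral>x. (1 + B / A) * (f x)\<^sup>2 + (1 + A / B) * (g x)\<^sup>2 \<partial>M)"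
    by (rule integral_mono_AE[OF Bochner_Integration.integrable_bound[OF int] int])
      (use fm gm in \<open>auto simp: pt intro!: order_trans[OF pt abs_ge_self]\<close>)
  also have "\<dots> = (1 + B / A) * (\<integral>x. (f x)\<^sup>2 \<partial>M) + (1 + A / B) * (\<integral>x. (g x)\<^sup>2 \<partial>M)"
    using f g by simp
  also have "\<dots> \<le> (1 + B / A) * A\<^sup>2 + (1 + A / B) * B\<^sup>2"
    using A B by (intro add_mono mult_left_mono) auto
  also have "\<dots> = (A + B)\<^sup>2" using A B by (simp add: field_simps power2_eq_square)
  finally show "sqrt (\<integral>x. (f x + g x)\<^sup>2 \<partial>M) \<le> sqrt (\<integral>x. (f x)\<^sup>2 \<partial>M) + sqrt (\<integral>x. (g x)\<^sup>2 \<partial>M) + e"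
    using A B by (intro real_le_lsqrt) (auto simp: A_def B_def add_ac)
qed

lemma W_per_commute:
  assumes "\<mu> \<in> P_S1" "\<rho> \<in> P_S1"
  shows "W_per \<mu> \<rho> = W_per \<rho> \<mu>"
proof -
  have le: "W_per \<rho> \<mu> \<le> W_per \<mu> \<rho>" if P: "\<mu> \<in> P_S1" "\<rho> \<in> P_S1" for \<mu> \<rho>
  proof (rule field_le_epsilon)
    fix e :: real assume "e > 0"
    then obtain \<gamma> where \<gamma>: "\<gamma> \<in> couplings \<mu> \<rho>" "cost \<gamma> < W_per \<mu> \<rho> + e"
      using W_per_approx[OF P, of "W_per \<mu> \<rho> + e"] by auto
    interpret prob_space \<gamma> using couplingsD(1)[OF \<gamma>(1)] .
    note [measurable] = couplings_measurable[OF \<gamma>(1)]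
    define s :: "real \<times> real \<Rightarrow> real \<times> real" where "s = (\<lambda>z. (snd z, fst z))"
    have s [measurable]: "s \<in> \<gamma> \<rightarrow>\<^sub>M S1 \<Otimes>\<^sub>M S1" unfolding s_def by measurable
    have "distr \<gamma> (S1 \<Otimes>\<^sub>M S1) s \<in> couplings \<rho> \<mu>"
      unfolding couplings_def
      using \<gamma>(1) by (auto simp: distr_distr comp_def s_def couplings_def prob_space_distr s[unfolded s_def])
    from W_per_le_cost[OF this] have "W_per \<rho> \<mu> \<le> cost \<gamma>"
      unfolding cost_def by (simp add: integral_distr) (simp add: s_def d_per_commute)
    with \<gamma>(2) show "W_per \<rho> \<mu> \<le> W_per \<mu> \<rho> + e" by simp
  qed
  show ?thesis using le[OF assms] le[OF assms(2,1)] by simp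
qed

lemma P_S1_D:
  assumes "\<mu> \<in> P_S1"
  shows "prob_space \<mu>" "sets \<mu> = sets S1" "space \<mu> = {-pi..<pi}"
  using assms sets_eq_imp_space_eq[of \<mu> S1] by (auto simp: P_S1_def space_S1)

lemma nn_integral_coupling:
  assumes "\<gamma> \<in> couplings \<mu> \<rho>"
    and "f \<in> borel_measurable S1"
  shows "(\<integral>\<^sup>+z. f (fst z) \<partial>\<gamma>) = (\<integral>\<^sup>+x. f x \<partial>\<mu>)"
    "(\<integral>\<^sup>+z. f (snd z) \<partial>\<gamma>) = (\<integral>\<^sup>+x. f x \<partial>\<rho>)"
  unfolding couplingsD(3,4)[OF assms(1), symmetric]
  using couplings_measurable[OF assms(1)] assms(2) by (simp_all add: nn_integral_distr)

section \<open>Gluing couplings along a partition into short arcs\<close>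

definition arc_index :: "nat \<Rightarrow> real \<Rightarrow> int" where
  "arc_index n x = \<lfloor>real n * x\<rfloor>"

lemma arc_index_measurable [measurable]: "arc_index n \<in> S1 \<rightarrow>\<^sub>M count_space UNIV"
proof -
  have "arc_index n \<in> borel \<rightarrow>\<^sub>M count_space UNIV" unfolding arc_index_def by measurable
  then show ?thesis unfolding S1_def by (rule measurable_restrict_space1)
qed

lemma arc_index_eq_dist:
  fixes n :: nat
  assumes "n > 0" "arc_index n x = arc_index n y"
  shows "\<bar>x - y\<bar> \<le> 1 / n"
proof -
  have "\<bar>real n * x - real n * y\<bar> < 1" using assms(2) unfolding arc_index_def by linarith
  then have "real n * \<bar>x - y\<bar> < 1" by (simp add: abs_mult right_diff_distrib[symmetric])
  then show ?thesis using assms(1) by (simp add: field_simps)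
qed

text \<open>Instead of disintegrating the two couplings along their common marginal, the measure below
  couples their middle points only up to lying in a common arc of length \<open>1/n\<close>. It has a density
  with respect to the product of the couplings.\<close>

definition glue_density :: "nat \<Rightarrow> real measure \<Rightarrow> (real \<times> real) \<times> (real \<times> real) \<Rightarrow> ennreal" where
  "glue_density n \<rho> w =
    (if arc_index n (snd (fst w)) = arc_index n (fst (snd w))
     then 1 / emeasure \<rho> {y \<in> space \<rho>. arc_index n y = arc_index n (snd (fst w))} else 0)"

text \<open>There are countably many arcs, so those of measure zero together form a null set. On it
  the quotient in \<open>glue_density\<close> would be \<open>1 / 0 = top\<close>.\<close>

lemma AE_arc_pos:
  assumes "\<rho> \<in> P_S1"
  shows "AE y in \<rho>. emeasure \<rho> {x \<in> space \<rho>. arc_index n x = arc_index n y} \<noteq> 0"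
proof -
  let ?A = "\<lambda>i. {x \<in> space \<rho>. arc_index n x = i}"
  have [measurable]: "arc_index n \<in> \<rho> \<rightarrow>\<^sub>M count_space UNIV"
    using P_S1_D(2)[OF assms] by (simp cong: measurable_cong_sets)
  have "(\<Union>i\<in>{i. emeasure \<rho> (?A i) = 0}. ?A i) \<in> null_sets \<rho>"
    by (intro null_sets_UN') (auto simp: null_sets_def)
  then show ?thesis
    by (rule AE_I') auto
qed

text \<open>With a point of one factor fixed, the density integrates over the other factor to the
  mass of an arc divided by itself, so both marginals of \<open>\<Gamma>\<close> are the given
  couplings. The two middle points are at most \<open>1 / n\<close> apart, and Minkowski's
  inequality separates the three legs of the path.\<close>

lemma glue:
  fixes n :: nat
  assumes \<gamma>1: "\<gamma>1 \<in> couplings \<mu> \<rho>" and \<gamma>2: "\<gamma>2 \<in> couplings \<rho> \<sigma>" and n: "n > 0"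
    and P: "\<mu> \<in> P_S1" "\<rho> \<in> P_S1" "\<sigma> \<in> P_S1"
  shows "W_per \<mu> \<sigma> \<le> cost \<gamma>1 + (1 / n + cost \<gamma>2)"
proof -
  interpret R: prob_space \<rho> using P_S1_D(1)[OF P(2)] .
  interpret G1: prob_space \<gamma>1 using couplingsD(1)[OF \<gamma>1] .
  interpret G2: prob_space \<gamma>2 using couplingsD(1)[OF \<gamma>2] .
  interpret pair_prob_space \<gamma>1 \<gamma>2 ..
  note m1 [measurable] = couplings_measurable[OF \<gamma>1] and m2 [measurable] = couplings_measurable[OF \<gamma>2]
  have sR [measurable_cong]: "sets \<rho> = sets S1" using P_S1_D(2)[OF P(2)] .
  let ?c = "\<lambda>y. emeasure \<rho> {x \<in> space \<rho>. arc_index n x = arc_index n y}"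
  have c_meas [measurable]: "?c \<in> borel_measurable S1"
  proof -
    have "(\<lambda>i. emeasure \<rho> {x \<in> space \<rho>. arc_index n x = i}) \<in> count_space UNIV \<rightarrow>\<^sub>M borel" by simp
    from measurable_compose[OF arc_index_measurable this] show ?thesis .
  qed
  let ?f = "glue_density n \<rho>"
  have f_meas [measurable]: "?f \<in> borel_measurable (\<gamma>1 \<Otimes>\<^sub>M \<gamma>2)"
    unfolding glue_density_def by measurable
  define \<Gamma> where "\<Gamma> = density (\<gamma>1 \<Otimes>\<^sub>M \<gamma>2) ?f"
  have marg: "(\<integral>\<^sup>+x. indicator {x \<in> space \<rho>. arc_index n x = i} x / emeasure \<rho> {x \<in> space \<rho>. arc_index n x = i} \<partial>\<rho>) = 1"
    if "emeasure \<rho> {x \<in> space \<rho>. arc_index n x = i} \<noteq> 0" for i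
  proof -
    have "(\<integral>\<^sup>+x. indicator {x \<in> space \<rho>. arc_index n x = i} x / emeasure \<rho> {x \<in> space \<rho>. arc_index n x = i} \<partial>\<rho>)
       = emeasure \<rho> {x \<in> space \<rho>. arc_index n x = i} / emeasure \<rho> {x \<in> space \<rho>. arc_index n x = i}"
      by (subst nn_integral_divide) (auto simp: nn_integral_indicator)
    also have "\<dots> = 1" using that by (intro ennreal_divide_self) (simp_all add: less_top[symmetric] R.emeasure_finite)
    finally show ?thesis .
  qed
  have fst_int: "(\<integral>\<^sup>+w. h (fst w) \<partial>\<Gamma>) = (\<integral>\<^sup>+z. h z \<partial>\<gamma>1)" if [measurable]: "h \<in> borel_measurable \<gamma>1" for h
  proof -
    have "(\<integral>\<^sup>+w. h (fst w) \<partial>\<Gamma>) = (\<integral>\<^sup>+z. \<integral>\<^sup>+z'. ?f (z, z') * h z \<partial>\<gamma>2 \<partial>\<gamma>1)"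
      unfolding \<Gamma>_def by (subst nn_integral_density) (auto simp: G2.nn_integral_fst[symmetric])
    also have "\<dots> = (\<integral>\<^sup>+z. h z \<partial>\<gamma>1)"
    proof (rule nn_integral_cong_AE)
      have "AE z in \<gamma>1. ?c (snd z) \<noteq> 0"
        by (rule AE_distrD[OF m1(2), unfolded couplingsD(4)[OF \<gamma>1], OF AE_arc_pos[OF P(2)]])
      then show "AE z in \<gamma>1. (\<integral>\<^sup>+z'. ?f (z, z') * h z \<partial>\<gamma>2) = h z"
      proof (rule AE_mp[OF _ AE_I2], intro impI)
        fix z assume z: "z \<in> space \<gamma>1" "?c (snd z) \<noteq> 0"
        have "(\<integral>\<^sup>+z'. ?f (z, z') * h z \<partial>\<gamma>2)
          = (\<integral>\<^sup>+z'. (\<lambda>y. (if arc_index n (snd z) = arc_index n y then 1 / ?c (snd z) else 0) * h z) (fst z') \<partial>\<gamma>2)"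
          by (simp only: glue_density_def fst_conv snd_conv)
        also have "\<dots> = (\<integral>\<^sup>+y. (if arc_index n (snd z) = arc_index n y then 1 / ?c (snd z) else 0) * h z \<partial>\<rho>)"
          by (rule nn_integral_coupling(1)[OF \<gamma>2]) measurable
        also have "\<dots> = (\<integral>\<^sup>+y. (if arc_index n (snd z) = arc_index n y then 1 / ?c (snd z) else 0) \<partial>\<rho>) * h z"
          by (rule nn_integral_multc) measurable
        also have "(\<integral>\<^sup>+y. (if arc_index n (snd z) = arc_index n y then 1 / ?c (snd z) else 0) \<partial>\<rho>)
           = (\<integral>\<^sup>+y. indicator {x \<in> space \<rho>. arc_index n x = arc_index n (snd z)} y / ?c (snd z) \<partial>\<rho>)"
          by (rule nn_integral_cong) (auto simp: indicator_def)
        finally show "(\<integral>\<^sup>+z'. ?f (z, z') * h z \<partial>\<gamma>2) = h z" using marg[OF z(2)] by simp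
      qed
    qed
    finally show ?thesis .
  qed
  have snd_int: "(\<integral>\<^sup>+w. h (snd w) \<partial>\<Gamma>) = (\<integral>\<^sup>+z. h z \<partial>\<gamma>2)" if [measurable]: "h \<in> borel_measurable \<gamma>2" for h
  proof -
    have "(\<integral>\<^sup>+w. h (snd w) \<partial>\<Gamma>) = (\<integral>\<^sup>+z'. \<integral>\<^sup>+z. ?f (z, z') * h z' \<partial>\<gamma>1 \<partial>\<gamma>2)"
      unfolding \<Gamma>_def by (subst nn_integral_density) (auto simp: nn_integral_snd[symmetric])
    also have "\<dots> = (\<integral>\<^sup>+z. h z \<partial>\<gamma>2)"
    proof (rule nn_integral_cong_AE)
      have "AE z in \<gamma>2. ?c (fst z) \<noteq> 0"
        by (rule AE_distrD[OF m2(1), unfolded couplingsD(3)[OF \<gamma>2], OF AE_arc_pos[OF P(2)]])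
      then show "AE z' in \<gamma>2. (\<integral>\<^sup>+z. ?f (z, z') * h z' \<partial>\<gamma>1) = h z'"
      proof (rule AE_mp[OF _ AE_I2], intro impI)
        fix z' assume z': "z' \<in> space \<gamma>2" "?c (fst z') \<noteq> 0"
        \<comment> \<open>The density is normalised by the arc of the point from
          \<open>\<gamma>1\<close>; where it is nonzero, this is also the arc of the point from
          \<open>\<gamma>2\<close>.\<close>
        have "(\<integral>\<^sup>+z. ?f (z, z') * h z' \<partial>\<gamma>1)
          = (\<integral>\<^sup>+z. (\<lambda>y. (if arc_index n y = arc_index n (fst z') then 1 / ?c (fst z') else 0) * h z') (snd z) \<partial>\<gamma>1)"
          by (rule nn_integral_cong) (simp only: glue_density_def fst_conv snd_conv split: if_split, metis)
        also have "\<dots> = (\<integral>\<^sup>+y. (if arc_index n y = arc_index n (fst z') then 1 / ?c (fst z') else 0) * h z' \<partial>\<rho>)"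
          by (rule nn_integral_coupling(2)[OF \<gamma>1]) measurable
        also have "\<dots> = (\<integral>\<^sup>+y. (if arc_index n y = arc_index n (fst z') then 1 / ?c (fst z') else 0) \<partial>\<rho>) * h z'"
          by (rule nn_integral_multc) measurable
        also have "(\<integral>\<^sup>+y. (if arc_index n y = arc_index n (fst z') then 1 / ?c (fst z') else 0) \<partial>\<rho>)
           = (\<integral>\<^sup>+y. indicator {x \<in> space \<rho>. arc_index n x = arc_index n (fst z')} y / ?c (fst z') \<partial>\<rho>)"
          by (rule nn_integral_cong) (auto simp: indicator_def)
        finally show "(\<integral>\<^sup>+z. ?f (z, z') * h z' \<partial>\<gamma>1) = h z'" using marg[OF z'(2)] by simp
      qed
    qed
    finally show ?thesis .
  qed
  have [measurable_cong]: "sets \<Gamma> = sets (\<gamma>1 \<Otimes>\<^sub>M \<gamma>2)" by (simp add: \<Gamma>_def)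
  have dfst: "distr \<Gamma> \<gamma>1 fst = \<gamma>1"
  proof (rule measure_eqI)
    fix A assume "A \<in> sets (distr \<Gamma> \<gamma>1 fst)"
    then have A: "A \<in> sets \<gamma>1" by simp
    then have "emeasure (distr \<Gamma> \<gamma>1 fst) A = (\<integral>\<^sup>+z. indicator A z \<partial>distr \<Gamma> \<gamma>1 fst)" by simp
    also have "\<dots> = (\<integral>\<^sup>+w. indicator A (fst w) \<partial>\<Gamma>)" using A by (intro nn_integral_distr) auto
    also have "\<dots> = emeasure \<gamma>1 A" using A by (subst fst_int) auto
    finally show "emeasure (distr \<Gamma> \<gamma>1 fst) A = emeasure \<gamma>1 A" .
  qed simp
  have dsnd: "distr \<Gamma> \<gamma>2 snd = \<gamma>2"
  proof (rule measure_eqI)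
    fix A assume "A \<in> sets (distr \<Gamma> \<gamma>2 snd)"
    then have A: "A \<in> sets \<gamma>2" by simp
    then have "emeasure (distr \<Gamma> \<gamma>2 snd) A = (\<integral>\<^sup>+z. indicator A z \<partial>distr \<Gamma> \<gamma>2 snd)" by simp
    also have "\<dots> = (\<integral>\<^sup>+w. indicator A (snd w) \<partial>\<Gamma>)" using A by (intro nn_integral_distr) auto
    also have "\<dots> = emeasure \<gamma>2 A" using A by (subst snd_int) auto
    finally show "emeasure (distr \<Gamma> \<gamma>2 snd) A = emeasure \<gamma>2 A" .
  qed simp
  have "emeasure \<Gamma> (space \<Gamma>) = 1"
    using fst_int[of "\<lambda>_. 1"] by (simp add: G1.emeasure_space_1)
  then interpret GG: prob_space \<Gamma> by (rule prob_spaceI)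
  define e where "e w = (fst (fst w), snd (snd w))" for w :: "(real \<times> real) \<times> (real \<times> real)"
  have e [measurable]: "e \<in> \<Gamma> \<rightarrow>\<^sub>M S1 \<Otimes>\<^sub>M S1" unfolding e_def by measurable
  have "distr \<Gamma> S1 (\<lambda>w. fst (fst w)) = \<mu>"
    using distr_distr[of fst \<gamma>1 S1 fst \<Gamma>] dfst couplingsD(3)[OF \<gamma>1] by (simp add: comp_def)
  moreover have "distr \<Gamma> S1 (\<lambda>w. snd (snd w)) = \<sigma>"
    using distr_distr[of snd \<gamma>2 S1 snd \<Gamma>] dsnd couplingsD(4)[OF \<gamma>2] by (simp add: comp_def)
  ultimately have couplings: "distr \<Gamma> (S1 \<Otimes>\<^sub>M S1) e \<in> couplings \<mu> \<sigma>"
    unfolding couplings_def by (auto simp: distr_distr comp_def e_def GG.prob_space_distr e[unfolded e_def])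
  have I2: "integrable \<Gamma> (\<lambda>w. (d_per (fst (fst w)) (snd (fst w)))\<^sup>2)"
    "integrable \<Gamma> (\<lambda>w. (d_per (fst (snd w)) (snd (snd w)))\<^sup>2)"
    "integrable \<Gamma> (\<lambda>w. d_per (fst (snd w)) (snd (snd w)))"
    by (rule bounded_d_per_integrable; simp add: GG.prob_space_axioms)+
  then have J: "integrable \<Gamma> (\<lambda>w. (1 / n + d_per (fst (snd w)) (snd (snd w)))\<^sup>2)"
    by (simp add: power2_sum)
  note W_per_le_cost[OF couplings]
  then have "W_per \<mu> \<sigma> \<le> sqrt (\<integral>w. (d_per (fst (fst w)) (snd (snd w)))\<^sup>2 \<partial>\<Gamma>)"
    unfolding cost_def by (simp add: integral_distr) (simp add: e_def)
  also have "\<dots> \<le> sqrt (\<integral>w. (d_per (fst (fst w)) (snd (fst w)) + (1 / n + d_per (fst (snd w)) (snd (snd w))))\<^sup>2 \<partial>\<Gamma>)"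
  proof (intro real_sqrt_le_mono integral_mono_AE)
    have "AE w in \<gamma>1 \<Otimes>\<^sub>M \<gamma>2. 0 < ?f w \<longrightarrow> d_per (snd (fst w)) (fst (snd w)) \<le> 1 / n"
      using order_trans[OF d_per_le_dist arc_index_eq_dist[OF n]]
      by (intro AE_I2) (auto simp: glue_density_def split: if_splits)
    then have "AE w in \<Gamma>. d_per (snd (fst w)) (fst (snd w)) \<le> 1 / n"
      unfolding \<Gamma>_def by (simp add: AE_density)
    then show "AE w in \<Gamma>. (d_per (fst (fst w)) (snd (snd w)))\<^sup>2
        \<le> (d_per (fst (fst w)) (snd (fst w)) + (1 / n + d_per (fst (snd w)) (snd (snd w))))\<^sup>2"
    proof eventually_elim
      case (elim w)
      have "d_per (fst (fst w)) (snd (snd w)) \<le> d_per (fst (fst w)) (snd (fst w)) +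
          (d_per (snd (fst w)) (fst (snd w)) + d_per (fst (snd w)) (snd (snd w)))"
        by (meson d_per_triangle add_left_mono order_trans)
      with elim show ?case by (intro power_mono) (auto simp: d_per_nonneg)
    qed
    show "integrable \<Gamma> (\<lambda>w. (d_per (fst (fst w)) (snd (snd w)))\<^sup>2)"
      by (rule bounded_d_per_integrable) (auto simp: GG.prob_space_axioms)
    have "\<bar>d_per (fst (fst w)) (snd (fst w)) + (1 / n + d_per (fst (snd w)) (snd (snd w)))\<bar> \<le> pi + (1/n + pi)" for w :: "(real \<times> real) \<times> (real \<times> real)"
      using d_per_nonneg[of "fst (fst w)" "snd (fst w)"] d_per_nonneg[of "fst (snd w)" "snd (snd w)"]
         d_per_le_pi[of "fst (fst w)" "snd (fst w)"] d_per_le_pi[of "fst (snd w)" "snd (snd w)"] by simp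
    then have "\<bar>d_per (fst (fst w)) (snd (fst w)) + (1 / n + d_per (fst (snd w)) (snd (snd w)))\<bar>\<^sup>2 \<le> (pi + (1/n + pi))\<^sup>2" for w :: "(real \<times> real) \<times> (real \<times> real)"
      by (intro power_mono) auto
    then show "integrable \<Gamma> (\<lambda>w. (d_per (fst (fst w)) (snd (fst w)) + (1 / n + d_per (fst (snd w)) (snd (snd w))))\<^sup>2)"
      by (intro GG.integrable_const_bound[where B = "(pi + (1/n + pi))\<^sup>2"]) auto
  qed
  also have "\<dots> \<le> sqrt (\<integral>w. (d_per (fst (fst w)) (snd (fst w)))\<^sup>2 \<partial>\<Gamma>)
     + sqrt (\<integral>w. (1 / n + d_per (fst (snd w)) (snd (snd w)))\<^sup>2 \<partial>\<Gamma>)"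
    by (intro L2_triangle I2(1) J) auto
  also have "sqrt (\<integral>w. (1 / n + d_per (fst (snd w)) (snd (snd w)))\<^sup>2 \<partial>\<Gamma>)
     \<le> sqrt (\<integral>w. (1 / n)\<^sup>2 \<partial>\<Gamma>) + sqrt (\<integral>w. (d_per (fst (snd w)) (snd (snd w)))\<^sup>2 \<partial>\<Gamma>)"
    by (intro L2_triangle I2) auto
  also have "sqrt (\<integral>w. (1 / n)\<^sup>2 \<partial>\<Gamma>) = 1 / n" using n by (simp add: GG.prob_space)
  also have "(\<integral>w. (d_per (fst (fst w)) (snd (fst w)))\<^sup>2 \<partial>\<Gamma>) = (\<integral>z. (d_per (fst z) (snd z))\<^sup>2 \<partial>\<gamma>1)"
    by (subst dfst[symmetric], subst integral_distr) auto
  also have "(\<integral>w. (d_per (fst (snd w)) (snd (snd w)))\<^sup>2 \<partial>\<Gamma>) = (\<integral>z. (d_per (fst z) (snd z))\<^sup>2 \<partial>\<gamma>2)"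
    by (subst dsnd[symmetric], subst integral_distr) auto
  finally show ?thesis by (simp add: cost_def)
qed

lemma W_per_triangle:
  assumes P: "\<mu> \<in> P_S1" "\<rho> \<in> P_S1" "\<sigma> \<in> P_S1"
  shows "W_per \<mu> \<sigma> \<le> W_per \<mu> \<rho> + W_per \<rho> \<sigma>"
proof (rule field_le_epsilon)
  fix e :: real assume e: "e > 0"
  obtain \<gamma>1 where \<gamma>1: "\<gamma>1 \<in> couplings \<mu> \<rho>" "cost \<gamma>1 < W_per \<mu> \<rho> + e / 3"
    using W_per_approx[OF P(1,2), of "W_per \<mu> \<rho> + e / 3"] e by auto
  obtain \<gamma>2 where \<gamma>2: "\<gamma>2 \<in> couplings \<rho> \<sigma>" "cost \<gamma>2 < W_per \<rho> \<sigma> + e / 3"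
    using W_per_approx[OF P(2,3), of "W_per \<rho> \<sigma> + e / 3"] e by auto
  obtain n where n: "n > 0" "1 / real n < e / 3"
    using reals_Archimedean[of "e / 3"] e by (metis divide_pos_pos inverse_eq_divide zero_less_Suc zero_less_numeral)
  show "W_per \<mu> \<sigma> \<le> W_per \<mu> \<rho> + W_per \<rho> \<sigma> + e"
    using glue[OF \<gamma>1(1) \<gamma>2(1) n(1) P] \<gamma>1(2) \<gamma>2(2) n(2) by linarith
qed

section \<open>The Poisson kernel\<close>

text \<open>The factor \<open>1 / (2 pi)\<close> makes this a probability density for Lebesgue
  measure on an interval of length \<open>2 pi\<close>.\<close>

definition poisson :: "real \<Rightarrow> real \<Rightarrow> real" where
  "poisson r t = (1 - r\<^sup>2) / (2 * pi * (1 - 2 * r * cos t + r\<^sup>2))"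

lemma poisson_denom_ge:
  fixes r t :: real
  assumes "0 \<le> r"
  shows "(1 - r)\<^sup>2 \<le> 1 - 2 * r * cos t + r\<^sup>2"
  using mult_left_mono[OF cos_le_one[of t] assms] by (simp add: power2_eq_square algebra_simps)

lemma poisson_denom_pos:
  fixes r t :: real
  assumes "0 \<le> r" "r < 1"
  shows "0 < 1 - 2 * r * cos t + r\<^sup>2"
  using poisson_denom_ge[OF assms(1), of t] assms(2) by (smt (verit) zero_less_power)

lemma poisson_nonneg: "0 \<le> r \<Longrightarrow> r < 1 \<Longrightarrow> 0 \<le> poisson r t"
  unfolding poisson_def using poisson_denom_pos[of r t]
  by (intro divide_nonneg_pos mult_pos_pos) (auto simp: power_le_one)

lemma poisson_le:
  assumes "0 \<le> r" "r < 1"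
  shows "poisson r t \<le> 1 / (1 - r)\<^sup>2"
proof -
  have "poisson r t \<le> 1 / (1 - 2 * r * cos t + r\<^sup>2)"
    unfolding poisson_def using poisson_denom_pos[OF assms, of t] pi_gt3 assms
    by (intro frac_le) (auto simp: mult_le_cancel_right1)
  also have "\<dots> \<le> 1 / (1 - r)\<^sup>2"
    using poisson_denom_ge[OF assms(1), of t] assms by (intro divide_left_mono) (auto intro!: mult_pos_pos poisson_denom_pos)
  finally show ?thesis .
qed

lemma norm_one_minus_cis_square:
  "(norm (1 - complex_of_real c * cis t))\<^sup>2 = 1 - 2 * c * cos t + c\<^sup>2"
proof -
  have "(norm (1 - complex_of_real c * cis t))\<^sup>2 = (1 - c * cos t)\<^sup>2 + (c * sin t)\<^sup>2"
    unfolding cmod_power2 by simp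
  also have "\<dots> = 1 - 2 * c * cos t + c\<^sup>2 * ((cos t)\<^sup>2 + (sin t)\<^sup>2)"
    by algebra
  finally show ?thesis by (simp only: sin_cos_squared_add2 mult_1_right)
qed

text \<open>Cauchy's formula for \<open>g w (1 - r\<^sup>2) / (1 - cnj a w)\<close> at \<open>a = r cis x\<close>. The sign change in the
  auxiliary function moves the parameter interval of the circle from \<open>[0, 2 \<pi>]\<close> to \<open>[-\<pi>, \<pi>]\<close>.\<close>

lemma poisson_formula:
  fixes g :: "complex \<Rightarrow> complex"
  assumes r: "0 \<le> r" "r < 1" and R: "R > 1" and g: "g holomorphic_on ball 0 R"
  shows "((\<lambda>y. of_real (poisson r (y - x)) * g (cis y)) has_integral g (r * cis x)) {-pi..pi}"
proof -
  define a where "a = r * cis x"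
  have na: "norm a = r" using r by (simp add: a_def norm_mult)
  define h where "h u = g (- u) * (1 - r\<^sup>2) / (1 + cnj a * u)" for u
  have nz: "1 + cnj a * u \<noteq> 0" if "norm u \<le> 1" for u
  proof
    assume "1 + cnj a * u = 0"
    then have "norm (cnj a * u) = 1" by (metis add_eq_0_iff norm_minus_cancel norm_one)
    moreover have "norm (cnj a * u) \<le> r * 1" unfolding norm_mult using that r na by (intro mult_mono) auto
    ultimately show False using r by simp
  qed
  have sub: "uminus ` cball 0 1 \<subseteq> ball (0::complex) R" using R by auto
  have hol: "h holomorphic_on cball 0 1"
    unfolding h_def
    by (intro holomorphic_intros holomorphic_on_compose[OF _ holomorphic_on_subset[OF g sub], unfolded comp_def])
       (auto simp: nz)
  have "((\<lambda>u. h u / (u - (- a))) has_contour_integral (2 * of_real pi * \<i> * h (- a))) (circlepath 0 1)"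
    by (rule Cauchy_integral_circlepath)
       (use hol r na in \<open>auto intro: holomorphic_on_imp_continuous_on holomorphic_on_subset\<close>)
  then have "((\<lambda>t. h (cis t) / (cis t + a) * \<i> * cis t) has_integral (2 * of_real pi * \<i> * h (- a))) {0..2 * pi}"
    unfolding circlepath_def by (subst (asm) has_contour_integral_part_circlepath_iff) auto
  from has_integral_affinity[OF this[folded cbox_interval], of 1 pi]
  have "((\<lambda>y. h (cis (y + pi)) / (cis (y + pi) + a) * \<i> * cis (y + pi)) has_integral (2 * of_real pi * \<i> * h (- a)))
      ((\<lambda>x. x - pi) ` {0..2 * pi})" by simp
  also have "(\<lambda>x. x - pi) ` {0..2 * pi} = {-pi..pi}"
    by (subst image_minus_const_atLeastAtMost') simp
  finally have "((\<lambda>y. h (cis (y + pi)) / (cis (y + pi) + a) * \<i> * cis (y + pi) * (1 / (2 * of_real pi * \<i>))) has_integral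
      (2 * of_real pi * \<i> * h (- a) * (1 / (2 * of_real pi * \<i>)))) {-pi..pi}"
    by (rule has_integral_mult_left)
  \<comment> \<open>At \<open>u = - a\<close> the denominator of \<open>h\<close> equals
    \<open>1 - r\<^sup>2\<close>, which its numerator cancels.\<close>
  moreover have "2 * of_real pi * \<i> * h (- a) * (1 / (2 * of_real pi * \<i>)) = g (r * cis x)"
  proof -
    have "a * cnj a = complex_of_real (r\<^sup>2)" using na by (simp add: complex_norm_square[symmetric])
    moreover have "complex_of_real (r\<^sup>2) \<noteq> 1"
      using r by (metis of_real_eq_1_iff power_one power2_eq_iff_nonneg less_irrefl zero_le_one)
    ultimately have "h (- a) = g a" by (simp add: h_def mult.commute)
    then show ?thesis by (simp add: a_def)
  qed
  moreover have "h (cis (y + pi)) / (cis (y + pi) + a) * \<i> * cis (y + pi) * (1 / (2 * of_real pi * \<i>))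
     = of_real (poisson r (y - x)) * g (cis y)" for y
  proof -
    have cancel: "X / q / (- D) * \<i> * (- c) * (1 / (2 * p * \<i>)) = X / q * (c / D) * (1 / (2 * p))"
      for X q D c p :: complex
      by (cases "q = 0"; cases "D = 0"; cases "p = 0"; simp add: field_simps)
    have cp: "cis (y + pi) = - cis y" by (simp add: cis_mult[symmetric])
    \<comment> \<open>On the unit circle \<open>cis y - a = cis y * cnj q\<close>, so the Cauchy
      denominator and that of \<open>h\<close> combine to the squared norm of \<open>q\<close>,
      which is the denominator of the Poisson kernel.\<close>
    define q where "q = 1 - cnj a * cis y"
    have q0: "q \<noteq> 0" using nz[of "- cis y"] by (simp add: q_def)
    have c1: "cis y * cnj (cis y) = 1" by (simp add: complex_norm_square[symmetric])
    have qc: "cis y - a = cis y * cnj q"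
      using c1 by (simp add: q_def algebra_simps)
    have "q * cnj q = complex_of_real (1 - 2 * r * cos (y - x) + r\<^sup>2)"
    proof -
      have "q = 1 - r * cis (y - x)" by (simp add: q_def a_def cis_mult cis_cnj)
      then show ?thesis
        unfolding complex_norm_square[symmetric] by (simp only: norm_one_minus_cis_square)
    qed
    then have P: "complex_of_real (poisson r (y - x)) = (1 - r\<^sup>2) / (2 * pi * (q * cnj q))"
      by (simp add: poisson_def)
    have "h (cis (y + pi)) / (cis (y + pi) + a) * \<i> * cis (y + pi) * (1 / (2 * of_real pi * \<i>))
      = g (cis y) * (1 - r\<^sup>2) / q / (- (cis y - a)) * \<i> * (- cis y) * (1 / (2 * of_real pi * \<i>))"
      by (simp add: cp h_def q_def)
    also have "\<dots> = g (cis y) * (1 - r\<^sup>2) / q * (cis y / (cis y * cnj q)) * (1 / (2 * of_real pi))"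
      unfolding qc by (rule cancel)
    also have "\<dots> = of_real (poisson r (y - x)) * g (cis y)"
      unfolding P using q0 by (simp add: mult_ac)
    finally show ?thesis .
  qed
  ultimately show ?thesis by simp
qed

lemma poisson_formula_Re:
  fixes g :: "complex \<Rightarrow> complex"
  assumes r: "0 \<le> r" "r < 1" and R: "R > 1" and g: "g holomorphic_on ball 0 R"
  shows "((\<lambda>y. poisson r (y - x) * Re (g (cis y))) has_integral Re (g (r * cis x))) {-pi..pi}"
  using has_integral_Re[OF poisson_formula[OF assms, of x]] by simp

lemma poisson_integral: "0 \<le> r \<Longrightarrow> r < 1 \<Longrightarrow> ((\<lambda>y. poisson r (y - x)) has_integral 1) {-pi..pi}"
  using poisson_formula_Re[of r 2 "\<lambda>_. 1" x] by simp

text \<open>The function \<open>cis (- x) * w\<close> of \<open>w\<close> has real part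
  \<open>cos (y - x)\<close> at \<open>cis y\<close> and value \<open>r\<close> at
  \<open>r * cis x\<close>. This moment yields the transport cost of mollification.\<close>

lemma poisson_cos_integral:
  assumes "0 \<le> r" "r < 1"
  shows "((\<lambda>y. poisson r (y - x) * cos (y - x)) has_integral r) {-pi..pi}"
proof -
  have "((\<lambda>y. poisson r (y - x) * Re (cis (- x) * cis y)) has_integral Re (cis (- x) * (r * cis x))) {-pi..pi}"
    by (rule poisson_formula_Re[OF assms, of 2 "\<lambda>w. cis (- x) * w"]) (auto intro!: holomorphic_intros)
  then show ?thesis by (simp add: cis_mult) (simp add: cis_cnj[symmetric] cos_diff algebra_simps power2_eq_square[symmetric] flip: distrib_left)
qed

text \<open>The logarithm of \<open>|1 - s w|\<close> is harmonic on a neighbourhood of the disc for \<open>s < 1\<close>.\<close>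

lemma poisson_ln_integral:
  assumes r: "0 \<le> r" "r < 1" and s: "0 < s" "s < 1"
  shows "((\<lambda>y. poisson r (y - x) * ln (1 - 2 * s * cos (y - z) + s\<^sup>2)) has_integral
      ln (1 - 2 * (s * r) * cos (x - z) + (s * r)\<^sup>2)) {-pi..pi}"
proof -
  \<comment> \<open>The factor 2 turns the logarithm of a norm into that of its square, which is
    affine in the cosine.\<close>
  define g where "g w = 2 * Ln (1 - s * cis (- z) * w)" for w
  have Re1: "Re (1 - s * cis (- z) * w) > 0" if "norm w < 1 / s" for w
  proof -
    have "Re (s * cis (- z) * w) \<le> norm (s * cis (- z) * w)" by (rule complex_Re_le_cmod)
    also have "\<dots> = s * norm w" using s by (simp add: norm_mult)
    also have "\<dots> < 1" using that s by (simp add: field_simps)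
    finally show ?thesis by simp
  qed
  have ReL: "Re (g (c * cis t)) = ln (1 - 2 * (s * c) * cos (t - z) + (s * c)\<^sup>2)" if c: "0 \<le> c" "c \<le> 1" for c t
  proof -
    have "s * c \<le> s" using c s by (simp add: mult_left_le)
    then have "c * s < 1" using s(2) by (simp only: mult.commute[of c s])
    then have "norm (c * cis t) < 1 / s" using c s by (simp add: norm_mult field_simps)
    from Re1[OF this] have nz: "1 - s * cis (- z) * (c * cis t) \<noteq> 0" by (metis less_irrefl zero_complex.simps(1))
    have eq: "1 - s * cis (- z) * (c * cis t) = 1 - (s * c) * cis (t - z)"
      by (simp add: cis_mult mult_ac)
    have "Re (g (c * cis t)) = 2 * ln (norm (1 - s * cis (- z) * (c * cis t)))"
      unfolding g_def using nz by simp
    also have "\<dots> = ln ((norm (1 - s * cis (- z) * (c * cis t)))\<^sup>2)"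
      using nz by (subst ln_realpow) auto
    also have "(norm (1 - s * cis (- z) * (c * cis t)))\<^sup>2 = 1 - 2 * (s * c) * cos (t - z) + (s * c)\<^sup>2"
      unfolding eq using norm_one_minus_cis_square[of "s * c" "t - z"] by simp
    finally show ?thesis .
  qed
  have "g holomorphic_on ball 0 (1 / s)"
    unfolding g_def
  proof (intro holomorphic_intros)
    fix w :: complex assume "w \<in> ball 0 (1 / s)"
    then have "Re (1 - s * cis (- z) * w) > 0" by (intro Re1) auto
    then show "1 - s * cis (- z) * w \<notin> \<real>\<^sub>\<le>\<^sub>0" using complex_nonpos_Reals_iff by force
  qed
  from poisson_formula_Re[OF r _ this, of x] s ReL[of 1] ReL[of r] r show ?thesis by simp
qed

section \<open>Lebesgue measure on the circle and the smoothed logarithmic potential\<close>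

lemma space_leb_S1: "space leb_S1 = {-pi..<pi}"
  by (simp add: leb_S1_def space_restrict_space)

lemma sets_leb_S1 [measurable_cong]: "sets leb_S1 = sets S1"
  unfolding leb_S1_def S1_def by (rule sets_restrict_space_cong[OF sets_lborel])

lemma measurable_S1_borel: "f \<in> borel_measurable borel \<Longrightarrow> f \<in> borel_measurable S1"
  unfolding S1_def by (rule measurable_restrict_space1)

lemma measurable_id_S1 [measurable]: "(\<lambda>x. x) \<in> S1 \<rightarrow>\<^sub>M borel"
  by (rule measurable_S1_borel) simp

lemma emeasure_space_leb_S1: "emeasure leb_S1 {-pi..<pi} = ennreal (2 * pi)"
  unfolding leb_S1_def by (subst emeasure_restrict_space) auto

lemma finite_leb_S1: "finite_measure leb_S1"
  by (rule finite_measureI) (simp add: space_leb_S1 emeasure_space_leb_S1)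

interpretation leb_S1: finite_measure leb_S1
  by (rule finite_leb_S1)

lemma nn_integral_leb_S1_has_integral:
  assumes nonneg: "\<And>x. 0 \<le> f x" and I: "(f has_integral I) {-pi..pi}"
  shows "(\<integral>\<^sup>+x. ennreal (f x) \<partial>leb_S1) = ennreal I"
proof -
  have "(\<integral>\<^sup>+x. ennreal (f x) \<partial>leb_S1) = (\<integral>\<^sup>+x. ennreal (f x) * indicator {-pi..<pi} x \<partial>lborel)"
    unfolding leb_S1_def by (subst nn_integral_restrict_space) auto
  also have "\<dots> = (\<integral>\<^sup>+x. ennreal (f x) * indicator {-pi..pi} x \<partial>lborel)"
    by (rule nn_integral_cong_AE) (rule AE_mp[OF AE_lborel_singleton[of pi]], auto simp: indicator_def)
  also have "\<dots> = ennreal I"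
    by (rule nn_integral_has_integral_lebesgue'[OF nonneg I])
  finally show ?thesis .
qed

text \<open>For \<open>v = \<bar>w\<bar> / 2 \<le> 2\<close> the Taylor bound gives
  \<open>sin v \<ge> v - v ^ 3 / 6 \<ge> v / 3\<close>. Hence
  \<open>w\<^sup>2 = 4 * v\<^sup>2 \<le> 36 * (sin v)\<^sup>2\<close>, and
  \<open>2 * (sin v)\<^sup>2 = 1 - cos w\<close> leaves the factor 18.\<close>

lemma square_le_one_minus_cos:
  assumes "\<bar>w\<bar> \<le> pi"
  shows "w\<^sup>2 \<le> 18 * (1 - cos w)"
proof -
  define v where "v = \<bar>w\<bar> / 2"
  have v: "0 \<le> v" "v \<le> 2" using assms pi_less_4 by (auto simp: v_def)
  have "\<bar>sin v - (\<Sum>m<3. sin_coeff m * v ^ m)\<bar> \<le> inverse (fact 3) * \<bar>v\<bar> ^ 3"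
    by (rule Maclaurin_sin_bound)
  then have "\<bar>sin v - v\<bar> \<le> v ^ 3 / 6"
    using v by (simp add: sin_coeff_def eval_nat_numeral fact_numeral)
  then have "v - v ^ 3 / 6 \<le> sin v" by linarith
  moreover have "v ^ 3 \<le> v * 2\<^sup>2"
    unfolding power3_eq_cube mult.assoc power2_eq_square using v by (intro mult_mono) auto
  ultimately have "v / 3 \<le> sin v" by simp
  then have "(v / 3)\<^sup>2 \<le> (sin v)\<^sup>2" using v by (intro power_mono) auto
  moreover have "cos w = 1 - 2 * (sin v)\<^sup>2"
    using cos_double_sin[of v] by (simp add: v_def abs_if split: if_splits)
  moreover have "w\<^sup>2 = 4 * v\<^sup>2" by (simp add: v_def power_divide)
  ultimately show ?thesis by (simp add: power_divide)
qed

lemma d_per_square_le: "(d_per x y)\<^sup>2 \<le> 18 * (1 - cos (y - x))"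
proof -
  obtain k :: int where k: "d_per x y = \<bar>x - y + 2 * pi * of_int k\<bar>" using d_per_attained by blast
  have "cos (x - y + 2 * pi * of_int k) = cos (x - y)"
    by (simp add: cos_add)
  also have "\<dots> = cos (y - x)" using cos_minus[of "y - x"] by simp
  finally show ?thesis
    using square_le_one_minus_cos[of "x - y + 2 * pi * of_int k"] d_per_le_pi[of x y] unfolding k by simp
qed

text \<open>The interaction kernel as a function of \<open>cos x\<close>, using \<open>sin\<^sup>2 (x/2) = (1 - cos x)/2\<close>.\<close>

definition wk :: "real \<Rightarrow> ennreal" where
  "wk x = (if cos x = 1 then \<infinity> else ennreal (- (1 / (2 * pi)) * ln ((1 - cos x) / 2)))"

lemma e2ennreal_W_ker: "e2ennreal (W_ker x) = wk x"
proof (cases "cos x = 1")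
  case True
  then obtain k :: int where "x = of_int k * 2 * pi" unfolding cos_one_2pi_int by blast
  then have "\<exists>k::int. x = 2 * pi * of_int k" by (intro exI[of _ k]) simp
  then show ?thesis using True by (simp add: W_ker_def wk_def)
next
  case False
  have n: "\<nexists>k::int. x = 2 * pi * of_int k"
  proof
    assume "\<exists>k::int. x = 2 * pi * of_int k"
    then obtain k :: int where "x = 2 * pi * of_int k" by blast
    then have "cos x = 1" by simp
    with False show False by blast
  qed
  have sq: "(1 - cos x) / 2 = \<bar>sin (x / 2)\<bar>\<^sup>2"
    using cos_double_sin[of "x / 2"] by simp
  have "(1 - cos x) / 2 \<noteq> 0" using False by simp
  then have "\<bar>sin (x / 2)\<bar> > 0" unfolding sq by simp
  then have "ln ((1 - cos x) / 2) = 2 * ln \<bar>sin (x / 2)\<bar>" unfolding sq by (subst ln_realpow) auto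
  then show ?thesis using False n by (simp add: W_ker_def wk_def e2ennreal_ereal)
qed

lemma wk_measurable [measurable]: "wk \<in> borel_measurable borel"
  unfolding wk_def by measurable

lemma wk_minus: "wk (- x) = wk x"
  by (simp add: wk_def)

lemma poisson_measurable [measurable]: "poisson r \<in> borel_measurable borel"
  unfolding poisson_def by measurable

lemma one_minus_cos_expand:
  fixes s t :: real
  shows "1 - 2 * s * cos t + s\<^sup>2 = (1 - s)\<^sup>2 + 2 * s * (1 - cos t)"
  by (simp add: power2_eq_square algebra_simps)

lemma AE_leb_S1_cos: "AE y in leb_S1. cos (y - z) \<noteq> 1"
proof -
  have "{y. cos (y - z) = 1} \<subseteq> range (\<lambda>k::int. z + of_int k * 2 * pi)"
    unfolding cos_one_2pi_int by (auto simp: image_iff algebra_simps)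
  then have "countable {y. cos (y - z) = 1}" by (rule countable_subset) simp
  then have "AE y in lborel. y \<notin> {y. cos (y - z) = 1}"
    by (intro AE_not_in countable_imp_null_set_lborel)
  then show ?thesis unfolding leb_S1_def
    by (subst AE_restrict_space_iff) auto
qed

text \<open>The singular kernel is the limit, as \<open>s\<close> tends to 1, of the smooth kernels
  \<open>k s\<close>, for which the Poisson formula is exact. Fatou's lemma passes to the limit in
  the direction of an upper bound. The term \<open>ln 4\<close> comes from
  \<open>2 - 2 * cos t = 4 * ((1 - cos t) / 2)\<close>.\<close>

lemma poisson_potential:
  assumes r: "0 \<le> r" "r < 1"
  shows "(\<integral>\<^sup>+y. ennreal (poisson r (y - x)) * wk (y - z) \<partial>leb_S1)
    \<le> ennreal (1 / (2 * pi) * (ln 4 - ln (1 - 2 * r * cos (x - z) + r\<^sup>2)))"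
proof -
  define k where "k s t = 1 / (2 * pi) * (ln 4 - ln (1 - 2 * s * cos t + s\<^sup>2))" for s t :: real
  \<comment> \<open>The shift by 2 makes \<open>s 0 = 1 / 2\<close> positive, as
    \<open>poisson_ln_integral\<close> requires.\<close>
  define s where "s n = 1 - 1 / (real n + 2)" for n
  have s: "0 < s n" "s n < 1" for n unfolding s_def by (auto simp: field_simps)
  have s_lim: "s \<longlonglongrightarrow> 1" unfolding s_def by real_asymp
  have k_nonneg: "0 \<le> k c t" if "0 \<le> c" "c < 1" for c t
  proof -
    have "1 - 2 * c * cos t + c\<^sup>2 \<le> 4"
      using that mult_left_mono[of "- cos t" 1 c] cos_ge_minus_one[of t] power_le_one[of c 2] by simp
    then show ?thesis using poisson_denom_pos[of c t] that unfolding k_def by simp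
  qed
  have hi: "((\<lambda>y. poisson r (y - x) * k (s n) (y - z)) has_integral k (s n * r) (x - z)) {-pi..pi}" for n
  proof -
    have "((\<lambda>y. 1 / (2 * pi) * (ln 4 * poisson r (y - x) - poisson r (y - x) * ln (1 - 2 * s n * cos (y - z) + (s n)\<^sup>2)))
       has_integral 1 / (2 * pi) * (ln 4 * 1 - ln (1 - 2 * (s n * r) * cos (x - z) + (s n * r)\<^sup>2))) {-pi..pi}"
      by (intro has_integral_mult_right has_integral_diff poisson_integral poisson_ln_integral r s)
    then show ?thesis unfolding k_def by (simp add: algebra_simps)
  qed
  have eq: "(\<integral>\<^sup>+y. ennreal (poisson r (y - x) * k (s n) (y - z)) \<partial>leb_S1) = ennreal (k (s n * r) (x - z))" for n
    by (rule nn_integral_leb_S1_has_integral[OF _ hi])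
      (intro mult_nonneg_nonneg poisson_nonneg k_nonneg r s less_imp_le[OF s(1)])
  have "(\<integral>\<^sup>+y. ennreal (poisson r (y - x)) * wk (y - z) \<partial>leb_S1)
    \<le> (\<integral>\<^sup>+y. liminf (\<lambda>n. ennreal (poisson r (y - x) * k (s n) (y - z))) \<partial>leb_S1)"
  proof (rule nn_integral_mono_AE, use AE_leb_S1_cos[of z] in eventually_elim)
    case (elim y)
    have pos: "1 - cos (y - z) > 0" using elim cos_le_one[of "y - z"] by linarith
    have "(\<lambda>n. ennreal (poisson r (y - x) * k (s n) (y - z))) \<longlonglongrightarrow>
        ennreal (poisson r (y - x) * k 1 (y - z))"
      unfolding k_def by (intro tendsto_ennrealI tendsto_intros s_lim) (use pos in auto)
    then have "liminf (\<lambda>n. ennreal (poisson r (y - x) * k (s n) (y - z))) = ennreal (poisson r (y - x) * k 1 (y - z))"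
      by (intro lim_imp_Liminf) auto
    also have "\<dots> = ennreal (poisson r (y - x)) * ennreal (k 1 (y - z))"
      using r by (intro ennreal_mult') (auto intro: poisson_nonneg)
    also have "k 1 (y - z) = - (1 / (2 * pi)) * ln ((1 - cos (y - z)) / 2)"
    proof -
      have split: "ln (4 * c) = ln 4 + ln c" if "c > 0" for c :: real using that by (simp add: ln_mult)
      have eq: "1 - 2 * 1 * cos (y - z) + 1\<^sup>2 = 4 * ((1 - cos (y - z)) / 2)" by simp
      have "ln (1 - 2 * 1 * cos (y - z) + 1\<^sup>2) = ln 4 + ln ((1 - cos (y - z)) / 2)"
        unfolding eq using pos by (intro split) simp
      then show ?thesis unfolding k_def by simp
    qed
    finally show ?case using elim by (simp add: wk_def)
  qed
  also have "\<dots> \<le> liminf (\<lambda>n. (\<integral>\<^sup>+y. ennreal (poisson r (y - x) * k (s n) (y - z)) \<partial>leb_S1))"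
    by (rule nn_integral_liminf) (simp add: k_def)
  also have "\<dots> = ennreal (k r (x - z))"
  proof -
    have "(\<lambda>n. ennreal (k (s n * r) (x - z))) \<longlonglongrightarrow> ennreal (k (1 * r) (x - z))"
      unfolding k_def
      by (intro tendsto_ennrealI tendsto_intros s_lim) (use poisson_denom_pos[OF r, of "x - z"] in auto)
    then show ?thesis unfolding eq by (intro lim_imp_Liminf) auto
  qed
  finally show ?thesis by (simp add: k_def)
qed

text \<open>Smoothing raises the kernel by at most a constant, since \<open>1 - 2 r cos t + r\<^sup>2 \<ge> 2 r (1 - cos t)\<close>.\<close>

lemma poisson_potential_le_wk:
  assumes r: "0 < r" "r < 1"
  shows "(\<integral>\<^sup>+y. ennreal (poisson r (y - x)) * wk (y - z) \<partial>leb_S1) \<le> wk (x - z) + ennreal (- ln r / (2 * pi))"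
proof (cases "cos (x - z) = 1")
  case False
  then have pos: "1 - cos (x - z) > 0" using cos_le_one[of "x - z"] by linarith
  have split: "ln (4 * (r * c)) = ln 4 + (ln r + ln c)" if "c > 0" for c :: real
    using that r by (simp add: ln_mult)
  have "ln (4 * (r * ((1 - cos (x - z)) / 2))) \<le> ln (1 - 2 * r * cos (x - z) + r\<^sup>2)"
    unfolding one_minus_cos_expand using pos r by (subst ln_le_cancel_iff) (auto intro!: add_nonneg_pos)
  then have "ln 4 + (ln r + ln ((1 - cos (x - z)) / 2)) \<le> ln (1 - 2 * r * cos (x - z) + r\<^sup>2)"
    by (subst (asm) split) (use pos in auto)
  then have "1 / (2 * pi) * (ln 4 - ln (1 - 2 * r * cos (x - z) + r\<^sup>2))
      \<le> 1 / (2 * pi) * (- ln ((1 - cos (x - z)) / 2) + - ln r)"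
    by (intro mult_left_mono) auto
  also have "\<dots> = - (1 / (2 * pi)) * ln ((1 - cos (x - z)) / 2) + - ln r / (2 * pi)"
    by (simp add: algebra_simps add_divide_distrib diff_divide_distrib)
  finally have "ennreal (1 / (2 * pi) * (ln 4 - ln (1 - 2 * r * cos (x - z) + r\<^sup>2))) \<le>
      ennreal (- (1 / (2 * pi)) * ln ((1 - cos (x - z)) / 2) + - ln r / (2 * pi))"
    by (rule ennreal_leI)
  also have "\<dots> = wk (x - z) + ennreal (- ln r / (2 * pi))"
  proof -
    have "(1 - cos (x - z)) / 2 \<le> 1" using cos_ge_minus_one[of "x - z"] by simp
    then have "ln ((1 - cos (x - z)) / 2) \<le> 0" using pos by simp
    then have "0 \<le> - (1 / (2 * pi)) * ln ((1 - cos (x - z)) / 2)"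
      by (intro mult_nonpos_nonpos) auto
    moreover have "0 \<le> - ln r / (2 * pi)" using r by (intro divide_nonneg_pos) auto
    ultimately show ?thesis using False by (simp only: wk_def if_False ennreal_plus)
  qed
  finally show ?thesis using poisson_potential[of r x z] r by (meson less_imp_le order_trans)
qed (simp add: wk_def)

lemma poisson_potential_le_const:
  assumes r: "0 \<le> r" "r < 1"
  shows "(\<integral>\<^sup>+y. ennreal (poisson r (y - x)) * wk (y - z) \<partial>leb_S1) \<le> ennreal ((ln 4 - ln ((1 - r)\<^sup>2)) / (2 * pi))"
proof -
  have "1 / (2 * pi) * (ln 4 - ln (1 - 2 * r * cos (x - z) + r\<^sup>2)) \<le> 1 / (2 * pi) * (ln 4 - ln ((1 - r)\<^sup>2))"
    using poisson_denom_ge[of r "x - z"] poisson_denom_pos[OF r, of "x - z"] r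
    by (intro mult_left_mono diff_left_mono, subst ln_le_cancel_iff) auto
  then show ?thesis using poisson_potential[OF r, of x z]
    by (elim order_trans) (auto intro!: ennreal_leI)
qed

lemma nn_integral_poisson: "0 \<le> r \<Longrightarrow> r < 1 \<Longrightarrow> (\<integral>\<^sup>+y. ennreal (poisson r (y - x)) \<partial>leb_S1) = 1"
  using nn_integral_leb_S1_has_integral[OF poisson_nonneg poisson_integral, of r x] by simp

section \<open>Mollification by the Poisson kernel\<close>

definition mollify :: "real \<Rightarrow> real measure \<Rightarrow> real measure" where
  "mollify r \<rho> = density leb_S1 (\<lambda>y. \<integral>\<^sup>+x. ennreal (poisson r (y - x)) \<partial>\<rho>)"

text \<open>The energy is kept in \<open>ennreal\<close>, where Fubini, suprema and infinite values
  come without integrability conditions.\<close>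

definition F0_enn :: "real measure \<Rightarrow> ennreal" where
  "F0_enn \<mu> = (\<integral>\<^sup>+z. wk (fst z - snd z) \<partial>(\<mu> \<Otimes>\<^sub>M \<mu>))"

lemma F0_eq_F0_enn: "F0 \<mu> = enn2ereal (F0_enn \<mu>)"
  unfolding F0_def F0_enn_def e2ennreal_W_ker ..

lemma wk_diff_commute: "wk (x - y) = wk (y - x)"
  using wk_minus[of "x - y"] by simp

lemma S1_borel_measurable [measurable (raw)]:
  "f \<in> M \<rightarrow>\<^sub>M S1 \<Longrightarrow> (\<lambda>x. f x) \<in> borel_measurable M"
  by (rule measurable_compose[OF _ measurable_id_S1])

lemma fst_S1_borel [measurable]: "fst \<in> borel_measurable (S1 \<Otimes>\<^sub>M N)"
  and snd_S1_borel [measurable]: "snd \<in> borel_measurable (N \<Otimes>\<^sub>M S1)"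
  by (rule S1_borel_measurable, simp)+

lemma F0_enn_iterated:
  assumes "\<mu> \<in> P_S1"
  shows "F0_enn \<mu> = (\<integral>\<^sup>+x. \<integral>\<^sup>+y. wk (x - y) \<partial>\<mu> \<partial>\<mu>)"
proof -
  interpret prob_space \<mu> using P_S1_D(1)[OF assms] .
  note [measurable_cong] = P_S1_D(2)[OF assms]
  show ?thesis unfolding F0_enn_def by (subst nn_integral_fst[symmetric]) auto
qed

context
  fixes \<rho> :: "real measure" and r :: real
  assumes P: "\<rho> \<in> P_S1" and r: "0 < r" "r < 1"
begin

interpretation R: prob_space \<rho>
  using P_S1_D(1)[OF P] .

interpretation LR: pair_sigma_finite leb_S1 \<rho> ..

declare P_S1_D(2)[OF P, measurable_cong]

lemma mollify_density_measurable: "(\<lambda>y. \<integral>\<^sup>+x. ennreal (poisson r (y - x)) \<partial>\<rho>) \<in> borel_measurable leb_S1"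
  by measurable

lemma sets_mollify: "sets (mollify r \<rho>) = sets S1"
  by (simp add: mollify_def sets_leb_S1)

lemma nn_integral_mollify:
  assumes [measurable]: "g \<in> borel_measurable S1"
  shows "(\<integral>\<^sup>+y. g y \<partial>mollify r \<rho>) = (\<integral>\<^sup>+x. \<integral>\<^sup>+y. ennreal (poisson r (y - x)) * g y \<partial>leb_S1 \<partial>\<rho>)"
proof -
  have "(\<integral>\<^sup>+y. g y \<partial>mollify r \<rho>) = (\<integral>\<^sup>+y. (\<integral>\<^sup>+x. ennreal (poisson r (y - x)) \<partial>\<rho>) * g y \<partial>leb_S1)"
    unfolding mollify_def by (rule nn_integral_density) measurable
  also have "\<dots> = (\<integral>\<^sup>+y. \<integral>\<^sup>+x. ennreal (poisson r (y - x)) * g y \<partial>\<rho> \<partial>leb_S1)"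
    by (intro nn_integral_cong nn_integral_multc[symmetric]) measurable
  also have "\<dots> = (\<integral>\<^sup>+x. \<integral>\<^sup>+y. ennreal (poisson r (y - x)) * g y \<partial>leb_S1 \<partial>\<rho>)"
    by (rule LR.Fubini'[symmetric]) measurable
  finally show ?thesis .
qed

lemma mollify_in_P_S1: "mollify r \<rho> \<in> P_S1"
proof -
  have "emeasure (mollify r \<rho>) (space (mollify r \<rho>)) = (\<integral>\<^sup>+y. 1 \<partial>mollify r \<rho>)" by simp
  also have "\<dots> = 1"
    using r by (subst nn_integral_mollify) (auto simp: nn_integral_poisson R.emeasure_space_1)
  finally show ?thesis unfolding P_S1_def using sets_mollify by (auto intro: prob_spaceI)
qed

text \<open>The two arguments of the kernel are smoothed one after the other, with Fubini in
  between. Each smoothing costs \<open>- ln r / (2 * pi)\<close>.\<close>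

lemma F0_enn_mollify_le: "F0_enn (mollify r \<rho>) \<le> F0_enn \<rho> + ennreal (- ln r / pi)"
proof -
  let ?c = "ennreal (- ln r / (2 * pi))"
  interpret T: prob_space "mollify r \<rho>" using P_S1_D(1)[OF mollify_in_P_S1] .
  note [measurable_cong] = sets_mollify
  have "F0_enn (mollify r \<rho>) = (\<integral>\<^sup>+x. \<integral>\<^sup>+y. wk (x - y) \<partial>mollify r \<rho> \<partial>mollify r \<rho>)"
    by (rule F0_enn_iterated[OF mollify_in_P_S1])
  also have "\<dots> = (\<integral>\<^sup>+x. \<integral>\<^sup>+x'. \<integral>\<^sup>+y. ennreal (poisson r (y - x')) * wk (y - x) \<partial>leb_S1 \<partial>\<rho> \<partial>mollify r \<rho>)"
  proof (rule nn_integral_cong)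
    fix x
    have "(\<integral>\<^sup>+y. wk (x - y) \<partial>mollify r \<rho>) = (\<integral>\<^sup>+y. wk (y - x) \<partial>mollify r \<rho>)"
      by (intro nn_integral_cong wk_diff_commute)
    then show "(\<integral>\<^sup>+y. wk (x - y) \<partial>mollify r \<rho>) = (\<integral>\<^sup>+x'. \<integral>\<^sup>+y. ennreal (poisson r (y - x')) * wk (y - x) \<partial>leb_S1 \<partial>\<rho>)"
      by (simp add: nn_integral_mollify)
  qed
  also have "\<dots> \<le> (\<integral>\<^sup>+x. \<integral>\<^sup>+x'. wk (x' - x) + ?c \<partial>\<rho> \<partial>mollify r \<rho>)"
    by (intro nn_integral_mono poisson_potential_le_wk r)
  also have "\<dots> = (\<integral>\<^sup>+x. (\<integral>\<^sup>+x'. wk (x - x') \<partial>\<rho>) + ?c \<partial>mollify r \<rho>)"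
    by (intro nn_integral_cong, subst nn_integral_add)
       (auto simp: R.emeasure_space_1 intro!: nn_integral_cong arg_cong2[where f = "(+)"] wk_diff_commute)
  also have "\<dots> = (\<integral>\<^sup>+x. \<integral>\<^sup>+x'. wk (x - x') \<partial>\<rho> \<partial>mollify r \<rho>) + ?c"
    by (subst nn_integral_add) (auto simp: T.emeasure_space_1)
  also have "(\<integral>\<^sup>+x. \<integral>\<^sup>+x'. wk (x - x') \<partial>\<rho> \<partial>mollify r \<rho>) =
      (\<integral>\<^sup>+x'. \<integral>\<^sup>+x. wk (x - x') \<partial>mollify r \<rho> \<partial>\<rho>)"
  proof -
    interpret TR: pair_sigma_finite \<rho> "mollify r \<rho>" ..
    show ?thesis by (rule TR.Fubini') measurable
  qed
  also have "\<dots> = (\<integral>\<^sup>+x'. \<integral>\<^sup>+x. \<integral>\<^sup>+y. ennreal (poisson r (y - x)) * wk (y - x') \<partial>leb_S1 \<partial>\<rho> \<partial>\<rho>)"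
    by (simp add: nn_integral_mollify)
  also have "\<dots> \<le> (\<integral>\<^sup>+x'. \<integral>\<^sup>+x. wk (x - x') + ?c \<partial>\<rho> \<partial>\<rho>)"
    by (intro nn_integral_mono poisson_potential_le_wk r)
  also have "\<dots> = (\<integral>\<^sup>+x'. (\<integral>\<^sup>+x. wk (x' - x) \<partial>\<rho>) + ?c \<partial>\<rho>)"
    by (intro nn_integral_cong, subst nn_integral_add)
       (auto simp: R.emeasure_space_1 intro!: nn_integral_cong arg_cong2[where f = "(+)"] wk_diff_commute)
  also have "\<dots> = F0_enn \<rho> + ?c"
    by (subst nn_integral_add) (auto simp: R.emeasure_space_1 F0_enn_iterated[OF P])
  finally have "F0_enn (mollify r \<rho>) \<le> F0_enn \<rho> + ?c + ?c" by (simp add: add_right_mono)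
  also have "\<dots> = F0_enn \<rho> + ennreal (- ln r / pi)"
  proof -
    have nn: "0 \<le> - ln r / (2 * pi)" using r by (intro divide_nonneg_pos) auto
    have "?c + ?c = ennreal (- ln r / (2 * pi) + - ln r / (2 * pi))"
      by (rule ennreal_plus[OF nn nn, symmetric])
    also have "- ln r / (2 * pi) + - ln r / (2 * pi) = - ln r / pi" by (simp add: field_simps)
    finally show ?thesis by (simp add: add.assoc)
  qed
  finally show ?thesis .
qed

text \<open>Smoothing a single argument already makes the potential bounded, so the bound is uniform
  in \<open>\<rho>\<close> and covers measures of infinite energy.\<close>

lemma F0_enn_mollify_le_const: "F0_enn (mollify r \<rho>) \<le> ennreal ((ln 4 - ln ((1 - r)\<^sup>2)) / (2 * pi))"
proof -
  let ?c = "ennreal ((ln 4 - ln ((1 - r)\<^sup>2)) / (2 * pi))"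
  interpret T: prob_space "mollify r \<rho>" using P_S1_D(1)[OF mollify_in_P_S1] .
  note [measurable_cong] = sets_mollify
  have "F0_enn (mollify r \<rho>) = (\<integral>\<^sup>+x. \<integral>\<^sup>+y. wk (y - x) \<partial>mollify r \<rho> \<partial>mollify r \<rho>)"
    unfolding F0_enn_iterated[OF mollify_in_P_S1] by (intro nn_integral_cong wk_diff_commute)
  also have "\<dots> = (\<integral>\<^sup>+x. \<integral>\<^sup>+x'. \<integral>\<^sup>+y. ennreal (poisson r (y - x')) * wk (y - x) \<partial>leb_S1 \<partial>\<rho> \<partial>mollify r \<rho>)"
    by (simp add: nn_integral_mollify)
  also have "\<dots> \<le> (\<integral>\<^sup>+x. \<integral>\<^sup>+x'. ?c \<partial>\<rho> \<partial>mollify r \<rho>)"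
    using r by (intro nn_integral_mono poisson_potential_le_const) auto
  also have "\<dots> = ?c" by (simp add: R.emeasure_space_1 T.emeasure_space_1)
  finally show ?thesis .
qed

text \<open>The coupling sends each \<open>x\<close> to a random \<open>y\<close> with density
  \<open>poisson r (y - x)\<close>. Its cost is at most 18 times the mean of
  \<open>1 - cos (y - x)\<close>, which is exactly \<open>1 - r\<close>.\<close>

lemma W_per_mollify: "W_per \<rho> (mollify r \<rho>) \<le> sqrt (18 * (1 - r))"
proof -
  define D where "D z = ennreal (poisson r (snd z - fst z))" for z :: "real \<times> real"
  have [measurable]: "D \<in> borel_measurable (\<rho> \<Otimes>\<^sub>M leb_S1)" unfolding D_def by measurable
  define \<gamma> where "\<gamma> = density (\<rho> \<Otimes>\<^sub>M leb_S1) D"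
  have s [measurable_cong]: "sets \<gamma> = sets (S1 \<Otimes>\<^sub>M S1)"
    unfolding \<gamma>_def by (simp add: sets_pair_measure_cong[OF P_S1_D(2)[OF P] sets_leb_S1])
  have int: "(\<integral>\<^sup>+z. h z \<partial>\<gamma>) = (\<integral>\<^sup>+x. \<integral>\<^sup>+y. ennreal (poisson r (y - x)) * h (x, y) \<partial>leb_S1 \<partial>\<rho>)"
    if [measurable]: "h \<in> borel_measurable (S1 \<Otimes>\<^sub>M S1)" for h
    unfolding \<gamma>_def by (subst nn_integral_density) (auto simp: leb_S1.nn_integral_fst[symmetric] D_def)
  have "emeasure \<gamma> (space \<gamma>) = (\<integral>\<^sup>+z. 1 \<partial>\<gamma>)" by simp
  also have "\<dots> = 1" using r by (subst int) (auto simp: nn_integral_poisson R.emeasure_space_1)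
  finally interpret G: prob_space \<gamma> by (rule prob_spaceI)
  have dfst: "distr \<gamma> S1 fst = \<rho>"
  proof (rule measure_eqI)
    fix A assume "A \<in> sets (distr \<gamma> S1 fst)"
    then have A [measurable]: "A \<in> sets S1" by simp
    then have "emeasure (distr \<gamma> S1 fst) A = (\<integral>\<^sup>+x. indicator A x \<partial>distr \<gamma> S1 fst)" by simp
    also have "\<dots> = (\<integral>\<^sup>+z. indicator A (fst z) \<partial>\<gamma>)" by (rule nn_integral_distr) auto
    also have "\<dots> = (\<integral>\<^sup>+x. \<integral>\<^sup>+y. ennreal (poisson r (y - x)) * indicator A x \<partial>leb_S1 \<partial>\<rho>)"
      by (subst int) auto
    also have "\<dots> = (\<integral>\<^sup>+x. indicator A x \<partial>\<rho>)"
      using r by (intro nn_integral_cong, subst nn_integral_multc) (auto simp: nn_integral_poisson)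
    also have "\<dots> = emeasure \<rho> A" using A P_S1_D(2)[OF P] by simp
    finally show "emeasure (distr \<gamma> S1 fst) A = emeasure \<rho> A" .
  qed (simp add: P_S1_D(2)[OF P])
  have dsnd: "distr \<gamma> S1 snd = mollify r \<rho>"
  proof (rule measure_eqI)
    fix A assume "A \<in> sets (distr \<gamma> S1 snd)"
    then have A [measurable]: "A \<in> sets S1" by simp
    then have "emeasure (distr \<gamma> S1 snd) A = (\<integral>\<^sup>+x. indicator A x \<partial>distr \<gamma> S1 snd)" by simp
    also have "\<dots> = (\<integral>\<^sup>+z. indicator A (snd z) \<partial>\<gamma>)" by (rule nn_integral_distr) auto
    also have "\<dots> = (\<integral>\<^sup>+x. \<integral>\<^sup>+y. ennreal (poisson r (y - x)) * indicator A y \<partial>leb_S1 \<partial>\<rho>)"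
      by (subst int) auto
    also have "\<dots> = (\<integral>\<^sup>+x. indicator A x \<partial>mollify r \<rho>)" by (subst nn_integral_mollify) auto
    also have "\<dots> = emeasure (mollify r \<rho>) A" using A sets_mollify by simp
    finally show "emeasure (distr \<gamma> S1 snd) A = emeasure (mollify r \<rho>) A" .
  qed (simp add: sets_mollify)
  have "\<gamma> \<in> couplings \<rho> (mollify r \<rho>)"
    unfolding couplings_def using s dfst dsnd G.prob_space_axioms by simp
  then have "W_per \<rho> (mollify r \<rho>) \<le> cost \<gamma>" by (rule W_per_le_cost)
  also have "cost \<gamma> \<le> sqrt (18 * (1 - r))"
    unfolding cost_def
  proof (rule real_sqrt_le_mono)
    have I: "integrable \<gamma> (\<lambda>z. (d_per (fst z) (snd z))\<^sup>2)"
      by (rule bounded_d_per_integrable) (auto simp: G.prob_space_axioms)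
    have "ennreal (\<integral>z. (d_per (fst z) (snd z))\<^sup>2 \<partial>\<gamma>) = (\<integral>\<^sup>+z. ennreal ((d_per (fst z) (snd z))\<^sup>2) \<partial>\<gamma>)"
      by (rule nn_integral_eq_integral[symmetric, OF I]) simp
    also have "\<dots> \<le> (\<integral>\<^sup>+z. ennreal (18 * (1 - cos (snd z - fst z))) \<partial>\<gamma>)"
      by (intro nn_integral_mono ennreal_leI d_per_square_le)
    also have "\<dots> = (\<integral>\<^sup>+x. \<integral>\<^sup>+y. ennreal (poisson r (y - x)) * ennreal (18 * (1 - cos (y - x))) \<partial>leb_S1 \<partial>\<rho>)"
      by (subst int) auto
    also have "\<dots> = (\<integral>\<^sup>+x. \<integral>\<^sup>+y. ennreal (poisson r (y - x) * (18 * (1 - cos (y - x)))) \<partial>leb_S1 \<partial>\<rho>)"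
      using r by (intro nn_integral_cong ennreal_mult[symmetric] poisson_nonneg) auto
    also have "\<dots> = (\<integral>\<^sup>+x. ennreal (18 * (1 - r)) \<partial>\<rho>)"
    proof (rule nn_integral_cong, rule nn_integral_leb_S1_has_integral)
      fix x y
      show "0 \<le> poisson r (y - x) * (18 * (1 - cos (y - x)))"
        using r by (intro mult_nonneg_nonneg poisson_nonneg) auto
      have "((\<lambda>y. 18 * (poisson r (y - x) - poisson r (y - x) * cos (y - x))) has_integral 18 * (1 - r)) {-pi..pi}"
        using r by (intro has_integral_mult_right has_integral_diff poisson_integral poisson_cos_integral) auto
      then show "((\<lambda>y. poisson r (y - x) * (18 * (1 - cos (y - x)))) has_integral 18 * (1 - r)) {-pi..pi}"
        by (simp add: algebra_simps)
    qed
    also have "\<dots> = ennreal (18 * (1 - r))" by (simp add: R.emeasure_space_1)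
    finally show "(\<integral>z. (d_per (fst z) (snd z))\<^sup>2 \<partial>\<gamma>) \<le> 18 * (1 - r)"
      using r by (subst (asm) ennreal_le_iff) auto
  qed
  finally show ?thesis .
qed

end

section \<open>Entropy and truncated interaction energies\<close>

lemma mult_ln_ge: "- 1 \<le> x * ln x" if "0 \<le> x" for x :: real
proof (cases "x = 0")
  case False
  then have x: "x > 0" using that by simp
  have "x * (- ln x) \<le> x * (1 / x - 1)"
    using ln_le_minus_one[of "1 / x"] x by (intro mult_left_mono) (auto simp: ln_div)
  then show ?thesis using x by (simp add: algebra_simps)
qed simp

lemma mult_ln_le: "x * ln x \<le> b\<^sup>2" if "0 \<le> x" "x \<le> b" for x b :: real
proof (cases "x = 0")
  case False
  then have "x > 0" using that by simp
  then have "x * ln x \<le> x * x" using ln_le_minus_one[of x] by (intro mult_left_mono) auto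
  also have "\<dots> \<le> b * b" using that by (intro mult_mono) auto
  finally show ?thesis by (simp add: power2_eq_square)
qed simp

text \<open>The integrand is at least -1 and the circle has length \<open>2 * pi\<close>. Because of
  this bound, entropy can be discarded at a cost proportional to \<nu>.\<close>

lemma entropy_S1_ge: "ereal (- (2 * pi)) \<le> entropy_S1 \<mu>"
proof (cases "absolutely_continuous leb_S1 \<mu>")
  case True
  define f where "f x = enn2real (RN_deriv leb_S1 \<mu> x)" for x
  let ?A = "\<integral>\<^sup>+x. ennreal (f x * ln (f x)) \<partial>leb_S1" and ?B = "\<integral>\<^sup>+x. ennreal (- (f x * ln (f x))) \<partial>leb_S1"
  have "?B \<le> (\<integral>\<^sup>+x. 1 \<partial>leb_S1)"
    using mult_ln_ge[of "f x" for x] by (intro nn_integral_mono) (simp add: f_def ennreal_le_1 minus_le_iff)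
  also have "\<dots> = ennreal (2 * pi)" by (simp add: space_leb_S1 emeasure_space_leb_S1)
  finally have "enn2ereal ?B \<le> enn2ereal (ennreal (2 * pi))" by (simp only: less_eq_ennreal.rep_eq)
  then have "enn2ereal ?B \<le> ereal (2 * pi)" by simp
  then have "0 - ereal (2 * pi) \<le> enn2ereal ?A - enn2ereal ?B" by (intro ereal_minus_mono) auto
  then show ?thesis using True by (simp add: entropy_S1_def f_def Let_def)
qed (simp add: entropy_S1_def)

lemma entropy_S1_mollify_le:
  assumes P: "\<rho> \<in> P_S1" and r: "0 < r" "r < 1"
  shows "entropy_S1 (mollify r \<rho>) \<le> ereal (2 * pi / (1 - r) ^ 4)"
proof -
  interpret R: prob_space \<rho> using P_S1_D(1)[OF P] .
  let ?D = "\<lambda>y. \<integral>\<^sup>+x. ennreal (poisson r (y - x)) \<partial>\<rho>"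
  let ?b = "1 / (1 - r)\<^sup>2"
  have m: "?D \<in> borel_measurable leb_S1" by (rule mollify_density_measurable[OF P r])
  have ac: "absolutely_continuous leb_S1 (mollify r \<rho>)"
    unfolding mollify_def by (rule absolutely_continuousI_density[OF m])
  have D_le: "?D y \<le> ennreal ?b" for y
  proof -
    have "?D y \<le> (\<integral>\<^sup>+x. ennreal ?b \<partial>\<rho>)"
      using r by (intro nn_integral_mono ennreal_leI poisson_le) auto
    then show ?thesis by (simp add: R.emeasure_space_1)
  qed
  define f where "f x = enn2real (RN_deriv leb_S1 (mollify r \<rho>) x)" for x
  have sf: "sigma_finite_measure (mollify r \<rho>)"
    using P_S1_D(1)[OF mollify_in_P_S1[OF P r]] by (simp add: prob_space_imp_sigma_finite)
  \<comment> \<open>\<open>entropy_S1\<close> is written with \<open>RN_deriv\<close>, which agrees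
    with the explicit density only almost everywhere.\<close>
  have "AE x in leb_S1. ?D x = RN_deriv leb_S1 (mollify r \<rho>) x"
    by (rule RN_deriv_unique_sigma_finite[OF m _ sf]) (simp add: mollify_def)
  then have "AE x in leb_S1. ennreal (f x * ln (f x)) \<le> ennreal (?b\<^sup>2)"
  proof eventually_elim
    case (elim x)
    then have "f x = enn2real (?D x)" by (simp add: f_def)
    moreover have "enn2real (?D x) \<le> ?b" using D_le[of x] by (rule enn2real_leI[rotated]) simp
    ultimately show ?case by (intro ennreal_leI mult_ln_le) auto
  qed
  then have "(\<integral>\<^sup>+x. ennreal (f x * ln (f x)) \<partial>leb_S1) \<le> (\<integral>\<^sup>+x. ennreal (?b\<^sup>2) \<partial>leb_S1)"
    by (rule nn_integral_mono_AE)
  also have "\<dots> = ennreal (?b\<^sup>2 * (2 * pi))"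
    by (simp add: space_leb_S1 emeasure_space_leb_S1 ennreal_mult)
  also have "?b\<^sup>2 * (2 * pi) = 2 * pi / (1 - r) ^ 4"
    by (simp add: power_divide power_mult[symmetric])
  finally have "enn2ereal (\<integral>\<^sup>+x. ennreal (f x * ln (f x)) \<partial>leb_S1) \<le> enn2ereal (ennreal (2 * pi / (1 - r) ^ 4))"
    by (simp only: less_eq_ennreal.rep_eq)
  then have "enn2ereal (\<integral>\<^sup>+x. ennreal (f x * ln (f x)) \<partial>leb_S1) \<le> ereal (2 * pi / (1 - r) ^ 4)"
    using r by simp
  then have "enn2ereal (\<integral>\<^sup>+x. ennreal (f x * ln (f x)) \<partial>leb_S1)
      - enn2ereal (\<integral>\<^sup>+x. ennreal (- (f x * ln (f x))) \<partial>leb_S1) \<le> ereal (2 * pi / (1 - r) ^ 4) - 0"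
    by (intro ereal_minus_mono) auto
  then show ?thesis using ac by (simp add: entropy_S1_def f_def Let_def)
qed

text \<open>This puts the interaction energy in place of \<open>F_energy \<nu>\<close> in the
  integrated inequality, so that both flows are measured by the same functional.\<close>

lemma F0_le_F_energy:
  assumes "0 \<le> \<nu>"
  shows "F0 \<mu> \<le> F_energy \<nu> \<mu> + ereal (2 * pi * \<nu>)"
proof (cases "\<nu> = 0")
  case False
  have "ereal \<nu> * ereal (- (2 * pi)) \<le> ereal \<nu> * entropy_S1 \<mu>"
    using assms entropy_S1_ge[of \<mu>] by (intro ereal_mult_left_mono) auto
  then have "- ereal (2 * pi * \<nu>) \<le> ereal \<nu> * entropy_S1 \<mu>" by (simp add: mult_ac)
  then show ?thesis using False
    by (cases "F0 \<mu>"; cases "ereal \<nu> * entropy_S1 \<mu>") (auto simp: F_energy_def F0_def)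
qed (simp add: F_energy_def)

lemma F_energy_mollify_le:
  assumes P: "\<rho> \<in> P_S1" and r: "0 < r" "r < 1" and "0 \<le> \<nu>" and E: "F0_enn (mollify r \<rho>) \<le> ennreal c" "0 \<le> c"
  shows "F_energy \<nu> (mollify r \<rho>) \<le> ereal (\<nu> * (2 * pi / (1 - r) ^ 4) + c)"
proof -
  have "F0 (mollify r \<rho>) \<le> enn2ereal (ennreal c)"
    using E(1) by (simp only: F0_eq_F0_enn less_eq_ennreal.rep_eq)
  then have F: "F0 (mollify r \<rho>) \<le> ereal c" using E(2) by simp
  show ?thesis
  proof (cases "\<nu> = 0")
    case False
    have "ereal \<nu> * entropy_S1 (mollify r \<rho>) \<le> ereal \<nu> * ereal (2 * pi / (1 - r) ^ 4)"
      using assms entropy_S1_mollify_le[OF P r] by (intro ereal_mult_left_mono) auto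
    then have "ereal \<nu> * entropy_S1 (mollify r \<rho>) + F0 (mollify r \<rho>) \<le> ereal \<nu> * ereal (2 * pi / (1 - r) ^ 4) + ereal c"
      using F by (rule add_mono)
    then show ?thesis using False by (simp add: F_energy_def)
  qed (use F in \<open>simp add: F_energy_def\<close>)
qed

text \<open>Let \<open>a = 1 / (n + 1)\<close> and \<open>s = (1 - cos t) / 2\<close>. Adding
  \<open>a\<close> removes the singularity, and dividing by \<open>1 + a\<close> keeps the argument
  of the logarithm in (0, 1], hence the kernel nonnegative. Since
  \<open>(a + s) / (1 + a) = 1 - (1 - s) / (1 + a)\<close>, the truncations increase with
  \<open>n\<close>.\<close>

definition wk_trunc :: "nat \<Rightarrow> real \<Rightarrow> real" where
  "wk_trunc n t = - (1 / (2 * pi)) * ln ((1 / (real n + 1) + (1 - cos t) / 2) / (1 + 1 / (real n + 1)))"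

lemma wk_trunc_measurable [measurable]: "wk_trunc n \<in> borel_measurable borel"
  unfolding wk_trunc_def by measurable

lemma wk_trunc_arg:
  fixes a s :: real
  assumes "0 < a" "0 \<le> s" "s \<le> 1"
  shows "0 < (a + s) / (1 + a)" "(a + s) / (1 + a) \<le> 1"
  using assms by (auto simp: field_simps)

lemma half_one_minus_cos: "0 \<le> (1 - cos t) / 2" "(1 - cos t) / 2 \<le> (1::real)"
  using cos_le_one[of t] cos_ge_minus_one[of t] by auto

lemma wk_trunc_nonneg: "0 \<le> wk_trunc n t"
proof -
  have "ln ((1 / (real n + 1) + (1 - cos t) / 2) / (1 + 1 / (real n + 1))) \<le> 0"
    by (subst ln_le_zero_iff; intro wk_trunc_arg half_one_minus_cos) simp_all
  then show ?thesis unfolding wk_trunc_def by (intro mult_nonpos_nonpos) auto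
qed

text \<open>The logarithm has slope at most \<open>1 / a = n + 1\<close> to the right of
  \<open>a\<close>. The cosine is the natural variable, being periodic and thus controlled by
  \<open>d_per\<close>.\<close>

lemma wk_trunc_lipschitz_cos: "\<bar>wk_trunc n s - wk_trunc n t\<bar> \<le> (real n + 1) * \<bar>cos s - cos t\<bar>"
proof -
  have le: "wk_trunc n s - wk_trunc n t \<le> (real n + 1) * \<bar>cos s - cos t\<bar>" for s t
  proof -
    define a where "a = 1 / (real n + 1)"
    define x where "x = a + (1 - cos s) / 2"
    define y where "y = a + (1 - cos t) / 2"
    have a: "a > 0" "1 / a = real n + 1" by (auto simp: a_def)
    have x: "x \<ge> a" "y \<ge> a" using half_one_minus_cos[of s] half_one_minus_cos[of t] by (auto simp: x_def y_def)
    have "wk_trunc n s - wk_trunc n t = 1 / (2 * pi) * (ln (y / (1 + a)) - ln (x / (1 + a)))"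
      by (simp add: wk_trunc_def a_def x_def y_def algebra_simps)
    also have "ln (y / (1 + a)) - ln (x / (1 + a)) = ln (y / x)"
      using x a by (simp add: ln_div)
    also have "1 / (2 * pi) * ln (y / x) \<le> 1 / (2 * pi) * (\<bar>y - x\<bar> / a)"
    proof (intro mult_left_mono)
      have "ln (y / x) \<le> y / x - 1" using x a by (intro ln_le_minus_one) auto
      also have "\<dots> = (y - x) / x" using x a by (simp add: field_simps)
      also have "\<dots> \<le> \<bar>y - x\<bar> / x" using x a by (intro divide_right_mono) auto
      also have "\<dots> \<le> \<bar>y - x\<bar> / a" using x a by (intro divide_left_mono) auto
      finally show "ln (y / x) \<le> \<bar>y - x\<bar> / a" .
    qed auto
    also have "\<dots> \<le> 1 * (\<bar>y - x\<bar> / a)"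
      using a pi_gt3 by (intro mult_right_mono) auto
    also have "\<dots> = (real n + 1) * \<bar>y - x\<bar>" unfolding a(2)[symmetric] by simp
    also have "\<bar>y - x\<bar> = \<bar>cos s - cos t\<bar> / 2" by (simp add: x_def y_def diff_divide_distrib[symmetric])
    also have "(real n + 1) * (\<bar>cos s - cos t\<bar> / 2) \<le> (real n + 1) * \<bar>cos s - cos t\<bar>"
      by (intro mult_left_mono) auto
    finally show ?thesis .
  qed
  from le[of s t] le[of t s] show ?thesis by (simp add: abs_le_iff abs_minus_commute)
qed

lemma cos_lipschitz: "\<bar>cos s - cos t\<bar> \<le> \<bar>s - t\<bar>" for s t :: real
proof -
  have "\<bar>cos s - cos t\<bar> = 2 * (\<bar>sin ((s + t) / 2)\<bar> * \<bar>sin ((t - s) / 2)\<bar>)"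
    unfolding cos_diff_cos by (simp add: abs_mult)
  also have "\<dots> \<le> 2 * (1 * \<bar>(t - s) / 2\<bar>)"
    by (intro mult_left_mono mult_mono abs_sin_le_one abs_sin_x_le_abs_x) auto
  finally show ?thesis by simp
qed

lemma cos_diff_d_per: "\<bar>cos (x - y) - cos (x' - y')\<bar> \<le> d_per x x' + d_per y y'"
proof -
  obtain k :: int where k: "d_per x x' = \<bar>x - x' + 2 * pi * of_int k\<bar>" using d_per_attained by blast
  obtain l :: int where l: "d_per y y' = \<bar>y - y' + 2 * pi * of_int l\<bar>" using d_per_attained by blast
  have per: "cos (t + 2 * pi * of_int j) = cos t" for t and j :: int by (simp add: cos_add)
  have "cos (x - y) = cos (x - y + 2 * pi * of_int (k - l))" by (rule per[symmetric])
  then have "\<bar>cos (x - y) - cos (x' - y')\<bar> \<le> \<bar>x - y + 2 * pi * of_int (k - l) - (x' - y')\<bar>"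
    using cos_lipschitz by simp
  also have "\<dots> = \<bar>(x - x' + 2 * pi * of_int k) - (y - y' + 2 * pi * of_int l)\<bar>"
    by (simp add: algebra_simps)
  also have "\<dots> \<le> d_per x x' + d_per y y'" unfolding k l by (rule abs_triangle_ineq4)
  finally show ?thesis .
qed

lemma wk_trunc_mono: "m \<le> n \<Longrightarrow> wk_trunc m t \<le> wk_trunc n t"
proof -
  assume mn: "m \<le> n"
  define s where "s = (1 - cos t) / 2"
  have s: "0 \<le> s" "s \<le> 1" using half_one_minus_cos[of t] by (auto simp: s_def)
  define a b where "a = 1 / (real m + 1)" and "b = 1 / (real n + 1)"
  have ab: "0 < b" "b \<le> a" "0 < a" using mn by (auto simp: a_def b_def field_simps)
  have "(b + s) / (1 + b) \<le> (a + s) / (1 + a)"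
  proof -
    have "(b + s) / (1 + b) = 1 - (1 - s) / (1 + b)" "(a + s) / (1 + a) = 1 - (1 - s) / (1 + a)"
      using ab by (auto simp: field_simps)
    moreover have "(1 - s) / (1 + a) \<le> (1 - s) / (1 + b)"
      using ab s by (intro divide_left_mono) auto
    ultimately show ?thesis by simp
  qed
  then have "ln ((b + s) / (1 + b)) \<le> ln ((a + s) / (1 + a))"
    using wk_trunc_arg(1)[of b s] wk_trunc_arg(1)[of a s] ab s by simp
  then have "- (1 / (2 * pi)) * ln ((a + s) / (1 + a)) \<le> - (1 / (2 * pi)) * ln ((b + s) / (1 + b))"
    by (intro mult_left_mono_neg) auto
  then show "wk_trunc m t \<le> wk_trunc n t" by (simp add: wk_trunc_def a_def b_def s_def)
qed

lemma wk_trunc_le: "wk_trunc n t \<le> wk_trunc n 0"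
proof -
  define a where "a = 1 / (real n + 1)"
  have a: "a > 0" by (simp add: a_def)
  have "ln (a / (1 + a)) \<le> ln ((a + (1 - cos t) / 2) / (1 + a))"
    using a half_one_minus_cos[of t] by (subst ln_le_cancel_iff) (auto intro!: divide_right_mono divide_pos_pos add_pos_nonneg)
  then have "- (1 / (2 * pi)) * ln ((a + (1 - cos t) / 2) / (1 + a)) \<le> - (1 / (2 * pi)) * ln (a / (1 + a))"
    by (intro mult_left_mono_neg) auto
  then show ?thesis by (simp add: wk_trunc_def a_def)
qed

lemma SUP_wk_trunc: "(SUP n. ennreal (wk_trunc n t)) = wk t"
proof -
  have inc: "incseq (\<lambda>n. ennreal (wk_trunc n t))" by (intro incseq_SucI ennreal_leI wk_trunc_mono) simp
  have "(\<lambda>n. ennreal (wk_trunc n t)) \<longlonglongrightarrow> wk t"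
  proof (cases "cos t = 1")
    case True
    have "filterlim (\<lambda>n. - (1 / (2 * pi)) * ln ((1 / (real n + 1)) / (1 + 1 / (real n + 1)))) at_top sequentially"
      by real_asymp
    then have "filterlim (\<lambda>n. wk_trunc n t) at_top sequentially" using True by (simp add: wk_trunc_def)
    then have "((\<lambda>n. ennreal (wk_trunc n t)) \<longlongrightarrow> top) sequentially"
      unfolding tendsto_top_iff_ennreal filterlim_at_top_dense
      by (simp add: ennreal_less_iff)
    then show ?thesis using True by (simp add: wk_def)
  next
    case False
    then have "cos t < 1" using cos_le_one[of t] by linarith
    then have pos: "0 < (1 - cos t) / 2" by simp
    have "(\<lambda>n. 1 / (real n + 1)) \<longlonglongrightarrow> 0" by real_asymp
    then have "(\<lambda>n. ennreal (wk_trunc n t)) \<longlonglongrightarrow> ennreal (- (1 / (2 * pi)) * ln ((0 + (1 - cos t) / 2) / (1 + 0)))"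
      unfolding wk_trunc_def by (intro tendsto_ennrealI tendsto_intros) (use pos in auto)
    then show ?thesis using False by (simp add: wk_def)
  qed
  then show ?thesis using LIMSEQ_SUP[OF inc] LIMSEQ_unique by blast
qed

lemma wk_trunc_diff_measurable:
  assumes "sets \<mu> = sets S1"
  shows "(\<lambda>z. wk_trunc n (fst z - snd z)) \<in> borel_measurable (\<mu> \<Otimes>\<^sub>M \<mu>)"
proof -
  have id: "(\<lambda>x. x) \<in> borel_measurable \<mu>"
    using measurable_id_S1 assms by (simp cong: measurable_cong_sets)
  have "(\<lambda>z. fst z - snd z) \<in> borel_measurable (\<mu> \<Otimes>\<^sub>M \<mu>)"
    by (intro borel_measurable_diff measurable_compose[OF measurable_fst id] measurable_compose[OF measurable_snd id])
  then show ?thesis by (rule measurable_compose[OF _ wk_trunc_measurable])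
qed

text \<open>The energy is not known to be finite or continuous along a flow. Its truncations are
  Lipschitz for \<open>W_per\<close>, hence continuous in positive time, and monotone convergence
  recovers the energy from them.\<close>

definition F0_trunc :: "nat \<Rightarrow> real measure \<Rightarrow> real" where
  "F0_trunc n \<mu> = (\<integral>z. wk_trunc n (fst z - snd z) \<partial>(\<mu> \<Otimes>\<^sub>M \<mu>))"

lemma ennreal_F0_trunc:
  assumes "\<mu> \<in> P_S1"
  shows "ennreal (F0_trunc n \<mu>) = (\<integral>\<^sup>+z. ennreal (wk_trunc n (fst z - snd z)) \<partial>(\<mu> \<Otimes>\<^sub>M \<mu>))"
proof -
  interpret prob_space \<mu> using P_S1_D(1)[OF assms] .
  interpret pair_prob_space \<mu> \<mu> ..
  have "integrable (\<mu> \<Otimes>\<^sub>M \<mu>) (\<lambda>z. wk_trunc n (fst z - snd z))"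
    using wk_trunc_diff_measurable[OF P_S1_D(2)[OF assms]]
    by (intro integrable_const_bound[where B = "wk_trunc n 0"]) (simp_all add: wk_trunc_nonneg wk_trunc_le)
  then show ?thesis unfolding F0_trunc_def
    by (intro nn_integral_eq_integral[symmetric]) (simp_all add: wk_trunc_nonneg)
qed

lemma F0_trunc_nonneg: "0 \<le> F0_trunc n \<mu>"
  unfolding F0_trunc_def by (intro Bochner_Integration.integral_nonneg wk_trunc_nonneg)

lemma SUP_F0_trunc:
  assumes "\<mu> \<in> P_S1"
  shows "F0_enn \<mu> = (SUP n. ennreal (F0_trunc n \<mu>))"
proof -
  have "incseq (\<lambda>n z. ennreal (wk_trunc n (fst z - snd z)))"
    by (auto simp: incseq_def le_fun_def intro!: ennreal_leI wk_trunc_mono)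
  then show ?thesis
    unfolding F0_enn_def SUP_wk_trunc[symmetric] ennreal_F0_trunc[OF assms]
    using wk_trunc_diff_measurable[OF P_S1_D(2)[OF assms]]
    by (intro nn_integral_monotone_convergence_SUP) simp_all
qed

lemma F0_trunc_mono:
  assumes "\<mu> \<in> P_S1" "m \<le> n"
  shows "F0_trunc m \<mu> \<le> F0_trunc n \<mu>"
proof -
  have "ennreal (F0_trunc m \<mu>) \<le> ennreal (F0_trunc n \<mu>)"
    unfolding ennreal_F0_trunc[OF assms(1)] by (intro nn_integral_mono ennreal_leI wk_trunc_mono assms)
  then show ?thesis using F0_trunc_nonneg by simp
qed

text \<open>The product of \<open>\<gamma>\<close> with itself couples the two product measures; the
  factor 2 counts their two coordinates.\<close>

lemma F0_trunc_le_cost: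
  assumes \<gamma>: "\<gamma> \<in> couplings \<mu> \<rho>"
  shows "\<bar>F0_trunc n \<mu> - F0_trunc n \<rho>\<bar> \<le> 2 * (real n + 1) * cost \<gamma>"
proof -
  interpret G: prob_space \<gamma> using couplingsD(1)[OF \<gamma>] .
  interpret GG: pair_prob_space \<gamma> \<gamma> ..
  note m [measurable] = couplings_measurable[OF \<gamma>]
  have sf: "sigma_finite_measure (distr \<gamma> S1 fst)" "sigma_finite_measure (distr \<gamma> S1 snd)"
    by (intro prob_space_imp_sigma_finite G.prob_space_distr m)+
  have eq1: "F0_trunc n \<mu> = (\<integral>w. wk_trunc n (fst (fst w) - fst (snd w)) \<partial>(\<gamma> \<Otimes>\<^sub>M \<gamma>))"
    unfolding F0_trunc_def couplingsD(3)[OF \<gamma>, symmetric] pair_measure_distr[OF m(1) m(1) sf(1)]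
    by (subst integral_distr) (auto simp: split_beta')
  have eq2: "F0_trunc n \<rho> = (\<integral>w. wk_trunc n (snd (fst w) - snd (snd w)) \<partial>(\<gamma> \<Otimes>\<^sub>M \<gamma>))"
    unfolding F0_trunc_def couplingsD(4)[OF \<gamma>, symmetric] pair_measure_distr[OF m(2) m(2) sf(2)]
    by (subst integral_distr) (auto simp: split_beta')
  have I: "integrable (\<gamma> \<Otimes>\<^sub>M \<gamma>) (\<lambda>w. wk_trunc n (fst (fst w) - fst (snd w)))"
    "integrable (\<gamma> \<Otimes>\<^sub>M \<gamma>) (\<lambda>w. wk_trunc n (snd (fst w) - snd (snd w)))"
    by (rule GG.integrable_const_bound[where B = "wk_trunc n 0"]; simp add: wk_trunc_nonneg wk_trunc_le)+
  have J: "integrable (\<gamma> \<Otimes>\<^sub>M \<gamma>) (\<lambda>w. d_per (fst (fst w)) (snd (fst w)))"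
    "integrable (\<gamma> \<Otimes>\<^sub>M \<gamma>) (\<lambda>w. d_per (fst (snd w)) (snd (snd w)))"
    by (rule bounded_d_per_integrable; simp add: GG.prob_space_axioms)+
  have L1: "(\<integral>z. d_per (fst z) (snd z) \<partial>\<gamma>) \<le> cost \<gamma>"
  proof -
    have K: "integrable \<gamma> (\<lambda>z. d_per (fst z) (snd z))" "integrable \<gamma> (\<lambda>z. (d_per (fst z) (snd z))\<^sup>2)"
      by (rule bounded_d_per_integrable; simp add: G.prob_space_axioms)+
    \<comment> \<open>Cauchy-Schwarz for a probability measure, in the form that a variance is
      nonnegative.\<close>
    have "(\<integral>z. d_per (fst z) (snd z) \<partial>\<gamma>)\<^sup>2 \<le> (\<integral>z. (d_per (fst z) (snd z))\<^sup>2 \<partial>\<gamma>)"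
      using G.variance_eq[OF K] G.variance_positive[of "\<lambda>z. d_per (fst z) (snd z)"] by simp
    then show ?thesis unfolding cost_def by (rule real_le_rsqrt)
  qed
  have "\<bar>F0_trunc n \<mu> - F0_trunc n \<rho>\<bar> = \<bar>\<integral>w. wk_trunc n (fst (fst w) - fst (snd w)) - wk_trunc n (snd (fst w) - snd (snd w)) \<partial>(\<gamma> \<Otimes>\<^sub>M \<gamma>)\<bar>"
    unfolding eq1 eq2 using I by simp
  also have "\<dots> \<le> (\<integral>w. \<bar>wk_trunc n (fst (fst w) - fst (snd w)) - wk_trunc n (snd (fst w) - snd (snd w))\<bar> \<partial>(\<gamma> \<Otimes>\<^sub>M \<gamma>))"
    by (rule integral_abs_bound)
  also have "\<dots> \<le> (\<integral>w. (real n + 1) * (d_per (fst (fst w)) (snd (fst w)) + d_per (fst (snd w)) (snd (snd w))) \<partial>(\<gamma> \<Otimes>\<^sub>M \<gamma>))"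
    using I J by (intro integral_mono order_trans[OF wk_trunc_lipschitz_cos] mult_left_mono cos_diff_d_per) auto
  also have "\<dots> = (real n + 1) * ((\<integral>w. d_per (fst (fst w)) (snd (fst w)) \<partial>(\<gamma> \<Otimes>\<^sub>M \<gamma>)) + (\<integral>w. d_per (fst (snd w)) (snd (snd w)) \<partial>(\<gamma> \<Otimes>\<^sub>M \<gamma>)))"
    using J by simp
  also have "(\<integral>w. d_per (fst (fst w)) (snd (fst w)) \<partial>(\<gamma> \<Otimes>\<^sub>M \<gamma>)) = (\<integral>z. d_per (fst z) (snd z) \<partial>\<gamma>)"
    using GG.integral_fst'[OF J(1)] by (simp add: G.prob_space)
  also have "(\<integral>w. d_per (fst (snd w)) (snd (snd w)) \<partial>(\<gamma> \<Otimes>\<^sub>M \<gamma>)) = (\<integral>z. d_per (fst z) (snd z) \<partial>\<gamma>)"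
    using GG.integral_fst'[OF J(2)] by (simp add: G.prob_space)
  also have "(real n + 1) * ((\<integral>z. d_per (fst z) (snd z) \<partial>\<gamma>) + (\<integral>z. d_per (fst z) (snd z) \<partial>\<gamma>)) \<le> (real n + 1) * (cost \<gamma> + cost \<gamma>)"
    by (intro mult_left_mono add_mono L1) auto
  finally show ?thesis by (simp add: algebra_simps)
qed

lemma F0_trunc_lipschitz:
  assumes "\<mu> \<in> P_S1" "\<rho> \<in> P_S1"
  shows "\<bar>F0_trunc n \<mu> - F0_trunc n \<rho>\<bar> \<le> 2 * (real n + 1) * W_per \<mu> \<rho>"
proof (rule field_le_epsilon)
  fix e :: real assume e: "e > 0"
  define c where "c = e / (2 * (real n + 1))"
  have c: "c > 0" "2 * (real n + 1) * c = e" using e by (auto simp: c_def)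
  obtain \<gamma> where \<gamma>: "\<gamma> \<in> couplings \<mu> \<rho>" "cost \<gamma> < W_per \<mu> \<rho> + c"
    using W_per_approx[OF assms, of "W_per \<mu> \<rho> + c"] c by auto
  have "\<bar>F0_trunc n \<mu> - F0_trunc n \<rho>\<bar> \<le> 2 * (real n + 1) * (W_per \<mu> \<rho> + c)"
    by (rule order_trans[OF F0_trunc_le_cost[OF \<gamma>(1), of n]]) (use \<gamma>(2) in \<open>intro mult_left_mono, auto\<close>)
  then show "\<bar>F0_trunc n \<mu> - F0_trunc n \<rho>\<bar> \<le> 2 * (real n + 1) * W_per \<mu> \<rho> + e"
    using c(2) by (simp add: distrib_left)
qed

section \<open>The integrated evolution variational inequality\<close>

lemma W_per_diff_le:
  assumes "\<mu> \<in> P_S1" "\<rho> \<in> P_S1" "\<sigma> \<in> P_S1"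
  shows "\<bar>W_per \<mu> \<sigma> - W_per \<rho> \<sigma>\<bar> \<le> W_per \<mu> \<rho>"
  using W_per_triangle[OF assms] W_per_triangle[OF assms(2,1,3)] W_per_commute[OF assms(1,2)] by linarith

lemma W_per_square_diff_le:
  assumes P: "\<mu> \<in> P_S1" "\<rho> \<in> P_S1" "\<sigma> \<in> P_S1"
  shows "\<bar>(W_per \<mu> \<sigma>)\<^sup>2 - (W_per \<rho> \<sigma>)\<^sup>2\<bar> \<le> 2 * pi * W_per \<mu> \<rho>"
proof -
  have "\<bar>(W_per \<mu> \<sigma>)\<^sup>2 - (W_per \<rho> \<sigma>)\<^sup>2\<bar> = \<bar>W_per \<mu> \<sigma> + W_per \<rho> \<sigma>\<bar> * \<bar>W_per \<mu> \<sigma> - W_per \<rho> \<sigma>\<bar>"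
    by (simp add: abs_mult[symmetric] power2_eq_square algebra_simps)
  also have "\<dots> \<le> (2 * pi) * W_per \<mu> \<rho>"
    using P W_per_diff_le[OF P] W_per_nonneg[of \<mu> \<sigma>] W_per_nonneg[of \<rho> \<sigma>] W_per_le_pi[of \<mu> \<sigma>] W_per_le_pi[of \<rho> \<sigma>]
    by (intro mult_mono) auto
  finally show ?thesis .
qed

lemma continuous_on_dominated:
  fixes f J :: "real \<Rightarrow> real"
  assumes "continuous_on S J" and bd: "\<And>s t. s \<in> S \<Longrightarrow> t \<in> S \<Longrightarrow> \<bar>f s - f t\<bar> \<le> L * \<bar>J s - J t\<bar>"
  shows "continuous_on S f"
  unfolding continuous_on_def
proof
  fix x assume x: "x \<in> S"
  then have "(J \<longlongrightarrow> J x) (at x within S)" using assms(1) by (simp add: continuous_on_def)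
  then have "((\<lambda>t. L * \<bar>J t - J x\<bar>) \<longlongrightarrow> L * \<bar>J x - J x\<bar>) (at x within S)" by (intro tendsto_intros)
  then have "((\<lambda>t. L * \<bar>J t - J x\<bar>) \<longlongrightarrow> 0) (at x within S)" by simp
  then have "((\<lambda>t. f t - f x) \<longlongrightarrow> 0) (at x within S)"
  proof (rule Lim_null_comparison[rotated])
    show "\<forall>\<^sub>F t in at x within S. norm (f t - f x) \<le> L * \<bar>J t - J x\<bar>"
      unfolding eventually_at_filter using bd[OF _ x] by (intro always_eventually) simp
  qed
  then show "(f \<longlongrightarrow> f x) (at x within S)" by (rule LIM_zero_cancel)
qed

text \<open>The value 0 for \<open>t \<le> 0\<close> leaves out the initial measure, whose energy
  may be infinite, and the negative times, where the flow is unspecified. The function is then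
  measurable on the whole line.\<close>

definition energy_along :: "(real \<Rightarrow> real measure) \<Rightarrow> real \<Rightarrow> ennreal" where
  "energy_along w t = (if 0 < t then F0_enn (w t) else 0)"

context
  fixes \<nu> :: real and \<mu>\<^sub>0 :: "real measure" and w :: "real \<Rightarrow> real measure"
  assumes flow: "gradient_flow (F_energy \<nu>) \<mu>\<^sub>0 w" and \<nu>: "0 \<le> \<nu>"
begin

lemma flow_P: "0 \<le> t \<Longrightarrow> w t \<in> P_S1"
  using flow by (simp add: gradient_flow_def)

lemma flow_0: "w 0 = \<mu>\<^sub>0"
  using flow by (simp add: gradient_flow_def)

lemma flow_ac:
  assumes "0 < a" "a \<le> b"
  obtains m where "m integrable_on {a..b}"
    "\<And>s t. a \<le> s \<Longrightarrow> s \<le> t \<Longrightarrow> t \<le> b \<Longrightarrow> W_per (w s) (w t) \<le> integral {s..t} m"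
proof -
  have "loc_abs_cont w" using flow by (simp add: gradient_flow_def)
  then obtain m :: "real \<Rightarrow> real" where m: "set_integrable lborel {a..b} m"
    "\<And>s t. a \<le> s \<and> s \<le> t \<and> t \<le> b \<Longrightarrow> W_per (w s) (w t) \<le> set_lebesgue_integral lborel {s..t} m"
    using assms unfolding loc_abs_cont_def by meson
  show ?thesis
  proof (rule that)
    show "m integrable_on {a..b}" using set_borel_integral_eq_integral(1)[OF m(1)] .
    fix s t assume st: "a \<le> s" "s \<le> t" "t \<le> b"
    have "set_integrable lborel {s..t} m"
      by (rule set_integrable_subset[OF m(1)]) (use st in auto)
    then show "W_per (w s) (w t) \<le> integral {s..t} m"
      using m(2)[of s t] st set_borel_integral_eq_integral(2)[of "{s..t}" m] by simp
  qed
qed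

lemma flow_F0_trunc_continuous: "continuous_on {0<..} (\<lambda>t. F0_trunc n (w t))"
proof -
  have "isCont (\<lambda>t. F0_trunc n (w t)) t0" if t0: "t0 > 0" for t0
  proof -
    define a b where "a = t0 / 2" and "b = t0 + 1"
    have ab: "0 < a" "a \<le> b" "t0 \<in> {a<..<b}" using t0 by (auto simp: a_def b_def)
    obtain m where m: "m integrable_on {a..b}"
      "\<And>s t. a \<le> s \<Longrightarrow> s \<le> t \<Longrightarrow> t \<le> b \<Longrightarrow> W_per (w s) (w t) \<le> integral {s..t} m"
      using flow_ac[OF ab(1,2)] by blast
    define J where "J t = integral {a..t} m" for t
    have JC: "continuous_on {a..b} J" unfolding J_def by (rule indefinite_integral_continuous_1[OF m(1)])
    have le: "\<bar>F0_trunc n (w s) - F0_trunc n (w t)\<bar> \<le> 2 * (real n + 1) * \<bar>J s - J t\<bar>" if st: "a \<le> s" "s \<le> t" "t \<le> b" for s t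
    proof -
      have "m integrable_on {a..t}" by (rule integrable_on_subinterval[OF m(1)]) (use st in auto)
      then have "J s + integral {s..t} m = J t"
        unfolding J_def using st by (intro Henstock_Kurzweil_Integration.integral_combine) auto
      then have "W_per (w s) (w t) \<le> \<bar>J s - J t\<bar>" using m(2)[OF st] by linarith
      then have "2 * (real n + 1) * W_per (w s) (w t) \<le> 2 * (real n + 1) * \<bar>J s - J t\<bar>"
        by (intro mult_left_mono) auto
      moreover have "w s \<in> P_S1" "w t \<in> P_S1" using st ab by (auto intro!: flow_P)
      ultimately show ?thesis using F0_trunc_lipschitz[of "w s" "w t" n] by linarith
    qed
    have "continuous_on {a..b} (\<lambda>t. F0_trunc n (w t))"
    proof (rule continuous_on_dominated[OF JC])
      fix s t assume "s \<in> {a..b}" "t \<in> {a..b}"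
      then show "\<bar>F0_trunc n (w s) - F0_trunc n (w t)\<bar> \<le> 2 * (real n + 1) * \<bar>J s - J t\<bar>"
        using le[of s t] le[of t s] by (cases "s \<le> t") (auto simp: abs_minus_commute)
    qed
    then show ?thesis by (rule continuous_on_interior) (use ab in auto)
  qed
  then show ?thesis by (simp add: continuous_on_eq_continuous_at)
qed

lemma energy_along_SUP: "energy_along w t = (SUP n. ennreal (indicator {0<..} t * F0_trunc n (w t)))"
  by (simp add: energy_along_def SUP_F0_trunc flow_P)

lemma energy_along_measurable: "energy_along w \<in> borel_measurable borel"
proof -
  have "(\<lambda>t. indicator {0<..} t *\<^sub>R F0_trunc n (w t)) \<in> borel_measurable borel" for n
    by (rule borel_measurable_continuous_on_indicator[OF _ flow_F0_trunc_continuous]) simp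
  then show ?thesis unfolding energy_along_SUP[abs_def] by (intro borel_measurable_SUP) auto
qed

text \<open>For each truncation, the function \<open>f\<close> below has a derivative at almost
  every time, and it is nonpositive: the truncated energy is at most
  \<open>F_energy \<nu> (w t) + 2 * pi * \<nu>\<close>, and the extra term is part of the bound
  \<open>C\<close>. The increments of \<open>f\<close> being dominated by an integral,
  \<open>f\<close> decreases; monotone convergence then removes the truncation.\<close>

lemma evi_integrated_pos:
  assumes ab: "0 < a" "a \<le> b" and \<rho>: "\<rho> \<in> P_S1" and C: "F_energy \<nu> \<rho> + ereal (2 * pi * \<nu>) \<le> ereal C"
  shows "ennreal ((W_per (w b) \<rho>)\<^sup>2 / 2) + (\<integral>\<^sup>+t. energy_along w t * indicator {a..b} t \<partial>lborel)
    \<le> ennreal ((W_per (w a) \<rho>)\<^sup>2 / 2 + (b - a) * C)"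
proof -
  have P: "w t \<in> P_S1" if "a \<le> t" for t using that ab by (intro flow_P) auto
  have dom: "\<rho> \<in> dom_S1 (F_energy \<nu>)" using \<rho> C by (cases "F_energy \<nu> \<rho>") (auto simp: dom_S1_def)
  obtain m where m: "m integrable_on {a..b}"
    "\<And>s t. a \<le> s \<Longrightarrow> s \<le> t \<Longrightarrow> t \<le> b \<Longrightarrow> W_per (w s) (w t) \<le> integral {s..t} m"
    using flow_ac[OF ab] by blast
  have "AE t in lborel. 0 < t \<longrightarrow> (\<exists>D. ((\<lambda>s. (W_per (w s) \<rho>)\<^sup>2) has_real_derivative D) (at t) \<and>
            ereal (D / 2) + F_energy \<nu> (w t) \<le> F_energy \<nu> \<rho>)"
    using flow dom by (simp add: gradient_flow_def)
  then obtain N where N: "N \<in> null_sets lborel" and der: "\<And>t. t \<notin> N \<Longrightarrow> 0 < t \<Longrightarrow>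
      \<exists>D. ((\<lambda>s. (W_per (w s) \<rho>)\<^sup>2) has_real_derivative D) (at t) \<and>
            ereal (D / 2) + F_energy \<nu> (w t) \<le> F_energy \<nu> \<rho>"
    by (elim AE_E3) auto
  have negN: "negligible N"
    using N by (simp add: negligible_iff_null_sets null_sets_completionI)
  have cont: "continuous_on {a..b} (\<lambda>t. F0_trunc n (w t))" for n
    by (rule continuous_on_subset[OF flow_F0_trunc_continuous]) (use ab in auto)
  have n_bound: "(W_per (w b) \<rho>)\<^sup>2 / 2 + integral {a..b} (\<lambda>t. F0_trunc n (w t)) \<le> (W_per (w a) \<rho>)\<^sup>2 / 2 + (b - a) * C" for n
  proof -
    let ?g = "\<lambda>t. F0_trunc n (w t)"
    define f where "f t = (W_per (w t) \<rho>)\<^sup>2 / 2 + integral {a..t} ?g - C * (t - a)" for t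
    have gI: "?g integrable_on {s..t}" if "a \<le> s" "t \<le> b" for s t
      by (rule integrable_continuous_interval, rule continuous_on_subset[OF cont]) (use that in auto)
    have mI: "m integrable_on {s..t}" if "a \<le> s" "t \<le> b" for s t
      by (rule integrable_on_subinterval[OF m(1)]) (use that in auto)
    have "f b \<le> f a"
    proof (rule nonincreasing_if_ac_deriv_nonpos[OF ab(2) _ _ negN])
      \<comment> \<open>Distances are at most \<open>pi\<close>, so squared distances vary by at
        most \<open>2 * pi\<close> times the distance moved; halving gives
        \<open>pi * m\<close>.\<close>
      show "(\<lambda>t. pi * m t + (?g t + - C)) integrable_on {a..b}"
        using integrable_cmul[OF m(1), of pi] gI[of a b]
        by (intro integrable_add) (auto intro!: integrable_const_ivl)
      fix s t assume st: "a \<le> s" "s \<le> t" "t \<le> b"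
      have "(W_per (w t) \<rho>)\<^sup>2 - (W_per (w s) \<rho>)\<^sup>2 \<le> 2 * pi * W_per (w s) (w t)"
        using W_per_square_diff_le[OF P[of t] P[of s] \<rho>] W_per_commute[OF P[of s] P[of t]] st by auto
      also have "\<dots> \<le> 2 * pi * integral {s..t} m"
        using m(2)[OF st] by (intro mult_left_mono) auto
      finally have W: "(W_per (w t) \<rho>)\<^sup>2 / 2 - (W_per (w s) \<rho>)\<^sup>2 / 2 \<le> pi * integral {s..t} m" by simp
      have "integral {a..s} ?g + integral {s..t} ?g = integral {a..t} ?g"
        using st gI by (intro Henstock_Kurzweil_Integration.integral_combine) auto
      moreover have "((\<lambda>t. pi * m t + (?g t + - C)) has_integral pi * integral {s..t} m + (integral {s..t} ?g + (t - s) * - C)) {s..t}"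
        using st has_integral_const_real[of "- C" s t]
        by (intro has_integral_add has_integral_mult_right integrable_integral mI gI) auto
      note integral_unique[OF this]
      ultimately show "f t - f s \<le> integral {s..t} (\<lambda>t. pi * m t + (?g t + - C))"
        using W st unfolding f_def by (simp add: algebra_simps)
    next
      fix t assume t: "t \<in> {a..b} - N"
      then have t0: "0 < t" using ab by auto
      from der[of t] t t0 obtain D where D: "((\<lambda>s. (W_per (w s) \<rho>)\<^sup>2) has_real_derivative D) (at t)"
        "ereal (D / 2) + F_energy \<nu> (w t) \<le> F_energy \<nu> \<rho>" by auto
      have "ennreal (?g t) \<le> F0_enn (w t)" using SUP_F0_trunc[OF P[of t]] t by (auto intro: SUP_upper)
      then have "enn2ereal (ennreal (?g t)) \<le> F0 (w t)" by (simp only: less_eq_ennreal.rep_eq F0_eq_F0_enn)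
      then have "ereal (?g t) \<le> F0 (w t)" using F0_trunc_nonneg by simp
      also have "\<dots> \<le> F_energy \<nu> (w t) + ereal (2 * pi * \<nu>)" by (rule F0_le_F_energy[OF \<nu>])
      finally have "D / 2 + ?g t \<le> C"
        using D(2) C by (cases "F_energy \<nu> (w t)"; cases "F_energy \<nu> \<rho>") auto
      moreover have "(f has_real_derivative D / 2 + ?g t - C * (1 - 0)) (at t within {a..b})"
        unfolding f_def
        by (intro DERIV_diff DERIV_add DERIV_cdivide DERIV_cmult has_field_derivative_at_within[OF D(1)]
            integral_has_real_derivative[OF cont] DERIV_ident DERIV_const) (use t in auto)
      ultimately show "\<exists>D\<le>0. (f has_real_derivative D) (at t within {a..b})"
        by (intro exI[of _ "D / 2 + ?g t - C * (1 - 0)"]) auto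
    qed
    then show ?thesis by (simp add: f_def algebra_simps)
  qed
  have int: "(\<integral>\<^sup>+t. energy_along w t * indicator {a..b} t \<partial>lborel) = (SUP n. ennreal (integral {a..b} (\<lambda>t. F0_trunc n (w t))))"
  proof -
    have "(\<integral>\<^sup>+t. energy_along w t * indicator {a..b} t \<partial>lborel)
      = (\<integral>\<^sup>+t. (SUP n. ennreal (F0_trunc n (w t)) * indicator {a..b} t) \<partial>lborel)"
      using ab by (intro nn_integral_cong) (auto simp: energy_along_def SUP_F0_trunc flow_P indicator_def)
    also have "\<dots> = (SUP n. \<integral>\<^sup>+t. ennreal (F0_trunc n (w t)) * indicator {a..b} t \<partial>lborel)"
    proof (rule nn_integral_monotone_convergence_SUP)
      show "incseq (\<lambda>n t. ennreal (F0_trunc n (w t)) * indicator {a..b} t)"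
        by (auto simp: incseq_def le_fun_def indicator_def intro!: ennreal_leI F0_trunc_mono P)
      fix n
      have "(\<lambda>t. indicator {a..b} t *\<^sub>R F0_trunc n (w t)) \<in> borel_measurable borel"
        by (rule borel_measurable_continuous_on_indicator[OF _ cont]) simp
      then have "(\<lambda>t. ennreal (indicator {a..b} t *\<^sub>R F0_trunc n (w t))) \<in> borel_measurable lborel" by simp
      also have "(\<lambda>t. ennreal (indicator {a..b} t *\<^sub>R F0_trunc n (w t))) = (\<lambda>t. ennreal (F0_trunc n (w t)) * indicator {a..b} t)"
        by (auto simp: indicator_def)
      finally show "(\<lambda>t. ennreal (F0_trunc n (w t)) * indicator {a..b} t) \<in> borel_measurable lborel" .
    qed
    also have "\<dots> = (SUP n. ennreal (integral {a..b} (\<lambda>t. F0_trunc n (w t))))"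
      by (intro SUP_cong refl nn_integral_has_integral_lebesgue' F0_trunc_nonneg integrable_integral integrable_continuous_interval cont)
    finally show ?thesis .
  qed
  have "ennreal ((W_per (w b) \<rho>)\<^sup>2 / 2) + (SUP n. ennreal (integral {a..b} (\<lambda>t. F0_trunc n (w t))))
      = (SUP n. ennreal ((W_per (w b) \<rho>)\<^sup>2 / 2) + ennreal (integral {a..b} (\<lambda>t. F0_trunc n (w t))))"
    by (rule ennreal_SUP_add_right) simp
  also have "\<dots> \<le> ennreal ((W_per (w a) \<rho>)\<^sup>2 / 2 + (b - a) * C)"
  proof (rule SUP_least)
    fix n
    have "0 \<le> integral {a..b} (\<lambda>t. F0_trunc n (w t))"
      by (intro Henstock_Kurzweil_Integration.integral_nonneg integrable_continuous_interval cont F0_trunc_nonneg)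
    then have "ennreal ((W_per (w b) \<rho>)\<^sup>2 / 2) + ennreal (integral {a..b} (\<lambda>t. F0_trunc n (w t)))
       = ennreal ((W_per (w b) \<rho>)\<^sup>2 / 2 + integral {a..b} (\<lambda>t. F0_trunc n (w t)))"
      by (simp add: ennreal_plus)
    also have "\<dots> \<le> ennreal ((W_per (w a) \<rho>)\<^sup>2 / 2 + (b - a) * C)" by (intro ennreal_leI n_bound)
    finally show "ennreal ((W_per (w b) \<rho>)\<^sup>2 / 2) + ennreal (integral {a..b} (\<lambda>t. F0_trunc n (w t)))
       \<le> ennreal ((W_per (w a) \<rho>)\<^sup>2 / 2 + (b - a) * C)" .
  qed
  finally show ?thesis unfolding int .
qed

text \<open>For \<open>a = 0\<close> the interval starts at times \<open>s k\<close> decreasing to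
  0: the distance at the left end converges by continuity of the flow at 0, the energy integral by
  monotone convergence.\<close>

lemma evi_integrated:
  assumes ab: "0 \<le> a" "a \<le> b" and \<rho>: "\<rho> \<in> P_S1" and C: "F_energy \<nu> \<rho> + ereal (2 * pi * \<nu>) \<le> ereal C"
  shows "ennreal ((W_per (w b) \<rho>)\<^sup>2 / 2) + (\<integral>\<^sup>+t. energy_along w t * indicator {a..b} t \<partial>lborel)
    \<le> ennreal ((W_per (w a) \<rho>)\<^sup>2 / 2 + (b - a) * C)"
proof -
  consider "0 < a" | "a = 0" "b = 0" | "a = 0" "0 < b" using ab by linarith
  then show ?thesis
  proof cases
    case 1 then show ?thesis using evi_integrated_pos assms by blast
  next
    case 2
    then have "energy_along w t * indicator {a..b} t = 0" for t by (auto simp: energy_along_def indicator_def)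
    with 2 show ?thesis by simp
  next
    case 3
    define s where "s k = b / (real k + 1)" for k :: nat
    have s: "0 < s k" "s k \<le> b" for k using 3 by (auto simp: s_def field_simps)
    have s_lim: "s \<longlonglongrightarrow> 0" unfolding s_def by real_asymp
    have s_right: "filterlim s (at_right 0) sequentially"
      using s_lim s(1) unfolding filterlim_at by (auto simp: less_imp_neq[symmetric])
    have "((\<lambda>t. W_per (w t) \<mu>\<^sub>0) \<longlongrightarrow> 0) (at_right 0)" using flow by (simp add: gradient_flow_def)
    then have lim0: "(\<lambda>k. W_per (w (s k)) (w 0)) \<longlonglongrightarrow> 0"
      unfolding flow_0 using s_right by (rule filterlim_compose)
    have "(\<lambda>k. (W_per (w (s k)) \<rho>)\<^sup>2 - (W_per (w 0) \<rho>)\<^sup>2) \<longlonglongrightarrow> 0"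
    proof (rule Lim_null_comparison)
      show "\<forall>\<^sub>F k in sequentially. norm ((W_per (w (s k)) \<rho>)\<^sup>2 - (W_per (w 0) \<rho>)\<^sup>2) \<le> 2 * pi * W_per (w (s k)) (w 0)"
        unfolding real_norm_def
        by (intro always_eventually allI W_per_square_diff_le flow_P \<rho>) (use s(1) in \<open>auto simp: less_imp_le\<close>)
      show "(\<lambda>k. 2 * pi * W_per (w (s k)) (w 0)) \<longlonglongrightarrow> 0"
        using tendsto_mult_left[OF lim0, of "2 * pi"] by simp
    qed
    then have "(\<lambda>k. (W_per (w (s k)) \<rho>)\<^sup>2) \<longlonglongrightarrow> (W_per (w 0) \<rho>)\<^sup>2" by (rule LIM_zero_cancel)
    then have R: "(\<lambda>k. ennreal ((W_per (w (s k)) \<rho>)\<^sup>2 / 2 + (b - s k) * C)) \<longlonglongrightarrow>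
        ennreal ((W_per (w 0) \<rho>)\<^sup>2 / 2 + (b - 0) * C)"
      by (intro tendsto_ennrealI tendsto_add tendsto_divide tendsto_mult tendsto_diff tendsto_const s_lim) auto
    have inc: "incseq (\<lambda>k t. energy_along w t * indicator {s k..b} t)"
    proof (rule incseq_SucI, rule le_funI)
      fix k t
      have "s (Suc k) \<le> s k" using 3 by (auto simp: s_def intro!: divide_left_mono)
      then show "energy_along w t * indicator {s k..b} t \<le> energy_along w t * indicator {s (Suc k)..b} t"
        by (auto simp: indicator_def)
    qed
    \<comment> \<open>No interval \<open>{s k..b}\<close> contains 0; the equality holds at
      \<open>t = 0\<close> because \<open>energy_along\<close> vanishes there.\<close>
    have sup: "(SUP k. energy_along w t * indicator {s k..b} t) = energy_along w t * indicator {a..b} t" for t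
    proof (cases "0 < t \<and> t \<le> b")
      case True
      have "eventually (\<lambda>k. s k < t) sequentially" using s_lim True order_tendstoD(2) by blast
      then obtain k where "s k < t" by (auto simp: eventually_sequentially)
      then have "energy_along w t * indicator {s k..b} t = energy_along w t * indicator {a..b} t"
        using True 3 by (auto simp: indicator_def)
      moreover have "energy_along w t * indicator {s j..b} t \<le> energy_along w t * indicator {a..b} t" for j
        using s(1)[of j] 3 by (auto simp: indicator_def)
      ultimately show ?thesis by (intro antisym SUP_least SUP_upper2[of k]) simp_all
    next
      case False
      then show ?thesis using 3 by (auto simp: energy_along_def indicator_def)
    qed
    have "(SUP k. \<integral>\<^sup>+t. energy_along w t * indicator {s k..b} t \<partial>lborel) = (\<integral>\<^sup>+t. energy_along w t * indicator {a..b} t \<partial>lborel)"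
      unfolding sup[symmetric]
      by (rule nn_integral_monotone_convergence_SUP[symmetric, OF inc]) (use energy_along_measurable in auto)
    then have L: "(\<lambda>k. \<integral>\<^sup>+t. energy_along w t * indicator {s k..b} t \<partial>lborel) \<longlonglongrightarrow> (\<integral>\<^sup>+t. energy_along w t * indicator {a..b} t \<partial>lborel)"
      using LIMSEQ_SUP[of "\<lambda>k. \<integral>\<^sup>+t. energy_along w t * indicator {s k..b} t \<partial>lborel"] inc
      by (auto simp: incseq_def le_fun_def intro!: nn_integral_mono)
    have "ennreal ((W_per (w b) \<rho>)\<^sup>2 / 2) + (\<integral>\<^sup>+t. energy_along w t * indicator {a..b} t \<partial>lborel)
       \<le> ennreal ((W_per (w 0) \<rho>)\<^sup>2 / 2 + (b - 0) * C)"
    proof (rule LIMSEQ_le[OF tendsto_add[OF tendsto_const L] R])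
      show "\<exists>N. \<forall>k\<ge>N. ennreal ((W_per (w b) \<rho>)\<^sup>2 / 2) + (\<integral>\<^sup>+t. energy_along w t * indicator {s k..b} t \<partial>lborel)
          \<le> ennreal ((W_per (w (s k)) \<rho>)\<^sup>2 / 2 + (b - s k) * C)"
        using evi_integrated_pos[OF s \<rho> C] by blast
    qed
    then show ?thesis using 3 by simp
  qed
qed

end

section \<open>Comparison of two flows\<close>

definition energy_int :: "(real \<Rightarrow> real measure) \<Rightarrow> real \<Rightarrow> real \<Rightarrow> ennreal" where
  "energy_int w a b = (\<integral>\<^sup>+t. energy_along w t * indicator {a..b} t \<partial>lborel)"

lemma ennreal_add_le_ennrealD:
  assumes "ennreal x + I \<le> ennreal y" "0 \<le> x" "0 \<le> y"
  obtains i where "0 \<le> i" "I = ennreal i" "x + i \<le> y"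
proof (cases I)
  case (real i)
  then have "ennreal (x + i) \<le> ennreal y" using assms by simp
  then show ?thesis using that real assms by (simp del: ennreal_plus)
next
  case top
  then show ?thesis using assms by (simp add: top_unique)
qed

lemma W_per_triangle_mollify:
  assumes P: "\<mu> \<in> P_S1" "\<rho> \<in> P_S1" and r: "0 < r" "r < 1"
  shows "(W_per \<mu> (mollify r \<rho>))\<^sup>2 / 2 \<le> (W_per \<mu> \<rho>)\<^sup>2 / 2 + pi * sqrt (18 * (1 - r))"
    and "(W_per \<mu> \<rho>)\<^sup>2 / 2 \<le> (W_per \<mu> (mollify r \<rho>))\<^sup>2 / 2 + pi * sqrt (18 * (1 - r))"
proof -
  note Pm = mollify_in_P_S1[OF P(2) r]
  have "\<bar>(W_per \<rho> \<mu>)\<^sup>2 - (W_per (mollify r \<rho>) \<mu>)\<^sup>2\<bar> \<le> 2 * pi * W_per \<rho> (mollify r \<rho>)"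
    by (rule W_per_square_diff_le[OF P(2) Pm P(1)])
  also have "\<dots> \<le> 2 * pi * sqrt (18 * (1 - r))"
    by (intro mult_left_mono W_per_mollify[OF P(2) r]) auto
  finally have "\<bar>(W_per \<rho> \<mu>)\<^sup>2 - (W_per (mollify r \<rho>) \<mu>)\<^sup>2\<bar> \<le> 2 * pi * sqrt (18 * (1 - r))" .
  then show "(W_per \<mu> (mollify r \<rho>))\<^sup>2 / 2 \<le> (W_per \<mu> \<rho>)\<^sup>2 / 2 + pi * sqrt (18 * (1 - r))"
    "(W_per \<mu> \<rho>)\<^sup>2 / 2 \<le> (W_per \<mu> (mollify r \<rho>))\<^sup>2 / 2 + pi * sqrt (18 * (1 - r))"
    unfolding W_per_commute[OF P(2,1)] W_per_commute[OF Pm P(1)] abs_le_iff by linarith+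
qed

lemma mollify_energy_const_nonneg:
  fixes r :: real
  assumes "0 < r" "r < 1"
  shows "0 \<le> (ln 4 - ln ((1 - r)\<^sup>2)) / (2 * pi)"
proof -
  have "(1 - r)\<^sup>2 \<le> 1" using assms by (intro power_le_one) auto
  then have "ln ((1 - r)\<^sup>2) \<le> ln 4" using assms by (subst ln_le_cancel_iff) auto
  then show ?thesis by simp
qed

text \<open>The mollified starting point of an interval of time is an admissible reference measure in the
  evolution variational inequality, with energy bounded independently of that starting point.\<close>

lemma flow_modulus:
  assumes "\<epsilon> > 0"
  obtains \<delta> where "\<delta> > 0"
    "\<And>\<nu> \<mu>\<^sub>0 w s t. gradient_flow (F_energy \<nu>) \<mu>\<^sub>0 w \<Longrightarrow> 0 \<le> \<nu> \<Longrightarrow> \<nu> \<le> 1 \<Longrightarrow>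
      0 \<le> s \<Longrightarrow> s \<le> t \<Longrightarrow> t \<le> s + \<delta> \<Longrightarrow> W_per (w s) (w t) \<le> \<epsilon> \<and> energy_int w s t \<le> ennreal \<epsilon>"
proof -
  \<comment> \<open>The distance will be at most
    \<open>sqrt \<eta> + sqrt (2 * \<eta>) \<le> sqrt (8 * \<eta>)\<close> and the energy integral
    at most \<open>\<eta>\<close>; the two terms of the minimum serve these two bounds.\<close>
  define \<eta> where "\<eta> = min \<epsilon> (\<epsilon>\<^sup>2 / 8)"
  have \<eta>: "0 < \<eta>" "\<eta> \<le> \<epsilon>" "8 * \<eta> \<le> \<epsilon>\<^sup>2" using assms by (auto simp: \<eta>_def)
  define r where "r = 1 - min (1 / 2) (\<eta> / 18)"
  have r: "0 < r" "r < 1" "18 * (1 - r) \<le> \<eta>" using \<eta> by (auto simp: r_def)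
  \<comment> \<open>The worst case over \<open>\<nu> \<le> 1\<close> of the mollified energy,
    including the \<open>2 * pi * \<nu>\<close> for the entropy.\<close>
  define B where "B = 2 * pi / (1 - r) ^ 4 + (ln 4 - ln ((1 - r)\<^sup>2)) / (2 * pi) + 2 * pi"
  have K: "0 \<le> (ln 4 - ln ((1 - r)\<^sup>2)) / (2 * pi)" by (rule mollify_energy_const_nonneg[OF r(1,2)])
  have B: "B > 0" unfolding B_def using K r by (intro add_nonneg_pos add_nonneg_nonneg) auto
  define \<delta> where "\<delta> = \<eta> / (2 * B)"
  have \<delta>: "\<delta> > 0" "\<delta> * B = \<eta> / 2" using \<eta> B by (auto simp: \<delta>_def)
  show ?thesis
  proof (rule that[OF \<delta>(1)])
    fix \<nu> \<mu>\<^sub>0 w s t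
    assume flow: "gradient_flow (F_energy \<nu>) \<mu>\<^sub>0 w" and \<nu>: "0 \<le> \<nu>" "\<nu> \<le> 1" and st: "0 \<le> s" "s \<le> t" "t \<le> s + \<delta>"
    have P: "w s \<in> P_S1" "w t \<in> P_S1" using flow_P[OF flow \<nu>(1)] st by auto
    let ?m = "mollify r (w s)"
    have Pm: "?m \<in> P_S1" by (rule mollify_in_P_S1[OF P(1) r(1,2)])
    have "F_energy \<nu> ?m \<le> ereal (\<nu> * (2 * pi / (1 - r) ^ 4) + (ln 4 - ln ((1 - r)\<^sup>2)) / (2 * pi))"
      by (rule F_energy_mollify_le[OF P(1) r(1,2) \<nu>(1) F0_enn_mollify_le_const[OF P(1) r(1,2)] K])
    then have "F_energy \<nu> ?m + ereal (2 * pi * \<nu>) \<le> ereal (\<nu> * (2 * pi / (1 - r) ^ 4) + (ln 4 - ln ((1 - r)\<^sup>2)) / (2 * pi)) + ereal (2 * pi * \<nu>)"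
      by (rule add_right_mono)
    also have "\<dots> \<le> ereal B"
    proof -
      have "\<nu> * (2 * pi / (1 - r) ^ 4) \<le> 1 * (2 * pi / (1 - r) ^ 4)" "2 * pi * \<nu> \<le> 2 * pi * 1"
        using \<nu> r by (intro mult_right_mono mult_left_mono; simp)+
      then show ?thesis unfolding B_def plus_ereal.simps ereal_less_eq by linarith
    qed
    finally have C: "F_energy \<nu> ?m + ereal (2 * pi * \<nu>) \<le> ereal B" .
    have mollify_s: "W_per (w s) ?m \<le> sqrt (18 * (1 - r))" by (rule W_per_mollify[OF P(1) r(1,2)])
    also have "\<dots> \<le> sqrt \<eta>" using r by simp
    finally have mollify_s: "W_per (w s) ?m \<le> sqrt \<eta>" .
    have "(W_per (w s) ?m)\<^sup>2 \<le> (sqrt \<eta>)\<^sup>2" using mollify_s W_per_nonneg[OF P(1) Pm] by (intro power_mono) auto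
    then have "(W_per (w s) ?m)\<^sup>2 \<le> \<eta>" using \<eta> by simp
    moreover have "(t - s) * B \<le> \<delta> * B" using st B by (intro mult_right_mono) auto
    ultimately have "(W_per (w s) ?m)\<^sup>2 / 2 + (t - s) * B \<le> \<eta>" using \<delta>(2) by simp
    from order_trans[OF evi_integrated[OF flow \<nu>(1) st(1,2) Pm C] ennreal_leI[OF this]]
    have ineq: "ennreal ((W_per (w t) ?m)\<^sup>2 / 2) + energy_int w s t \<le> ennreal \<eta>"
      by (simp add: energy_int_def)
    then obtain i where i: "0 \<le> i" "energy_int w s t = ennreal i" "(W_per (w t) ?m)\<^sup>2 / 2 + i \<le> \<eta>"
      using \<eta> by (elim ennreal_add_le_ennrealD) auto
    have "(W_per (w t) ?m)\<^sup>2 \<le> 2 * \<eta>" using i by simp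
    then have "W_per (w t) ?m \<le> sqrt (2 * \<eta>)" by (rule real_le_rsqrt)
    moreover have "W_per (w s) (w t) \<le> W_per (w s) ?m + W_per (w t) ?m"
      using W_per_triangle[OF P(1) Pm P(2)] W_per_commute[OF P(2) Pm] by simp
    moreover have "sqrt \<eta> \<le> sqrt (2 * \<eta>)" using \<eta> by simp
    ultimately have "W_per (w s) (w t) \<le> 2 * sqrt (2 * \<eta>)" using mollify_s by linarith
    also have "\<dots> = sqrt (8 * \<eta>)"
      using real_sqrt_mult[of 4 "2 * \<eta>"] by simp
    also have "\<dots> \<le> \<epsilon>" using \<eta> assms by (intro real_le_lsqrt) auto
    finally have "W_per (w s) (w t) \<le> \<epsilon>" .
    moreover have "i \<le> \<epsilon>" using i(3) \<eta>(2) zero_le_power2[of "W_per (w t) ?m"] by linarith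
    ultimately show "W_per (w s) (w t) \<le> \<epsilon> \<and> energy_int w s t \<le> ennreal \<epsilon>"
      using i(2) by (simp add: ennreal_leI)
  qed
qed

text \<open>Finiteness allows energy integrals to be cancelled in \<open>ennreal\<close>. Any
  mollification of the starting point serves as reference; the radius \<open>1 / 2\<close> is
  arbitrary.\<close>

lemma energy_int_finite:
  assumes flow: "gradient_flow (F_energy \<nu>) \<mu>\<^sub>0 w" and \<nu>: "0 \<le> \<nu>" "\<nu> \<le> 1" and "0 \<le> a" "a \<le> b"
  shows "energy_int w a b < \<infinity>"
proof -
  define r :: real where "r = 1 / 2"
  have r: "0 < r" "r < 1" by (auto simp: r_def)
  have P: "w a \<in> P_S1" using flow_P[OF flow \<nu>(1)] assms by auto
  have "F_energy \<nu> (mollify r (w a)) \<le> ereal (\<nu> * (2 * pi / (1 - r) ^ 4) + (ln 4 - ln ((1 - r)\<^sup>2)) / (2 * pi))"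
    by (rule F_energy_mollify_le[OF P r \<nu>(1) F0_enn_mollify_le_const[OF P r] mollify_energy_const_nonneg[OF r]])
  then have "F_energy \<nu> (mollify r (w a)) + ereal (2 * pi * \<nu>) \<le>
      ereal (\<nu> * (2 * pi / (1 - r) ^ 4) + (ln 4 - ln ((1 - r)\<^sup>2)) / (2 * pi)) + ereal (2 * pi * \<nu>)"
    by (rule add_right_mono)
  from evi_integrated[OF flow \<nu>(1) assms(4,5) mollify_in_P_S1[OF P r] this[unfolded plus_ereal.simps]]
  have "energy_int w a b \<le> ennreal ((W_per (w a) (mollify r (w a)))\<^sup>2 / 2 + (b - a) *
      (\<nu> * (2 * pi / (1 - r) ^ 4) + (ln 4 - ln ((1 - r)\<^sup>2)) / (2 * pi) + 2 * pi * \<nu>))"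
    unfolding energy_int_def[symmetric] by (rule order_trans[OF add_increasing[OF zero_le order_refl]])
  then show ?thesis by (rule le_less_trans) (simp add: infinity_ennreal_def)
qed

section \<open>Growth of the distance of the two flows over one time step\<close>

locale two_flows =
  fixes \<nu> :: real and \<mu>\<^sub>0 :: "real measure" and u v :: "real \<Rightarrow> real measure"
  assumes \<nu>: "0 \<le> \<nu>" "\<nu> \<le> 1"
    and flow_u: "gradient_flow (F_energy \<nu>) \<mu>\<^sub>0 u"
    and flow_v: "gradient_flow (F_energy 0) \<mu>\<^sub>0 v"
begin

lemma P_u: "0 \<le> t \<Longrightarrow> u t \<in> P_S1"
  using flow_P[OF flow_u \<nu>(1)] .

lemma P_v: "0 \<le> t \<Longrightarrow> v t \<in> P_S1"
  using flow_P[OF flow_v] by simp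

definition gap :: "real \<Rightarrow> real" where
  "gap t = (W_per (u t) (v t))\<^sup>2 / 2"

text \<open>In the inequality of \<open>u\<close> the measure \<open>v s\<close> is exchanged for
  its mollification at both ends of the step, each time at the price
  \<open>pi * sqrt (18 * (1 - r))\<close>. The rate multiplying \<open>\<delta>\<close> collects the
  entropy of the mollified measure, the rise of its interaction energy and the lower bound of the
  entropy.\<close>

definition err :: "real \<Rightarrow> real \<Rightarrow> real" where
  "err r \<delta> = 2 * pi * sqrt (18 * (1 - r)) + \<delta> * (\<nu> * (2 * pi / (1 - r) ^ 4) - ln r / pi + 2 * pi * \<nu>)"

lemma rate_nonneg:
  assumes "0 < r" "r < 1"
  shows "0 \<le> \<nu> * (2 * pi / (1 - r) ^ 4) - ln r / pi + 2 * pi * \<nu>"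
proof -
  have "ln r / pi \<le> 0" using assms by (intro divide_nonpos_pos) auto
  moreover have "0 \<le> \<nu> * (2 * pi / (1 - r) ^ 4)" "0 \<le> 2 * pi * \<nu>"
    using \<nu> assms by (intro mult_nonneg_nonneg divide_nonneg_nonneg; simp)+
  ultimately show ?thesis by linarith
qed

lemma err_nonneg:
  assumes "0 < r" "r < 1" "0 \<le> \<delta>"
  shows "0 \<le> err r \<delta>"
  unfolding err_def using assms
  by (intro add_nonneg_nonneg mult_nonneg_nonneg[OF assms(3) rate_nonneg]) auto

text \<open>The mollified \<open>v s\<close> is the reference measure for the inequality of \<open>u\<close>, and the new position
  \<open>u (s + \<delta>)\<close> is the reference measure for the inequality of \<open>v\<close>.\<close>

lemma gap_step:
  assumes s: "0 \<le> s" and \<delta>: "0 < \<delta>" and r: "0 < r" "r < 1"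
  shows "ennreal (gap (s + \<delta>)) + (energy_int v s (s + \<delta>) + energy_int u s (s + \<delta>))
    \<le> ennreal (gap s + err r \<delta>) + ennreal \<delta> * (F0_enn (v s) + F0_enn (u (s + \<delta>)))"
proof (cases "F0_enn (v s) = top \<or> F0_enn (u (s + \<delta>)) = top")
  case True
  then show ?thesis using \<delta> by (auto simp: ennreal_mult_eq_top_iff)
next
  case False
  then obtain a b where a: "0 \<le> a" "F0_enn (v s) = ennreal a" and b: "0 \<le> b" "F0_enn (u (s + \<delta>)) = ennreal b"
    by (cases "F0_enn (v s)"; cases "F0_enn (u (s + \<delta>))") auto
  let ?t = "s + \<delta>" and ?m = "mollify r (v s)" and ?k = "sqrt (18 * (1 - r))"
  let ?\<eta> = "\<nu> * (2 * pi / (1 - r) ^ 4) - ln r / pi + 2 * pi * \<nu>"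
  have P: "v s \<in> P_S1" "u s \<in> P_S1" "v ?t \<in> P_S1" "u ?t \<in> P_S1" using s \<delta> by (auto intro!: P_u P_v)
  have st: "0 \<le> s" "s \<le> ?t" using s \<delta> by auto
  have Pm: "?m \<in> P_S1" by (rule mollify_in_P_S1[OF P(1) r])
  have lnr: "0 \<le> - ln r / pi" using r by (intro divide_nonneg_pos) auto
  have "F0 (u ?t) = ereal b" using b by (simp add: F0_eq_F0_enn)
  then have "F_energy 0 (u ?t) + ereal (2 * pi * 0) \<le> ereal b" by (simp add: F_energy_def)
  from evi_integrated[OF flow_v order_refl st P(4) this]
  have "ennreal ((W_per (v ?t) (u ?t))\<^sup>2 / 2) + energy_int v s ?t \<le> ennreal ((W_per (v s) (u ?t))\<^sup>2 / 2 + \<delta> * b)"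
    by (simp add: energy_int_def)
  then obtain i where i: "0 \<le> i" "energy_int v s ?t = ennreal i"
    "(W_per (v ?t) (u ?t))\<^sup>2 / 2 + i \<le> (W_per (v s) (u ?t))\<^sup>2 / 2 + \<delta> * b"
    using \<delta> b by (elim ennreal_add_le_ennrealD) auto
  have "F0_enn ?m \<le> ennreal (a + - ln r / pi)"
    using F0_enn_mollify_le[OF P(1) r] unfolding ennreal_plus[OF a(1) lnr] a(2) .
  from F_energy_mollify_le[OF P(1) r \<nu>(1) this]
  have "F_energy \<nu> ?m \<le> ereal (\<nu> * (2 * pi / (1 - r) ^ 4) + (a + - ln r / pi))" using a lnr by simp
  then have "F_energy \<nu> ?m + ereal (2 * pi * \<nu>) \<le> ereal (\<nu> * (2 * pi / (1 - r) ^ 4) + (a + - ln r / pi)) + ereal (2 * pi * \<nu>)"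
    by (rule add_right_mono)
  also have "\<dots> = ereal (a + ?\<eta>)" by simp
  finally have "F_energy \<nu> ?m + ereal (2 * pi * \<nu>) \<le> ereal (a + ?\<eta>)" .
  from evi_integrated[OF flow_u \<nu>(1) st Pm this]
  have "ennreal ((W_per (u ?t) ?m)\<^sup>2 / 2) + energy_int u s ?t \<le> ennreal ((W_per (u s) ?m)\<^sup>2 / 2 + \<delta> * (a + ?\<eta>))"
    by (simp add: energy_int_def)
  moreover have \<eta>0: "0 \<le> ?\<eta>" by (rule rate_nonneg[OF r])
  ultimately obtain j where j: "0 \<le> j" "energy_int u s ?t = ennreal j"
    "(W_per (u ?t) ?m)\<^sup>2 / 2 + j \<le> (W_per (u s) ?m)\<^sup>2 / 2 + \<delta> * (a + ?\<eta>)"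
    using \<delta> a by (elim ennreal_add_le_ennrealD) auto
  \<comment> \<open>Adding the two inequalities, the distance between \<open>v s\<close> and
    \<open>u ?t\<close>, the corner of the path, drops out.\<close>
  have "gap ?t + (i + j) \<le> gap s + err r \<delta> + \<delta> * (a + b)"
    using i(3) j(3) W_per_triangle_mollify(1)[OF P(2,1) r] W_per_triangle_mollify(2)[OF P(4,1) r]
    unfolding gap_def err_def W_per_commute[OF P(3,4)] W_per_commute[OF P(1,4)]
    by (simp add: algebra_simps)
  then have "ennreal (gap ?t + (i + j)) \<le> ennreal (gap s + err r \<delta> + \<delta> * (a + b))" by (rule ennreal_leI)
  also have "ennreal (gap ?t + (i + j)) = ennreal (gap ?t) + (ennreal i + ennreal j)"
    using i j by (simp add: gap_def)
  also have "ennreal (gap s + err r \<delta> + \<delta> * (a + b)) = ennreal (gap s + err r \<delta>) + ennreal \<delta> * (ennreal a + ennreal b)"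
    using a b \<delta> err_nonneg[OF r, of \<delta>] by (simp add: ennreal_mult gap_def)
  finally show ?thesis using i j a b by simp
qed

end

section \<open>Iteration of the step and averaging over the time grid\<close>

lemma exists_le_mean:
  fixes f :: "real \<Rightarrow> ennreal"
  assumes \<delta>: "0 < \<delta>" and f: "(\<integral>\<^sup>+x. f x * indicator {0<..\<delta>} x \<partial>lborel) \<le> ennreal \<delta> * M" and M: "M < \<infinity>" and \<epsilon>: "0 < \<epsilon>"
  obtains \<sigma> where "0 < \<sigma>" "\<sigma> \<le> \<delta>" "f \<sigma> \<le> M + ennreal \<epsilon>"
proof (rule ccontr)
  assume "\<not> thesis"
  with that have lt: "M + ennreal \<epsilon> \<le> f \<sigma>" if "0 < \<sigma>" "\<sigma> \<le> \<delta>" for \<sigma>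
    using that by (meson linear)
  obtain m where m: "0 \<le> m" "M = ennreal m" using M by (cases M) auto
  have "ennreal ((m + \<epsilon>) * \<delta>) = (\<integral>\<^sup>+x. (M + ennreal \<epsilon>) * indicator {0<..\<delta>} x \<partial>lborel)"
    using m \<epsilon> \<delta> by (subst nn_integral_cmult_indicator) (auto simp: ennreal_mult)
  also have "\<dots> \<le> (\<integral>\<^sup>+x. f x * indicator {0<..\<delta>} x \<partial>lborel)"
    by (intro nn_integral_mono) (auto simp: indicator_def lt)
  also have "\<dots> \<le> ennreal (\<delta> * m)" using f m \<delta> by (simp add: ennreal_mult)
  finally have "(m + \<epsilon>) * \<delta> \<le> \<delta> * m" using m \<delta> by (subst (asm) ennreal_le_iff) auto
  then show False using mult_pos_pos[OF \<delta> \<epsilon>] by (simp add: algebra_simps)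
qed

lemma nn_integral_shift_indicator:
  fixes f :: "real \<Rightarrow> ennreal"
  assumes [measurable]: "f \<in> borel_measurable borel"
  shows "(\<integral>\<^sup>+x. f (x + c) * indicator {0<..\<delta>} x \<partial>lborel) = (\<integral>\<^sup>+x. f x * indicator {c<..c + \<delta>} x \<partial>lborel)"
proof -
  have "(\<integral>\<^sup>+x. f x * indicator {c<..c + \<delta>} x \<partial>lborel)
      = (\<integral>\<^sup>+x. f (c + 1 * x) * indicator {c<..c + \<delta>} (c + 1 * x) \<partial>lborel)"
    by (subst nn_integral_real_affine[where c = 1 and t = c]) auto
  also have "\<dots> = (\<integral>\<^sup>+x. f (x + c) * indicator {0<..\<delta>} x \<partial>lborel)"
    by (intro nn_integral_cong) (auto simp: indicator_def add.commute)
  finally show ?thesis ..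
qed

lemma sum_integral_cells_le:
  fixes f :: "real \<Rightarrow> ennreal"
  assumes [measurable]: "f \<in> borel_measurable borel" and "0 \<le> \<delta>"
  shows "(\<Sum>k<N. \<integral>\<^sup>+x. f x * indicator {c + real k * \<delta><..c + real k * \<delta> + \<delta>} x \<partial>lborel)
    \<le> (\<integral>\<^sup>+x. f x * indicator {c..c + real N * \<delta>} x \<partial>lborel)"
proof (induction N)
  case (Suc N)
  have "(\<Sum>k<Suc N. \<integral>\<^sup>+x. f x * indicator {c + real k * \<delta><..c + real k * \<delta> + \<delta>} x \<partial>lborel)
     \<le> (\<integral>\<^sup>+x. f x * indicator {c..c + real N * \<delta>} x \<partial>lborel)
       + (\<integral>\<^sup>+x. f x * indicator {c + real N * \<delta><..c + real N * \<delta> + \<delta>} x \<partial>lborel)"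
    using Suc.IH by (simp add: add_right_mono)
  also have "\<dots> = (\<integral>\<^sup>+x. f x * indicator {c..c + real N * \<delta>} x + f x * indicator {c + real N * \<delta><..c + real N * \<delta> + \<delta>} x \<partial>lborel)"
    by (rule nn_integral_add[symmetric]) auto
  also have "\<dots> \<le> (\<integral>\<^sup>+x. f x * indicator {c..c + real (Suc N) * \<delta>} x \<partial>lborel)"
  proof (rule nn_integral_mono)
    fix x
    define z where "z = real N * \<delta>"
    have z: "0 \<le> z" "real (Suc N) * \<delta> = z + \<delta>" using assms(2) by (auto simp: z_def algebra_simps)
    show "f x * indicator {c..c + real N * \<delta>} x + f x * indicator {c + real N * \<delta><..c + real N * \<delta> + \<delta>} x
       \<le> f x * indicator {c..c + real (Suc N) * \<delta>} x"
      unfolding z(2) z_def[symmetric] using z(1) assms(2) by (auto simp: indicator_def)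
  qed
  finally show ?case .
qed simp

lemma energy_int_le_add:
  assumes flow: "gradient_flow (F_energy \<nu>) \<mu>\<^sub>0 w" and \<nu>: "0 \<le> \<nu>"
    and sub: "{a..b} \<subseteq> {c..d} \<union> {e..f}"
  shows "energy_int w a b \<le> energy_int w c d + energy_int w e f"
proof -
  note [measurable] = energy_along_measurable[OF flow \<nu>]
  have "energy_int w c d + energy_int w e f =
    (\<integral>\<^sup>+t. energy_along w t * indicator {c..d} t + energy_along w t * indicator {e..f} t \<partial>lborel)"
    unfolding energy_int_def by (rule nn_integral_add[symmetric]) auto
  also have "\<dots> \<ge> energy_int w a b"
    unfolding energy_int_def using sub by (intro nn_integral_mono) (auto simp: indicator_def)
  finally show ?thesis .
qed

lemma energy_int_self: "energy_int w a a = 0"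
proof -
  have "energy_int w a a = (\<integral>\<^sup>+t. 0 \<partial>(lborel :: real measure))"
    unfolding energy_int_def
    by (rule nn_integral_cong_AE, rule AE_mp[OF AE_lborel_singleton[of a]]) (auto simp: indicator_def)
  then show ?thesis by simp
qed

context two_flows
begin

lemma gap_nonneg: "0 \<le> gap t"
  by (simp add: gap_def)

text \<open>The sample of \<open>u\<close> lies one step later than that of \<open>v\<close>, since
  a step uses \<open>v\<close> at its start and \<open>u\<close> at its end.\<close>

definition sample_sum :: "real \<Rightarrow> nat \<Rightarrow> real \<Rightarrow> ennreal" where
  "sample_sum \<delta> N \<sigma> = (\<Sum>k<N. energy_along v (\<sigma> + real k * \<delta>) + energy_along u (\<sigma> + (\<delta> + real k * \<delta>)))"

lemma gap_iterate:
  assumes \<sigma>: "0 < \<sigma>" and \<delta>: "0 < \<delta>" and r: "0 < r" "r < 1"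
  shows "ennreal (gap (\<sigma> + real N * \<delta>)) + (energy_int v \<sigma> (\<sigma> + real N * \<delta>) + energy_int u \<sigma> (\<sigma> + real N * \<delta>))
    \<le> ennreal (gap \<sigma> + real N * err r \<delta>) + ennreal \<delta> * sample_sum \<delta> N \<sigma>"
proof (induction N)
  case 0
  show ?case by (simp add: energy_int_self)
next
  case (Suc N)
  define s where "s = \<sigma> + real N * \<delta>"
  have s: "0 < s" "\<sigma> \<le> s" "\<sigma> + real (Suc N) * \<delta> = s + \<delta>" using \<sigma> \<delta> by (auto simp: s_def algebra_simps intro: add_pos_nonneg)
  let ?E = "ennreal (err r \<delta>)" and ?S = "ennreal \<delta> * sample_sum \<delta> N \<sigma>"
    and ?e = "ennreal \<delta> * (energy_along v s + energy_along u (s + \<delta>))"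
  have e0: "0 \<le> err r \<delta>" by (rule err_nonneg[OF r]) (use \<delta> in simp)
  have split: "energy_int v \<sigma> (s + \<delta>) \<le> energy_int v \<sigma> s + energy_int v s (s + \<delta>)"
    "energy_int u \<sigma> (s + \<delta>) \<le> energy_int u \<sigma> s + energy_int u s (s + \<delta>)"
    using s \<delta> by (intro energy_int_le_add[OF flow_v] energy_int_le_add[OF flow_u \<nu>(1)]; auto)+
  \<comment> \<open>Since \<open>s > 0\<close>, \<open>energy_along\<close> is the true energy at
    both sample times.\<close>
  have step: "ennreal (gap (s + \<delta>)) + (energy_int v s (s + \<delta>) + energy_int u s (s + \<delta>))
    \<le> ennreal (gap s) + ?E + ?e"
    using gap_step[of s \<delta> r] s \<delta> r e0 by (simp add: energy_along_def gap_nonneg)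
  have "ennreal (gap (s + \<delta>)) + (energy_int v \<sigma> (s + \<delta>) + energy_int u \<sigma> (s + \<delta>))
    \<le> ennreal (gap (s + \<delta>)) + ((energy_int v \<sigma> s + energy_int v s (s + \<delta>)) + (energy_int u \<sigma> s + energy_int u s (s + \<delta>)))"
    by (intro add_mono split order_refl)
  also have "\<dots> = (ennreal (gap (s + \<delta>)) + (energy_int v s (s + \<delta>) + energy_int u s (s + \<delta>))) + (energy_int v \<sigma> s + energy_int u \<sigma> s)"
    by (simp add: add_ac)
  also have "\<dots> \<le> (ennreal (gap s) + ?E + ?e) + (energy_int v \<sigma> s + energy_int u \<sigma> s)"
    by (intro add_right_mono step)
  also have "\<dots> = (ennreal (gap s) + (energy_int v \<sigma> s + energy_int u \<sigma> s)) + (?E + ?e)" by (simp add: add_ac)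
  also have "\<dots> \<le> (ennreal (gap \<sigma> + real N * err r \<delta>) + ?S) + (?E + ?e)"
    using Suc.IH unfolding s_def by (rule add_right_mono)
  also have "\<dots> = (ennreal (gap \<sigma> + real N * err r \<delta>) + ?E) + (?S + ?e)" by (simp add: add_ac)
  also have "ennreal (gap \<sigma> + real N * err r \<delta>) + ?E = ennreal (gap \<sigma> + real N * err r \<delta> + err r \<delta>)"
    using e0 gap_nonneg[of \<sigma>] by (intro ennreal_plus[symmetric]) auto
  also have "gap \<sigma> + real N * err r \<delta> + err r \<delta> = gap \<sigma> + real (Suc N) * err r \<delta>" by (simp add: algebra_simps)
  also have "?S + ?e = ennreal \<delta> * sample_sum \<delta> (Suc N) \<sigma>"
    by (simp add: sample_sum_def s_def distrib_left add_ac)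
  finally show ?case unfolding s(3) .
qed

text \<open>As \<open>\<sigma>\<close> runs through the first cell, each sample time sweeps one cell
  of the grid once. By translation invariance the integrals add up to one over a whole time
  interval, shifted by \<open>\<delta>\<close> for \<open>u\<close>.\<close>

lemma integral_sample_sum:
  assumes \<delta>: "0 < \<delta>"
  shows "(\<integral>\<^sup>+\<sigma>. ennreal \<delta> * sample_sum \<delta> N \<sigma> * indicator {0<..\<delta>} \<sigma> \<partial>lborel)
    \<le> ennreal \<delta> * (energy_int v 0 (real N * \<delta>) + energy_int u \<delta> (\<delta> + real N * \<delta>))"
proof -
  note [measurable] = energy_along_measurable[OF flow_v order_refl] energy_along_measurable[OF flow_u \<nu>(1)]
  have "(\<integral>\<^sup>+\<sigma>. ennreal \<delta> * sample_sum \<delta> N \<sigma> * indicator {0<..\<delta>} \<sigma> \<partial>lborel)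
    = (\<integral>\<^sup>+\<sigma>. ennreal \<delta> * (\<Sum>k<N. energy_along v (\<sigma> + real k * \<delta>) * indicator {0<..\<delta>} \<sigma>
        + energy_along u (\<sigma> + (\<delta> + real k * \<delta>)) * indicator {0<..\<delta>} \<sigma>) \<partial>lborel)"
    by (intro nn_integral_cong) (simp add: sample_sum_def sum_distrib_right distrib_right mult.assoc)
  also have "\<dots> = ennreal \<delta> * (\<Sum>k<N. (\<integral>\<^sup>+\<sigma>. energy_along v (\<sigma> + real k * \<delta>) * indicator {0<..\<delta>} \<sigma> \<partial>lborel)
        + (\<integral>\<^sup>+\<sigma>. energy_along u (\<sigma> + (\<delta> + real k * \<delta>)) * indicator {0<..\<delta>} \<sigma> \<partial>lborel))"
    by (simp add: nn_integral_cmult nn_integral_sum nn_integral_add)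
  also have "\<dots> = ennreal \<delta> * ((\<Sum>k<N. \<integral>\<^sup>+x. energy_along v x * indicator {0 + real k * \<delta><..0 + real k * \<delta> + \<delta>} x \<partial>lborel)
       + (\<Sum>k<N. \<integral>\<^sup>+x. energy_along u x * indicator {\<delta> + real k * \<delta><..\<delta> + real k * \<delta> + \<delta>} x \<partial>lborel))"
    by (simp add: nn_integral_shift_indicator sum.distrib)
  also have "\<dots> \<le> ennreal \<delta> * ((\<integral>\<^sup>+x. energy_along v x * indicator {0..0 + real N * \<delta>} x \<partial>lborel)
       + (\<integral>\<^sup>+x. energy_along u x * indicator {\<delta>..\<delta> + real N * \<delta>} x \<partial>lborel))"
    using \<delta> by (intro mult_left_mono add_mono sum_integral_cells_le) auto
  finally show ?thesis by (simp add: energy_int_def)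
qed

text \<open>Averaging over the offset \<open>\<sigma>\<close> of the time grid turns the Riemann sums of the energies into
  integrals, so that no monotonicity of the energies along the flows is needed.\<close>

lemma gap_bound:
  assumes \<delta>: "0 < \<delta>" and r: "0 < r" "r < 1" and \<epsilon>: "0 < \<epsilon>"
    and v: "energy_int v 0 \<delta> \<le> ennreal \<epsilon>" and u: "energy_int u (real N * \<delta>) (\<delta> + real N * \<delta>) \<le> ennreal \<epsilon>"
  obtains \<sigma> where "0 < \<sigma>" "\<sigma> \<le> \<delta>" "gap (\<sigma> + real N * \<delta>) \<le> gap \<sigma> + real N * err r \<delta> + 3 * \<epsilon>"
proof -
  have N\<delta>: "0 \<le> real N * \<delta>" using \<delta> by simp
  have "energy_int v 0 (real N * \<delta>) + energy_int u \<delta> (\<delta> + real N * \<delta>) < \<infinity>"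
    using energy_int_finite[OF flow_v, of 0 "real N * \<delta>"] energy_int_finite[OF flow_u \<nu>, of \<delta> "\<delta> + real N * \<delta>"] \<delta> N\<delta>
    by (simp add: infinity_ennreal_def)
  from exists_le_mean[OF \<delta> integral_sample_sum[OF \<delta>] this \<epsilon>]
  obtain \<sigma> where \<sigma>: "0 < \<sigma>" "\<sigma> \<le> \<delta>" and S: "ennreal \<delta> * sample_sum \<delta> N \<sigma> \<le>
      energy_int v 0 (real N * \<delta>) + energy_int u \<delta> (\<delta> + real N * \<delta>) + ennreal \<epsilon>" by blast
  let ?J = "energy_int v \<sigma> (\<sigma> + real N * \<delta>) + energy_int u \<sigma> (\<sigma> + real N * \<delta>)"
  have J: "?J < \<infinity>"
    using energy_int_finite[OF flow_v, of \<sigma> "\<sigma> + real N * \<delta>"] energy_int_finite[OF flow_u \<nu>, of \<sigma> "\<sigma> + real N * \<delta>"] \<sigma> N\<delta>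
    by (simp add: infinity_ennreal_def)
  \<comment> \<open>The averaged interval sticks out of the iterated one by at most a cell, at the
    start for \<open>v\<close> and at the end for \<open>u\<close>. Together with the slack of
    \<open>exists_le_mean\<close> this accounts for \<open>3 * \<epsilon>\<close>.\<close>
  have "energy_int v 0 (real N * \<delta>) \<le> energy_int v 0 \<delta> + energy_int v \<sigma> (\<sigma> + real N * \<delta>)"
    by (rule energy_int_le_add[OF flow_v]) (use \<sigma> in auto)
  moreover have "energy_int u \<delta> (\<delta> + real N * \<delta>) \<le> energy_int u \<sigma> (\<sigma> + real N * \<delta>) + energy_int u (real N * \<delta>) (\<delta> + real N * \<delta>)"
    by (rule energy_int_le_add[OF flow_u \<nu>(1)]) (use \<sigma> in auto)
  ultimately have "energy_int v 0 (real N * \<delta>) + energy_int u \<delta> (\<delta> + real N * \<delta>)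
      \<le> (ennreal \<epsilon> + energy_int v \<sigma> (\<sigma> + real N * \<delta>)) + (energy_int u \<sigma> (\<sigma> + real N * \<delta>) + ennreal \<epsilon>)"
    using v u by (meson add_mono order_refl order_trans)
  then have S': "ennreal \<delta> * sample_sum \<delta> N \<sigma> \<le> (ennreal \<epsilon> + energy_int v \<sigma> (\<sigma> + real N * \<delta>)) + (energy_int u \<sigma> (\<sigma> + real N * \<delta>) + ennreal \<epsilon>) + ennreal \<epsilon>"
    by (rule order_trans[OF S add_right_mono])
  have "ennreal (gap (\<sigma> + real N * \<delta>)) + ?J \<le> ennreal (gap \<sigma> + real N * err r \<delta>) + ennreal \<delta> * sample_sum \<delta> N \<sigma>"
    by (rule gap_iterate[OF \<sigma>(1) \<delta> r])
  also have "\<dots> \<le> ennreal (gap \<sigma> + real N * err r \<delta>) +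
     ((ennreal \<epsilon> + energy_int v \<sigma> (\<sigma> + real N * \<delta>)) + (energy_int u \<sigma> (\<sigma> + real N * \<delta>) + ennreal \<epsilon>) + ennreal \<epsilon>)"
    by (rule add_left_mono[OF S'])
  also have "\<dots> = (ennreal (gap \<sigma> + real N * err r \<delta>) + (ennreal \<epsilon> + ennreal \<epsilon> + ennreal \<epsilon>)) + ?J"
    by (simp only: add_ac)
  also have "ennreal (gap \<sigma> + real N * err r \<delta>) + (ennreal \<epsilon> + ennreal \<epsilon> + ennreal \<epsilon>) = ennreal (gap \<sigma> + real N * err r \<delta> + (\<epsilon> + \<epsilon> + \<epsilon>))"
  proof -
    have "ennreal (\<epsilon> + \<epsilon> + \<epsilon>) = ennreal \<epsilon> + ennreal \<epsilon> + ennreal \<epsilon>"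
      using \<epsilon> by (simp only: ennreal_plus add_nonneg_nonneg less_imp_le)
    moreover have "0 \<le> gap \<sigma> + real N * err r \<delta>"
      using gap_nonneg[of \<sigma>] err_nonneg[OF r, of \<delta>] \<delta> by simp
    ultimately show ?thesis
      using \<epsilon> by (simp only: ennreal_plus add_nonneg_nonneg less_imp_le)
  qed
  \<comment> \<open>The common term \<open>?J\<close> can be cancelled because it is finite.\<close>
  finally have "ennreal (gap (\<sigma> + real N * \<delta>)) \<le> ennreal (gap \<sigma> + real N * err r \<delta> + (\<epsilon> + \<epsilon> + \<epsilon>))"
    using J by (simp only: add.commute[of _ ?J] ennreal_add_left_cancel_le infinity_ennreal_def) auto
  then have "gap (\<sigma> + real N * \<delta>) \<le> gap \<sigma> + real N * err r \<delta> + (\<epsilon> + \<epsilon> + \<epsilon>)"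
    using \<epsilon> gap_nonneg[of \<sigma>] err_nonneg[OF r, of \<delta>] \<delta> by (subst (asm) ennreal_le_iff) auto
  with \<sigma> show ?thesis by (intro that) auto
qed

text \<open>At \<open>\<sigma>\<close> both flows are within \<open>\<epsilon>\<close> of their
  common initial measure, so the gap is at most \<open>2 * \<epsilon>\<close>; the accumulated error
  and \<open>gap_bound\<close> add \<open>3 * \<epsilon>\<close> each. A gap of
  \<open>8 * \<epsilon>\<close> means a distance of \<open>4 * sqrt \<epsilon>\<close>, and passing
  from the grid point to \<open>t\<close> costs \<open>\<epsilon> \<le> sqrt \<epsilon>\<close> for
  each flow.\<close>

lemma W_per_flows_le:
  assumes \<delta>: "0 < \<delta>" and r: "0 < r" "r < 1" and \<epsilon>: "0 < \<epsilon>" "\<epsilon> \<le> 1"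
    and mod_u: "\<And>s t. 0 \<le> s \<Longrightarrow> s \<le> t \<Longrightarrow> t \<le> s + \<delta> \<Longrightarrow> W_per (u s) (u t) \<le> \<epsilon> \<and> energy_int u s t \<le> ennreal \<epsilon>"
    and mod_v: "\<And>s t. 0 \<le> s \<Longrightarrow> s \<le> t \<Longrightarrow> t \<le> s + \<delta> \<Longrightarrow> W_per (v s) (v t) \<le> \<epsilon> \<and> energy_int v s t \<le> ennreal \<epsilon>"
    and t: "0 \<le> t" "t \<le> T" and small: "T / \<delta> * err r \<delta> \<le> 3 * \<epsilon>"
  shows "W_per (u t) (v t) \<le> 6 * sqrt \<epsilon>"
proof -
  \<comment> \<open>Both \<open>t\<close> and \<open>\<sigma> + real N * \<delta>\<close> then lie
    between \<open>N * \<delta>\<close> and \<open>(N + 1) * \<delta>\<close>, hence within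
    \<open>\<delta>\<close> of each other.\<close>
  define N where "N = nat \<lfloor>t / \<delta>\<rfloor>"
  have N: "real N * \<delta> \<le> t" "t \<le> \<delta> + real N * \<delta>"
  proof -
    have "0 \<le> t / \<delta>" using t \<delta> by simp
    then have "real N \<le> t / \<delta>" "t / \<delta> \<le> 1 + real N" unfolding N_def by linarith+
    then show "real N * \<delta> \<le> t" "t \<le> \<delta> + real N * \<delta>" using \<delta> by (auto simp: field_simps)
  qed
  have N\<delta>: "0 \<le> real N * \<delta>" using \<delta> by simp
  have e0: "0 \<le> err r \<delta>" by (rule err_nonneg[OF r]) (use \<delta> in simp)
  have "real N \<le> T / \<delta>" using N(1) t \<delta> by (simp add: field_simps)
  then have "real N * err r \<delta> \<le> T / \<delta> * err r \<delta>" using e0 by (rule mult_right_mono)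
  then have N_err: "real N * err r \<delta> \<le> 3 * \<epsilon>" using small by linarith
  obtain \<sigma> where \<sigma>: "0 < \<sigma>" "\<sigma> \<le> \<delta>" "gap (\<sigma> + real N * \<delta>) \<le> gap \<sigma> + real N * err r \<delta> + 3 * \<epsilon>"
    using gap_bound[OF \<delta> r \<epsilon>(1), of N] mod_v[of 0 \<delta>] mod_u[of "real N * \<delta>" "\<delta> + real N * \<delta>"] \<delta> N\<delta> by auto
  have tri: "W_per (u a) (v a) \<le> W_per (u a) (u b) + W_per (u b) (v b) + W_per (v b) (v a)" if "0 \<le> a" "0 \<le> b" for a b
    using W_per_triangle[of "u a" "u b" "v a"] W_per_triangle[of "u b" "v b" "v a"] P_u P_v that by force
  have "u 0 = v 0" using flow_0[OF flow_u \<nu>(1)] flow_0[OF flow_v] by simp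
  then have "W_per (u \<sigma>) (v \<sigma>) \<le> W_per (u \<sigma>) (u 0) + W_per (v 0) (v \<sigma>)"
    using W_per_triangle[of "u \<sigma>" "u 0" "v \<sigma>"] P_u P_v \<sigma> by simp
  also have "\<dots> \<le> \<epsilon> + \<epsilon>"
    using mod_u[of 0 \<sigma>] mod_v[of 0 \<sigma>] \<sigma> W_per_commute[of "u \<sigma>" "u 0"] P_u by (intro add_mono) auto
  finally have "W_per (u \<sigma>) (v \<sigma>) \<le> 2 * \<epsilon>" by simp
  then have "(W_per (u \<sigma>) (v \<sigma>))\<^sup>2 \<le> (2 * \<epsilon>)\<^sup>2"
    using W_per_nonneg[OF P_u P_v] \<sigma> by (intro power_mono) auto
  also have "\<dots> \<le> 4 * \<epsilon>" using \<epsilon> by (simp add: power2_eq_square)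
  finally have "gap \<sigma> \<le> 2 * \<epsilon>" by (simp add: gap_def)
  with \<sigma>(3) N_err have "gap (\<sigma> + real N * \<delta>) \<le> 8 * \<epsilon>" by linarith
  then have "(W_per (u (\<sigma> + real N * \<delta>)) (v (\<sigma> + real N * \<delta>)))\<^sup>2 \<le> 16 * \<epsilon>" by (simp add: gap_def)
  then have "W_per (u (\<sigma> + real N * \<delta>)) (v (\<sigma> + real N * \<delta>)) \<le> sqrt (16 * \<epsilon>)" by (rule real_le_rsqrt)
  also have "\<dots> = 4 * sqrt \<epsilon>" using real_sqrt_mult[of 16 \<epsilon>] by simp
  finally have main: "W_per (u (\<sigma> + real N * \<delta>)) (v (\<sigma> + real N * \<delta>)) \<le> 4 * sqrt \<epsilon>" .
  have "W_per (u t) (u (\<sigma> + real N * \<delta>)) \<le> \<epsilon>" "W_per (v (\<sigma> + real N * \<delta>)) (v t) \<le> \<epsilon>"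
  proof -
    let ?s = "\<sigma> + real N * \<delta>"
    have s: "0 \<le> ?s" using \<sigma> N\<delta> by simp
    consider "t \<le> ?s" "?s \<le> t + \<delta>" | "?s \<le> t" "t \<le> ?s + \<delta>" using N \<sigma> by linarith
    then show "W_per (u t) (u ?s) \<le> \<epsilon>" "W_per (v ?s) (v t) \<le> \<epsilon>"
      using mod_u[of t ?s] mod_v[of t ?s] mod_u[of ?s t] mod_v[of ?s t]
        W_per_commute[OF P_u[of t] P_u[of ?s]] W_per_commute[OF P_v[of t] P_v[of ?s]] s t
      by (cases; auto)+
  qed
  moreover have "\<epsilon> \<le> sqrt \<epsilon>" using \<epsilon> by (intro real_le_rsqrt) (simp add: power2_eq_square mult_le_one mult_left_le)
  ultimately show ?thesis using tri[of t "\<sigma> + real N * \<delta>"] main t \<sigma> N\<delta> by linarith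
qed

end

theorem theorem4p3:
  fixes \<epsilon>\<^sub>0 :: real
    and \<mu>\<^sub>0 :: "real measure"
    and \<mu>\<nu> :: "real \<Rightarrow> real \<Rightarrow> real measure"
    and \<mu> :: "real \<Rightarrow> real measure"
  assumes "\<epsilon>\<^sub>0 > 0"
    and "\<mu>\<^sub>0 \<in> P_S1"
    and "\<And>\<nu>. 0 < \<nu> \<Longrightarrow> \<nu> < \<epsilon>\<^sub>0 \<Longrightarrow> gradient_flow (F_energy \<nu>) \<mu>\<^sub>0 (\<mu>\<nu> \<nu>)"
    and "gradient_flow (F_energy 0) \<mu>\<^sub>0 \<mu>"
  shows "\<forall>T>0. ((\<lambda>\<nu>. SUP t\<in>{0..T}. W_per (\<mu>\<nu> \<nu> t) (\<mu> t)) \<longlongrightarrow> 0) (at_right 0)"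
proof (intro allI impI)
  fix T :: real assume T: "T > 0"
  show "((\<lambda>\<nu>. SUP t\<in>{0..T}. W_per (\<mu>\<nu> \<nu> t) (\<mu> t)) \<longlongrightarrow> 0) (at_right 0)"
  proof (rule tendstoI)
    fix e :: real assume e: "e > 0"
    \<comment> \<open>Chosen to make \<open>6 * sqrt \<epsilon> \<le> e / 2\<close>; the other half
      of \<open>e\<close> keeps the bound strict after the supremum is taken.\<close>
    define \<epsilon> where "\<epsilon> = min 1 ((e / 12)\<^sup>2)"
    have \<epsilon>: "0 < \<epsilon>" "\<epsilon> \<le> 1" using e by (auto simp: \<epsilon>_def)
    have "sqrt \<epsilon> \<le> sqrt ((e / 12)\<^sup>2)" by (rule real_sqrt_le_mono) (simp add: \<epsilon>_def)
    also have "\<dots> = e / 12" using e by simp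
    finally have e_half: "6 * sqrt \<epsilon> \<le> e / 2" by simp
    obtain \<delta> where \<delta>: "\<delta> > 0" and modulus: "\<And>\<nu> \<mu>\<^sub>0 w s t. gradient_flow (F_energy \<nu>) \<mu>\<^sub>0 w \<Longrightarrow> 0 \<le> \<nu> \<Longrightarrow> \<nu> \<le> 1 \<Longrightarrow>
      0 \<le> s \<Longrightarrow> s \<le> t \<Longrightarrow> t \<le> s + \<delta> \<Longrightarrow> W_per (w s) (w t) \<le> \<epsilon> \<and> energy_int w s t \<le> ennreal \<epsilon>"
      using flow_modulus[OF \<epsilon>(1)] by blast
    \<comment> \<open>This is the part of \<open>T / \<delta> * err r \<delta>\<close> free of
      \<nu>. It comes first, since the coefficient of \<nu> in the other part blows up as
      \<open>r\<close> tends to 1.\<close>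
    have "((\<lambda>r. T / \<delta> * (2 * pi * sqrt (18 * (1 - r)) + \<delta> * (- ln r / pi))) \<longlongrightarrow> T / \<delta> * (2 * pi * sqrt (18 * (1 - 1)) + \<delta> * (- ln 1 / pi))) (at_left 1)"
      by (intro tendsto_intros) auto
    then have "\<forall>\<^sub>F r in at_left 1. T / \<delta> * (2 * pi * sqrt (18 * (1 - r)) + \<delta> * (- ln r / pi)) < \<epsilon>"
      using \<epsilon> by (intro order_tendstoD) auto
    moreover have "\<forall>\<^sub>F r in at_left (1::real). r \<in> {0<..<1}" by (rule eventually_at_left_real) simp
    ultimately obtain r where r: "0 < r" "r < 1"
      "T / \<delta> * (2 * pi * sqrt (18 * (1 - r)) + \<delta> * (- ln r / pi)) < \<epsilon>"
      using eventually_happens'[OF trivial_limit_at_left_real[of "1::real"] eventually_conj] by force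
    have "((\<lambda>\<nu>. T / \<delta> * (\<delta> * (\<nu> * (2 * pi / (1 - r) ^ 4) + 2 * pi * \<nu>))) \<longlongrightarrow> T / \<delta> * (\<delta> * (0 * (2 * pi / (1 - r) ^ 4) + 2 * pi * 0))) (at_right 0)"
      using r by (intro tendsto_intros) auto
    then have "\<forall>\<^sub>F \<nu> in at_right 0. T / \<delta> * (\<delta> * (\<nu> * (2 * pi / (1 - r) ^ 4) + 2 * pi * \<nu>)) < \<epsilon>"
      using \<epsilon> by (intro order_tendstoD) auto
    \<comment> \<open>The bound 1 is the range of \<nu> in which \<open>modulus\<close> is
      uniform.\<close>
    moreover have "\<forall>\<^sub>F \<nu> in at_right 0. \<nu> \<in> {0<..<min 1 \<epsilon>\<^sub>0}"
      by (rule eventually_at_right_real) (use assms(1) in simp)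
    ultimately show "\<forall>\<^sub>F \<nu> in at_right 0. dist (SUP t\<in>{0..T}. W_per (\<mu>\<nu> \<nu> t) (\<mu> t)) 0 < e"
    proof eventually_elim
      case (elim \<nu>)
      then have \<nu>: "0 < \<nu>" "\<nu> < \<epsilon>\<^sub>0" "\<nu> < 1" by auto
      interpret two_flows \<nu> \<mu>\<^sub>0 "\<mu>\<nu> \<nu>" \<mu>
        by unfold_locales (use \<nu> assms in auto)
      have "T / \<delta> * err r \<delta> = T / \<delta> * (2 * pi * sqrt (18 * (1 - r)) + \<delta> * (- ln r / pi))
          + T / \<delta> * (\<delta> * (\<nu> * (2 * pi / (1 - r) ^ 4) + 2 * pi * \<nu>))"
        unfolding err_def by (simp only: distrib_left[symmetric] algebra_simps minus_divide_left[symmetric])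
      then have small: "T / \<delta> * err r \<delta> \<le> 3 * \<epsilon>" using r(3) elim(1) \<epsilon> by linarith
      have le: "W_per (\<mu>\<nu> \<nu> t) (\<mu> t) \<le> e / 2" if "t \<in> {0..T}" for t
      proof -
        have "W_per (\<mu>\<nu> \<nu> t) (\<mu> t) \<le> 6 * sqrt \<epsilon>"
          using that \<nu> by (intro W_per_flows_le[OF \<delta> r(1,2) \<epsilon> _ _ _ _ small] modulus[OF flow_u] modulus[OF flow_v]) auto
        then show ?thesis using e_half by linarith
      qed
      have ge: "0 \<le> W_per (\<mu>\<nu> \<nu> t) (\<mu> t)" if "t \<in> {0..T}" for t
        using that by (intro W_per_nonneg P_u P_v) auto
      have "(SUP t\<in>{0..T}. W_per (\<mu>\<nu> \<nu> t) (\<mu> t)) \<le> e / 2"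
        by (rule cSUP_least) (use T le in auto)
      \<comment> \<open>A real supremum is known to be nonnegative only through a member of a set
        that is bounded above; time 0 supplies the member.\<close>
      moreover have "W_per (\<mu>\<nu> \<nu> 0) (\<mu> 0) \<le> (SUP t\<in>{0..T}. W_per (\<mu>\<nu> \<nu> t) (\<mu> t))"
        by (rule cSUP_upper) (use T le in \<open>auto intro!: bdd_aboveI2[where M = "e / 2"]\<close>)
      ultimately show ?case using e T ge[of 0] by (simp add: dist_real_def)
    qed
  qed
qed

end
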